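(* Let $(A_\Omega,B_\Omega)_{\Omega\in\mathcal O}$ be domain-uniformly exponentially stabilizable and $(A_\Omega,C_\Omega)_{\Omega\in\mathcal O}$ be domain-uniformly exponentially detectable, and assume there are constants $C_B,C_C,C_R,\alpha>0$ with $\|B_\Omega\|\le C_B$, $\|C_\Omega\|\le C_C$, $\|R_\Omega\|\le C_R$ and $\|R_\Omega u\|_{U_\Omega}^2\ge\alpha\|u\|^2_{U_\Omega}$ for all $u\in U_\Omega$ and all $\Omega\in\mathcal O$. Then there exists a constant $c>0$ such that for all $T>0$ and all $\Omega\in\mathcal O$ the solution operator $\mathcal M^{-1}$ of the optimality system satisfies $$\|\mathcal M^{-1}\|_{L(W^{1\vee2}_\Omega,W^{2\wedge\infty}_\Omega)}\le c,$$ i.e. every mild solution $z=(x,\lambda)$ of $\mathcal M z=r$ satisfies $\|z\|_{2\wedge\infty}\le c\,\|r\|_{1\vee2}$.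
   Context: $\mathcal O$ is a family of open bounded Lipschitz domains in $\mathbb R^d$. For each $\Omega\in\mathcal O$: $X_\Omega=L^2(\Omega)$, $A_\Omega$ generates a $C_0$-semigroup $(\mathcal T_\Omega(t))_{t\ge0}$ on $X_\Omega$, $U_\Omega,Y_\Omega$ Hilbert spaces, $B_\Omega\in L(U_\Omega,X_\Omega)$, $C_\Omega\in L(X_\Omega,Y_\Omega)$, $R_\Omega\in L(U_\Omega)$, $Q_\Omega=R^*_\Omega R_\Omega$. Domain-uniform notions: a family of $C_0$-semigroups $(\mathcal T_\Omega)_{\Omega\in\mathcal O}$ is domain-uniformly exponentially stable if there are $M,k>0$ with $\|\mathcal T_\Omega(t)\|_{L(X_\Omega)}\le Me^{-kt}$ for all $\Omega\in\mathcal O$, $t\ge0$. $(A_\Omega,B_\Omega)_{\Omega\in\mathcal O}$ is domain-uniformly exponentially stabilizable if there are $K^B_\Omega\in L(X_\Omega,U_\Omega)$ with $\sup_\Omega\|K^B_\Omega\|<\infty$ such that the semigroups generated by $A_\Omega+B_\Omega K^B_\Omega$ form a domain-uniformly exponentially stable family. $(A_\Omega,C_\Omega)_{\Omega\in\mathcal O}$ is domain-uniformly exponentially detectable if $(A^*_\Omega,C^*_\Omega)_{\Omega\in\mathcal O}$ is domain-uniformly exponentially stabilizable. Optimality system: $\mathcal M(x,\lambda)=(C^*Cx-\dot\lambda-A^*\lambda,\ \lambda(T),\ \dot x-Ax-BQ^{-1}B^*\lambda,\ x(0))$, understood in the mild sense: for $r=(r_1,r_2,r_3,r_4)$ with $r_1,r_3\in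 L^1(0,T;X_\Omega)$, $r_2,r_4\in X_\Omega$, $(x,\lambda)\in C(0,T;X_\Omega)^2$ solves $\mathcal M(x,\lambda)=r$ if $x(t)=\mathcal T(t)r_4+\int_0^t\mathcal T(t-s)(BQ^{-1}B^*\lambda(s)+r_3(s))ds$ and $\lambda(t)=\mathcal T(T-t)^*r_2+\int_t^T\mathcal T(s-t)^*(r_1(s)-C^*Cx(s))ds$. Norms: $\|v\|_{2\wedge\infty}=\max\{\|v\|_{L^2(0,T;X)},\|v\|_{C(0,T;X)}\}$, $\|v\|_{1\vee2}=\min\{\|v\|_{L^1(0,T;X)},\|v\|_{L^2(0,T;X)}\}$; $\|r\|_{1\vee2}=(\|r_1\|_{1\vee2}^2+\|r_2\|_X^2+\|r_3\|_{1\vee2}^2+\|r_4\|_X^2)^{1/2}$ on $W^{1\vee2}_\Omega=(L^1(0,T;X_\Omega)\times X_\Omega)^2$; $\|(x,\lambda)\|_{2\wedge\infty}=(\|x\|_{2\wedge\infty}^2+\|\lambda\|_{2\wedge\infty}^2)^{1/2}$ on $W^{2\wedge\infty}_\Omega=C(0,T;X_\Omega)^2$. *)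

theory Defs
  imports "HOL-Analysis.Analysis"
begin

text \<open>A closed linear subspace (the state / control / observation space of one domain).\<close>
definition closed_subspace :: "'a::real_normed_vector set \<Rightarrow> bool" where
  "closed_subspace X \<longleftrightarrow> subspace X \<and> closed X"

definition lin_on :: "'a::real_vector set \<Rightarrow> ('a \<Rightarrow> 'b::real_vector) \<Rightarrow> bool" where
  "lin_on X f \<longleftrightarrow> (\<forall>x\<in>X. \<forall>y\<in>X. \<forall>a::real. f (x + y) = f x + f y \<and> f (a *\<^sub>R x) = a *\<^sub>R f x)"

definition bop :: "'a::real_normed_vector set \<Rightarrow> 'b::real_normed_vector set \<Rightarrow> ('a \<Rightarrow> 'b) \<Rightarrow> bool" where
  "bop X Y f \<longleftrightarrow> (\<forall>x\<in>X. f x \<in> Y) \<and> lin_on X f \<and> (\<exists>M. \<forall>x\<in>X. norm (f x) \<le> M * norm x)"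

definition badj :: "'a::real_inner set \<Rightarrow> 'b::real_inner set \<Rightarrow> ('a \<Rightarrow> 'b) \<Rightarrow> 'b \<Rightarrow> 'a" where
  "badj X Y F y = (SOME v. v \<in> X \<and> (\<forall>x\<in>X. inner (F x) y = inner x v))"

definition sub_inv :: "'a set \<Rightarrow> ('a \<Rightarrow> 'a) \<Rightarrow> 'a \<Rightarrow> 'a" where
  "sub_inv U Q v = (SOME w. w \<in> U \<and> Q w = v)"

definition c0_semigroup :: "'a::real_normed_vector set \<Rightarrow> (real \<Rightarrow> 'a \<Rightarrow> 'a) \<Rightarrow> bool" where
  "c0_semigroup X S \<longleftrightarrow>
     (\<forall>t\<ge>0. bop X X (S t)) \<and>
     (\<forall>x\<in>X. S 0 x = x) \<and>
     (\<forall>s\<ge>0. \<forall>t\<ge>0. \<forall>x\<in>X. S (s + t) x = S s (S t x)) \<and>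
     (\<forall>x\<in>X. ((\<lambda>t. S t x) \<longlongrightarrow> x) (at_right 0))"

definition generates :: "'a::real_normed_vector set \<Rightarrow> 'a set \<Rightarrow> ('a \<Rightarrow> 'a) \<Rightarrow> (real \<Rightarrow> 'a \<Rightarrow> 'a) \<Rightarrow> bool" where
  "generates X D A S \<longleftrightarrow>
     c0_semigroup X S \<and>
     D = {x\<in>X. \<exists>y. ((\<lambda>h. (1 / h) *\<^sub>R (S h x - x)) \<longlongrightarrow> y) (at_right 0)} \<and>
     (\<forall>x\<in>D. ((\<lambda>h. (1 / h) *\<^sub>R (S h x - x)) \<longlongrightarrow> A x) (at_right 0))"

definition uadj_dom :: "'a::real_inner set \<Rightarrow> 'a set \<Rightarrow> ('a \<Rightarrow> 'a) \<Rightarrow> 'a set" where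
  "uadj_dom X D A = {y\<in>X. \<exists>z\<in>X. \<forall>x\<in>D. inner (A x) y = inner x z}"

definition uadj :: "'a::real_inner set \<Rightarrow> 'a set \<Rightarrow> ('a \<Rightarrow> 'a) \<Rightarrow> 'a \<Rightarrow> 'a" where
  "uadj X D A y = (SOME z. z \<in> X \<and> (\<forall>x\<in>D. inner (A x) y = inner x z))"

definition du_exp_stable ::
  "('o \<Rightarrow> 'a::real_normed_vector set) \<Rightarrow> ('o \<Rightarrow> real \<Rightarrow> 'a \<Rightarrow> 'a) \<Rightarrow> bool" where
  "du_exp_stable X S \<longleftrightarrow>
     (\<exists>M k. M > 0 \<and> k > 0 \<and>
        (\<forall>\<Omega> t x. t \<ge> 0 \<longrightarrow> x \<in> X \<Omega> \<longrightarrow> norm (S \<Omega> t x) \<le> M * exp (- k * t) * norm x))"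

definition du_exp_stabilizable ::
  "('o \<Rightarrow> 'a::real_normed_vector set) \<Rightarrow> ('o \<Rightarrow> 'a set) \<Rightarrow> ('o \<Rightarrow> 'a \<Rightarrow> 'a)
   \<Rightarrow> ('o \<Rightarrow> 'b::real_normed_vector set) \<Rightarrow> ('o \<Rightarrow> 'b \<Rightarrow> 'a) \<Rightarrow> bool" where
  "du_exp_stabilizable X D A U B \<longleftrightarrow>
     (\<exists>K CK S.
        (\<forall>\<Omega>. bop (X \<Omega>) (U \<Omega>) (K \<Omega>) \<and> (\<forall>x\<in>X \<Omega>. norm (K \<Omega> x) \<le> CK * norm x)) \<and>
        (\<forall>\<Omega>. generates (X \<Omega>) (D \<Omega>) (\<lambda>x. A \<Omega> x + B \<Omega> (K \<Omega> x)) (S \<Omega>)) \<and>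
        du_exp_stable X S)"

definition du_exp_detectable ::
  "('o \<Rightarrow> 'a::real_inner set) \<Rightarrow> ('o \<Rightarrow> 'a set) \<Rightarrow> ('o \<Rightarrow> 'a \<Rightarrow> 'a)
   \<Rightarrow> ('o \<Rightarrow> 'c::real_inner set) \<Rightarrow> ('o \<Rightarrow> 'a \<Rightarrow> 'c) \<Rightarrow> bool" where
  "du_exp_detectable X D A Y C \<longleftrightarrow>
     du_exp_stabilizable X (\<lambda>\<Omega>. uadj_dom (X \<Omega>) (D \<Omega>) (A \<Omega>)) (\<lambda>\<Omega>. uadj (X \<Omega>) (D \<Omega>) (A \<Omega>))
        Y (\<lambda>\<Omega>. badj (X \<Omega>) (Y \<Omega>) (C \<Omega>))"

definition L1norm :: "real \<Rightarrow> (real \<Rightarrow> 'a::{banach,second_countable_topology}) \<Rightarrow> real" where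
  "L1norm T f = (LINT t:{0..T}|lborel. norm (f t))"

definition L2norm :: "real \<Rightarrow> (real \<Rightarrow> 'a::{banach,second_countable_topology}) \<Rightarrow> real" where
  "L2norm T f = sqrt (LINT t:{0..T}|lborel. (norm (f t))\<^sup>2)"

text \<open>\<open>\<parallel>f\<parallel>_{1\<or>2} = min(\<parallel>f\<parallel>_{L1}, \<parallel>f\<parallel>_{L2})\<close>, with the L2 norm being +infinity if f is not
  square integrable.\<close>
definition norm_1v2 :: "real \<Rightarrow> (real \<Rightarrow> 'a::{banach,second_countable_topology}) \<Rightarrow> real" where
  "norm_1v2 T f =
     (if set_integrable lborel {0..T} (\<lambda>t. (norm (f t))\<^sup>2) then min (L1norm T f) (L2norm T f)
      else L1norm T f)"

definition supnorm :: "real \<Rightarrow> (real \<Rightarrow> 'a::real_normed_vector) \<Rightarrow> real" where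
  "supnorm T f = (SUP t\<in>{0..T}. norm (f t))"

definition norm_2w :: "real \<Rightarrow> (real \<Rightarrow> 'a::{banach,second_countable_topology}) \<Rightarrow> real" where
  "norm_2w T f = max (L2norm T f) (supnorm T f)"

text \<open>Data: state space X, control space U, observation space Y, semigroup S (generated by A),
  B, C, R. Here Q = R* R, the feedback term is B Q^{-1} B*, and C* C.\<close>
definition mild_opt_solution ::
  "'x::{real_inner,banach,second_countable_topology} set \<Rightarrow> 'u::real_inner set \<Rightarrow> 'y::real_inner set
   \<Rightarrow> (real \<Rightarrow> 'x \<Rightarrow> 'x) \<Rightarrow> ('u \<Rightarrow> 'x) \<Rightarrow> ('x \<Rightarrow> 'y) \<Rightarrow> ('u \<Rightarrow> 'u) \<Rightarrow> real
   \<Rightarrow> (real \<Rightarrow> 'x) \<Rightarrow> 'x \<Rightarrow> (real \<Rightarrow> 'x) \<Rightarrow> 'x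
   \<Rightarrow> (real \<Rightarrow> 'x) \<Rightarrow> (real \<Rightarrow> 'x) \<Rightarrow> bool" where
  "mild_opt_solution X U Y S B C R T r1 r2 r3 r4 x lam \<longleftrightarrow>
     continuous_on {0..T} x \<and> continuous_on {0..T} lam \<and>
     (\<forall>t\<in>{0..T}. x t \<in> X \<and> lam t \<in> X) \<and>
     (\<forall>t\<in>{0..T}. x t = S t r4 +
        (LINT s:{0..t}|lborel.
           S (t - s) (B (sub_inv U (\<lambda>u. badj U U R (R u)) (badj U X B (lam s))) + r3 s))) \<and>
     (\<forall>t\<in>{0..T}. lam t = badj X X (S (T - t)) r2 +
        (LINT s:{t..T}|lborel.
           badj X X (S (s - t)) (r1 s - badj X Y C (C (x s)))))"

definition rhs_admissible ::
  "'x::{real_inner,banach,second_countable_topology} set \<Rightarrow> real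
   \<Rightarrow> (real \<Rightarrow> 'x) \<Rightarrow> 'x \<Rightarrow> (real \<Rightarrow> 'x) \<Rightarrow> 'x \<Rightarrow> bool" where
  "rhs_admissible X T r1 r2 r3 r4 \<longleftrightarrow>
     set_integrable lborel {0..T} r1 \<and> set_integrable lborel {0..T} r3 \<and>
     (\<forall>t\<in>{0..T}. r1 t \<in> X \<and> r3 t \<in> X) \<and> r2 \<in> X \<and> r4 \<in> X"

definition rhs_norm :: "real \<Rightarrow> (real \<Rightarrow> 'x::{real_inner,banach,second_countable_topology})
   \<Rightarrow> 'x \<Rightarrow> (real \<Rightarrow> 'x) \<Rightarrow> 'x \<Rightarrow> real" where
  "rhs_norm T r1 r2 r3 r4 =
     sqrt ((norm_1v2 T r1)\<^sup>2 + (norm r2)\<^sup>2 + (norm_1v2 T r3)\<^sup>2 + (norm r4)\<^sup>2)"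

definition sol_norm :: "real \<Rightarrow> (real \<Rightarrow> 'x::{real_inner,banach,second_countable_topology})
   \<Rightarrow> (real \<Rightarrow> 'x) \<Rightarrow> real" where
  "sol_norm T x lam = sqrt ((norm_2w T x)\<^sup>2 + (norm_2w T lam)\<^sup>2)"

end

(* An energy identity, obtained by integrating d/dt <x, lambda>, bounds the L2 norms of C x and of
   w = Q^-1 B* lambda by a product of the norms of the solution and of the data. Detectability
   rewrites the state equation with the exponentially stable semigroup of A + L* C at the price of
   a forcing L* C x, and stabilizability does the same for the costate with (A + B K)* and a forcing
   K* B* lambda; convolution estimates with exponential kernels then bound the solution by the data
   and those two L2 norms, with constants independent of T and of the domain. A quadratic absorption
   argument closes the estimate. The rewriting is done weakly: the perturbed Duhamel formula is
   paired with the mild equation, and Fubini's theorem replaces differentiation of mild solutions. *)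
theory Submission
  imports Defs
begin

section \<open>Operators on closed subspaces\<close>

text \<open>All spaces of the family are closed subspaces of one ambient Hilbert type (zero
  extension, for instance, puts every \<open>L^2(\<Omega>)\<close> into one \<open>L^2\<close>).
  Operators are therefore controlled only on carrier sets, and adjoints and inverses are Hilbert
  choices whose existence and uniqueness have to be secured by a Riesz argument. The obstacle is
  that mild solutions need not be differentiable, and that detectability provides a semigroup
  \<open>V\<close> whose relation to the adjoints of \<open>S\<close> is not given. Duality settles
  both: with \<open>z = x t\<close>, the backward orbit \<open>V (t - s) z\<close> is itself a mild
  costate, and pairing it with \<open>x\<close> produces \<open>(norm z)^2\<close> on one side and a
  factor \<open>norm z\<close> with exponential decay in every term on the other. The costate is
  treated in the same way with a forward orbit of \<open>W\<close>. Independence of the horizon has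
  a single source: the exponential kernel has mass at most \<open>2 / k\<close> on every interval.
  Convolution with it maps both L1 and L2 into both L2 and the bounded functions, which is why a
  minimum norm for the data matches a maximum norm for the solution.\<close>

lemma bop_mem: "bop X Y F \<Longrightarrow> x \<in> X \<Longrightarrow> F x \<in> Y"
  by (simp add: bop_def)

lemma bop_lin: "bop X Y F \<Longrightarrow> lin_on X F"
  by (simp add: bop_def)

lemma lin_on_add: "lin_on X f \<Longrightarrow> x \<in> X \<Longrightarrow> y \<in> X \<Longrightarrow> f (x + y) = f x + f y"
  by (simp add: lin_on_def)

lemma lin_on_scaleR: "lin_on X f \<Longrightarrow> x \<in> X \<Longrightarrow> f (a *\<^sub>R x) = a *\<^sub>R f x"
  by (simp add: lin_on_def)

lemma lin_on_diff:
  assumes "closed_subspace X" "lin_on X f" "x \<in> X" "y \<in> X"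
  shows "f (x - y) = f x - f y"
proof -
  have m: "(-1) *\<^sub>R y \<in> X"
    using assms(1,4) unfolding closed_subspace_def by (blast intro: subspace_scale)
  have "f (x + (-1) *\<^sub>R y) = f x + f ((-1) *\<^sub>R y)"
    using assms(2,3) m by (rule lin_on_add)
  then show ?thesis
    using lin_on_scaleR[OF assms(2,4), of "-1"] by simp
qed

lemma closed_subspace_intros:
  assumes "closed_subspace X"
  shows "0 \<in> X" "x \<in> X \<Longrightarrow> y \<in> X \<Longrightarrow> x + y \<in> X" "x \<in> X \<Longrightarrow> y \<in> X \<Longrightarrow> x - y \<in> X"
    "x \<in> X \<Longrightarrow> a *\<^sub>R x \<in> X" "closed X"
  using assms by (auto simp: closed_subspace_def subspace_0 subspace_add subspace_diff subspace_scale)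

lemma bop_bound:
  assumes "bop X Y F"
  obtains M where "M > 0" "\<And>x. x \<in> X \<Longrightarrow> norm (F x) \<le> M * norm x"
proof -
  obtain M where M: "\<forall>x\<in>X. norm (F x) \<le> M * norm x"
    using assms by (auto simp: bop_def)
  show ?thesis
  proof (rule that[of "max M 1"])
    fix x assume "x \<in> X"
    then show "norm (F x) \<le> max M 1 * norm x"
      using M by (meson max.cobounded1 mult_right_mono norm_ge_zero order_trans)
  qed simp
qed

lemma bop_continuous_on:
  assumes "closed_subspace X" "bop X Y F"
  shows "continuous_on X F"
proof -
  obtain M where M: "M > 0" "\<And>x. x \<in> X \<Longrightarrow> norm (F x) \<le> M * norm x"
    using assms(2) by (rule bop_bound) blast
  have "M-lipschitz_on X F"
  proof (rule lipschitz_onI)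
    fix x y assume "x \<in> X" "y \<in> X"
    then show "dist (F x) (F y) \<le> M * dist x y"
      using M(2)[of "x - y"] assms
      by (simp add: dist_norm lin_on_diff[OF assms(1) bop_lin[OF assms(2)], symmetric] closed_subspace_intros)
  qed (use M in simp)
  then show ?thesis by (rule lipschitz_on_continuous_on)
qed

lemma bop_comp: "bop X Y F \<Longrightarrow> bop Y Z G \<Longrightarrow> bop X Z (\<lambda>x. G (F x))"
proof -
  assume F: "bop X Y F" and G: "bop Y Z G"
  obtain M where M: "M > 0" "\<And>x. x \<in> X \<Longrightarrow> norm (F x) \<le> M * norm x"
    using F by (rule bop_bound) blast
  obtain N where N: "N > 0" "\<And>x. x \<in> Y \<Longrightarrow> norm (G x) \<le> N * norm x"
    using G by (rule bop_bound) blast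
  have "norm (G (F x)) \<le> (N * M) * norm x" if "x \<in> X" for x
  proof -
    have "norm (G (F x)) \<le> N * norm (F x)"
      using N bop_mem[OF F that] by blast
    also have "\<dots> \<le> N * (M * norm x)"
      using N(1) M(2)[OF that] by (intro mult_left_mono) auto
    finally show ?thesis by (simp add: mult.assoc)
  qed
  moreover have "G (F x) \<in> Z" if "x \<in> X" for x by (rule bop_mem[OF G bop_mem[OF F that]])
  moreover have "lin_on X (\<lambda>x. G (F x))"
    unfolding lin_on_def
    using lin_on_add[OF bop_lin[OF F]] lin_on_add[OF bop_lin[OF G]] lin_on_scaleR[OF bop_lin[OF F]]
      lin_on_scaleR[OF bop_lin[OF G]] bop_mem[OF F] by metis
  ultimately show ?thesis unfolding bop_def by blast
qed

section \<open>Riesz representation, adjoints and the inverse of the Gram operator of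
  \<open>R\<close>\<close>

lemma quadratic_nonneg_imp_zero:
  fixes a b :: real
  assumes "\<And>t. t\<^sup>2 * a + 2 * t * b \<ge> 0"
  shows "b = 0"
proof (rule ccontr)
  assume b: "b \<noteq> 0"
  \<comment> \<open>Near \<open>t = 0\<close> the linear term dominates: as
    \<open>a \<le> c\<close>, the expression at \<open>t = -b / c\<close> is at most
    \<open>-(b^2 / c)\<close>.\<close>
  define c where "c = \<bar>a\<bar> + 1"
  have c: "c > 0" "a \<le> c" by (auto simp: c_def)
  have "(-b / c)\<^sup>2 * a + 2 * (-b / c) * b \<ge> 0" by (rule assms)
  moreover have "(-b / c)\<^sup>2 * a \<le> (-b / c)\<^sup>2 * c"
    using c by (intro mult_left_mono) auto
  moreover have "(-b / c)\<^sup>2 * c + 2 * (-b / c) * b = - (b\<^sup>2 / c)"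
    using c by (simp add: power2_eq_square field_simps)
  moreover have "b\<^sup>2 / c > 0" using b c by simp
  ultimately show False by linarith
qed

text \<open>The representer minimises \<open>v \<mapsto> \<parallel>F v\<parallel>\<^sup>2 - 2 \<phi> v\<close> on \<open>X\<close>; by the parallelogram law
  minimising sequences are Cauchy.\<close>
lemma coercive_riesz:
  fixes F :: "'a::{real_inner,banach} \<Rightarrow> 'b::real_inner" and \<phi> :: "'a \<Rightarrow> real"
  assumes X: "closed_subspace X" and F: "bop X Z F" and \<alpha>: "\<alpha> > 0"
    and coer: "\<And>x. x \<in> X \<Longrightarrow> \<alpha> * (norm x)\<^sup>2 \<le> (norm (F x))\<^sup>2"
    and \<phi>: "lin_on X \<phi>" "\<And>x. x \<in> X \<Longrightarrow> \<bar>\<phi> x\<bar> \<le> K * norm x"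
  shows "\<exists>w\<in>X. \<forall>v\<in>X. inner (F w) (F v) = \<phi> v"
proof -
  define J where "J v = (norm (F v))\<^sup>2 - 2 * \<phi> v" for v
  note Fl = bop_lin[OF F]
  note XI = closed_subspace_intros[OF X]
  \<comment> \<open>Completing the square in \<open>norm v\<close> bounds \<open>J\<close> below
    once coercivity and the bound on \<open>\<phi>\<close> are inserted.\<close>
  have bd: "J v \<ge> - (K\<^sup>2 / \<alpha>)" if "v \<in> X" for v
  proof -
    have "0 \<le> \<alpha> * (norm v - K / \<alpha>)\<^sup>2" using \<alpha> by simp
    also have "\<dots> = \<alpha> * (norm v)\<^sup>2 - 2 * (K * norm v) + K\<^sup>2 / \<alpha>"
      using \<alpha> by (simp add: power2_eq_square field_simps)
    finally show ?thesis
      using coer[OF that] \<phi>(2)[OF that] unfolding J_def by linarith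
  qed
  define m where "m = Inf (J ` X)"
  have bdd: "bdd_below (J ` X)" using bd by (auto simp: bdd_below_def)
  have ge: "m \<le> J v" if "v \<in> X" for v
    unfolding m_def by (rule cInf_lower[OF _ bdd]) (use that in blast)
  have "\<exists>v\<in>X. J v < m + 1 / Suc n" for n
  proof -
    have "Inf (J ` X) < m + 1 / Suc n" by (simp add: m_def)
    then show ?thesis using cInf_lessD[of "J ` X"] XI(1) by blast
  qed
  then obtain v where v: "\<And>n. v n \<in> X" "\<And>n. J (v n) < m + 1 / Suc n" by metis
  \<comment> \<open>In the parallelogram law for \<open>F x\<close> and \<open>F y\<close> the
    linear parts cancel against those at the midpoint \<open>?h\<close>. Since \<open>J ?h\<close>
    is at least \<open>m\<close>, two near-minimisers are close by coercivity.\<close>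
  have par: "\<alpha> * (norm (x - y))\<^sup>2 \<le> 2 * (J x + J y - 2 * m)" if xy: "x \<in> X" "y \<in> X" for x y
  proof -
    let ?h = "(1/2) *\<^sub>R (x + y)"
    have h: "?h \<in> X" using xy XI by blast
    have e: "F ?h = (1/2) *\<^sub>R (F x + F y)" "\<phi> ?h = (1/2) * (\<phi> x + \<phi> y)" "F (x - y) = F x - F y"
      using xy XI lin_on_scaleR[OF Fl, of "x + y" "1/2"] lin_on_scaleR[OF \<phi>(1), of "x + y" "1/2"]
        lin_on_add[OF Fl xy] lin_on_add[OF \<phi>(1) xy] lin_on_diff[OF X Fl xy] by auto
    have "(norm (F x))\<^sup>2 + (norm (F y))\<^sup>2 = 2 * (norm ((1/2) *\<^sub>R (F x + F y)))\<^sup>2 + (norm (F x - F y))\<^sup>2 / 2"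
      unfolding power2_norm_eq_inner
      by (simp add: inner_add_left inner_add_right inner_diff_left inner_diff_right field_simps inner_commute)
    then have "(norm (F (x - y)))\<^sup>2 = 2 * (J x + J y - 2 * J ?h)"
      unfolding J_def e by (simp add: field_simps)
    then show ?thesis using coer[of "x - y"] ge[OF h] XI xy by (smt (verit))
  qed
  have "Cauchy v"
  proof (rule metric_CauchyI)
    fix e :: real assume e: "e > 0"
    have "(\<lambda>n. 1 / real (Suc n)) \<longlonglongrightarrow> 0"
      using LIMSEQ_inverse_real_of_nat by (simp add: inverse_eq_divide)
    then have "eventually (\<lambda>n. 1 / real (Suc n) < \<alpha> * e\<^sup>2 / 4) sequentially"
      by (rule order_tendstoD) (use \<alpha> e in simp)
    then obtain N where N: "\<And>n. n \<ge> N \<Longrightarrow> 1 / real (Suc n) < \<alpha> * e\<^sup>2 / 4"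
      by (auto simp: eventually_sequentially)
    show "\<exists>M. \<forall>i\<ge>M. \<forall>j\<ge>M. dist (v i) (v j) < e"
    proof (intro exI allI impI)
      fix i j assume "i \<ge> N" "j \<ge> N"
      then have "1 / real (Suc i) < \<alpha> * e\<^sup>2 / 4" "1 / real (Suc j) < \<alpha> * e\<^sup>2 / 4"
        using N by blast+
      then have "\<alpha> * (norm (v i - v j))\<^sup>2 < \<alpha> * e\<^sup>2"
        using par[OF v(1) v(1), of i j] v(2)[of i] v(2)[of j] by argo
      then have "(norm (v i - v j))\<^sup>2 < e\<^sup>2" using \<alpha> by simp
      then show "dist (v i) (v j) < e"
        unfolding dist_norm using e by (simp add: power_less_imp_less_base)
    qed
  qed
  then obtain w where w: "v \<longlonglongrightarrow> w" using Cauchy_convergent_iff convergent_def by blast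
  have wX: "w \<in> X" using closed_sequentially[OF XI(5) _ w] v(1) by blast
  have \<phi>bop: "bop X UNIV \<phi>" using \<phi> by (auto simp: bop_def)
  have "continuous_on X J"
    unfolding J_def by (intro continuous_intros bop_continuous_on[OF X F] bop_continuous_on[OF X \<phi>bop])
  then have "(\<lambda>n. J (v n)) \<longlonglongrightarrow> J w"
    using continuous_on_tendsto_compose[OF _ w wX] v(1) by simp
  moreover have "(\<lambda>n. m + 1 / real (Suc n)) \<longlonglongrightarrow> m + 0"
    using LIMSEQ_inverse_real_of_nat by (intro tendsto_intros) (simp add: inverse_eq_divide)
  ultimately have "J w \<le> m + 0"
    by (rule LIMSEQ_le) (use v(2) less_imp_le in blast)
  then have Jw: "J w = m" using ge[OF wX] by simp
  \<comment> \<open>Vanishing first variation: \<open>J (w + t u) - J w\<close> is a quadratic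
    polynomial in \<open>t\<close> that stays nonnegative for both signs of
    \<open>t\<close>.\<close>
  have "inner (F w) (F u) = \<phi> u" if u: "u \<in> X" for u
  proof -
    have "t\<^sup>2 * (norm (F u))\<^sup>2 + 2 * t * (inner (F w) (F u) - \<phi> u) \<ge> 0" for t
    proof -
      have m: "w + t *\<^sub>R u \<in> X" using wX u XI by blast
      have e: "F (w + t *\<^sub>R u) = F w + t *\<^sub>R F u" "\<phi> (w + t *\<^sub>R u) = \<phi> w + t * \<phi> u"
        using wX u XI lin_on_scaleR[OF Fl u, of t] lin_on_scaleR[OF \<phi>(1) u, of t]
         lin_on_add[OF Fl wX, of "t *\<^sub>R u"] lin_on_add[OF \<phi>(1) wX, of "t *\<^sub>R u"] by auto
      have "J w \<le> J (w + t *\<^sub>R u)" using ge[OF m] Jw by simp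
      then show ?thesis unfolding J_def e power2_norm_eq_inner
        by (simp add: inner_add_left inner_add_right algebra_simps inner_commute power2_eq_square)
    qed
    then have "inner (F w) (F u) - \<phi> u = 0" by (rule quadratic_nonneg_imp_zero)
    then show ?thesis by simp
  qed
  with wX show ?thesis by blast
qed

lemma inner_eq_on_subspace:
  assumes "closed_subspace X" "v \<in> X" "w \<in> X" "\<And>x. x \<in> X \<Longrightarrow> inner x v = inner x w"
  shows "v = w"
proof -
  have "inner (v - w) (v - w) = 0"
    using assms(4)[of "v - w"] closed_subspace_intros(3)[OF assms(1,2,3)] by (simp add: inner_diff_right)
  then show ?thesis by simp
qed

text \<open>Shows that the choice in \<open>badj\<close> is never vacuous:
  \<open>coercive_riesz\<close> with the identity in place of \<open>F\<close> represents the
  functional \<open>v \<mapsto> inner (F v) y\<close>.\<close>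

lemma badj_props:
  fixes F :: "'a::{real_inner,banach} \<Rightarrow> 'b::real_inner"
  assumes X: "closed_subspace X" and F: "bop X Y F"
  shows "badj X Y F y \<in> X" "x \<in> X \<Longrightarrow> inner (F x) y = inner x (badj X Y F y)"
proof -
  obtain M where M: "M > 0" "\<And>x. x \<in> X \<Longrightarrow> norm (F x) \<le> M * norm x"
    using F by (rule bop_bound) blast
  have "\<exists>w\<in>X. \<forall>v\<in>X. inner w v = inner (F v) y"
  proof (rule coercive_riesz[OF X, where F = "\<lambda>x. x" and \<alpha> = 1 and Z = UNIV and K = "M * norm y"])
    show "bop X UNIV (\<lambda>x. x)" by (auto simp: bop_def lin_on_def intro!: exI[of _ 1])
    show "lin_on X (\<lambda>v. inner (F v) y)"
      using bop_lin[OF F] by (auto simp: lin_on_def inner_add_left)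
    fix x assume "x \<in> X"
    then have "norm (F x) * norm y \<le> M * norm x * norm y"
      using M by (intro mult_right_mono) auto
    then show "\<bar>inner (F x) y\<bar> \<le> M * norm y * norm x"
      using Cauchy_Schwarz_ineq2[of "F x" y] by (simp add: ac_simps)
  qed auto
  then have "\<exists>v. v \<in> X \<and> (\<forall>x\<in>X. inner (F x) y = inner x v)"
    by (metis inner_commute)
  then have "badj X Y F y \<in> X \<and> (\<forall>x\<in>X. inner (F x) y = inner x (badj X Y F y))"
    unfolding badj_def by (rule someI_ex)
  then show "badj X Y F y \<in> X" "x \<in> X \<Longrightarrow> inner (F x) y = inner x (badj X Y F y)" by auto
qed

lemma badj_eqI:
  fixes F :: "'a::{real_inner,banach} \<Rightarrow> 'b::real_inner"
  assumes "closed_subspace X" "bop X Y F" "v \<in> X" "\<And>x. x \<in> X \<Longrightarrow> inner (F x) y = inner x v"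
  shows "badj X Y F y = v"
  using badj_props[OF assms(1,2)] assms(3,4) by (intro inner_eq_on_subspace[OF assms(1)]) metis+

text \<open>Testing the adjoint identity with \<open>badj X Y F y\<close> itself carries the bound
  of \<open>F\<close> over with the same constant, so the uniform bounds on \<open>B\<close>,
  \<open>C\<close> and \<open>R\<close> survive passage to adjoints.\<close>

lemma badj_norm_le:
  fixes F :: "'a::{real_inner,banach} \<Rightarrow> 'b::real_inner"
  assumes "closed_subspace X" "bop X Y F" "M \<ge> 0" "\<And>x. x \<in> X \<Longrightarrow> norm (F x) \<le> M * norm x"
  shows "norm (badj X Y F y) \<le> M * norm y"
proof -
  let ?v = "badj X Y F y"
  note p = badj_props[OF assms(1,2), where y = y]
  have "norm ?v * norm ?v = inner (F ?v) y"
    using p(2)[OF p(1)] by (simp add: power2_norm_eq_inner[symmetric] power2_eq_square)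
  also have "\<dots> \<le> norm (F ?v) * norm y" by (rule norm_cauchy_schwarz)
  also have "\<dots> \<le> M * norm ?v * norm y" using assms(4)[OF p(1)] by (intro mult_right_mono) auto
  finally have "norm ?v * norm ?v \<le> norm ?v * (M * norm y)" by (simp add: ac_simps)
  then show ?thesis using assms(3) by (cases "?v = 0") auto
qed

lemma badj_bop:
  fixes F :: "'a::{real_inner,banach} \<Rightarrow> 'b::real_inner"
  assumes X: "closed_subspace X" and Y: "closed_subspace Y" and F: "bop X Y F"
  shows "bop Y X (badj X Y F)"
proof -
  obtain M where M: "M > 0" "\<And>x. x \<in> X \<Longrightarrow> norm (F x) \<le> M * norm x"
    using F by (rule bop_bound) blast
  note p = badj_props[OF X F]
  note XI = closed_subspace_intros[OF X]
  have "lin_on Y (badj X Y F)"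
    unfolding lin_on_def
    by (auto intro!: badj_eqI[OF X F] XI p(1) simp: inner_add_right p(2))
  with badj_norm_le[OF X F less_imp_le[OF M(1)] M(2)] p(1) show ?thesis
    unfolding bop_def by blast
qed

text \<open>Lax-Milgram for \<open>Q\<close>, the adjoint of \<open>R\<close> composed with
  \<open>R\<close>: solving \<open>Q w = b\<close> means representing
  \<open>v \<mapsto> inner b v\<close> in the form \<open>inner (R w) (R v)\<close>, which is
  \<open>coercive_riesz\<close> with \<open>F = R\<close>. Coercivity also gives the bound
  \<open>1 / \<alpha>\<close> for the inverse.\<close>

lemma sub_inv_gram:
  fixes R :: "'u::{real_inner,banach} \<Rightarrow> 'v::real_inner"
  assumes U: "closed_subspace U" and R: "bop U V R" and \<alpha>: "\<alpha> > 0"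
    and coer: "\<And>u. u \<in> U \<Longrightarrow> \<alpha> * (norm u)\<^sup>2 \<le> (norm (R u))\<^sup>2"
  defines "Qi \<equiv> sub_inv U (\<lambda>u. badj U V R (R u))"
  shows "bop U U Qi" "b \<in> U \<Longrightarrow> badj U V R (R (Qi b)) = b"
    "b \<in> U \<Longrightarrow> inner (Qi b) b = (norm (R (Qi b)))\<^sup>2"
proof -
  note UI = closed_subspace_intros[OF U]
  note p = badj_props[OF U R]
  have ex: "Qi b \<in> U \<and> badj U V R (R (Qi b)) = b" if b: "b \<in> U" for b
  proof -
    have "\<exists>w\<in>U. \<forall>v\<in>U. inner (R w) (R v) = inner b v"
      by (rule coercive_riesz[OF U R \<alpha> coer, where K = "norm b"])
        (auto simp: lin_on_def inner_add_right Cauchy_Schwarz_ineq2)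
    then obtain w where w: "w \<in> U" "\<And>v. v \<in> U \<Longrightarrow> inner (R w) (R v) = inner b v" by blast
    have "badj U V R (R w) = b"
      by (rule badj_eqI[OF U R b]) (metis w(2) inner_commute)
    with w(1) have "\<exists>w. w \<in> U \<and> badj U V R (R w) = b" by blast
    then show ?thesis unfolding Qi_def sub_inv_def by (rule someI_ex)
  qed
  then show "b \<in> U \<Longrightarrow> badj U V R (R (Qi b)) = b" by blast
  have nrm: "inner (Qi b) b = (norm (R (Qi b)))\<^sup>2" if "b \<in> U" for b
    using p(2)[of "Qi b" "R (Qi b)"] ex[OF that] by (simp add: power2_norm_eq_inner)
  then show "b \<in> U \<Longrightarrow> inner (Qi b) b = (norm (R (Qi b)))\<^sup>2" .
  have bnd: "norm (Qi b) \<le> (1 / \<alpha>) * norm b" if "b \<in> U" for b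
  proof -
    have "\<alpha> * (norm (Qi b))\<^sup>2 \<le> inner (Qi b) b" using nrm[OF that] coer ex[OF that] by simp
    also have "\<dots> \<le> norm (Qi b) * norm b" by (rule norm_cauchy_schwarz)
    finally have "norm (Qi b) * (\<alpha> * norm (Qi b)) \<le> norm (Qi b) * norm b"
      by (simp add: power2_eq_square ac_simps)
    then show ?thesis using \<alpha> by (cases "Qi b = 0") (auto simp: field_simps)
  qed
  \<comment> \<open>\<open>Qi\<close> is a choice, so its linearity has to come from uniqueness of
    the preimage, which coercivity supplies.\<close>
  have inj: "v = w" if "v \<in> U" "w \<in> U" "badj U V R (R v) = badj U V R (R w)" for v w
  proof -
    have d: "v - w \<in> U" using that UI by blast
    have "inner (R (v - w)) (R v - R w) = 0"
      using p(2)[OF d, of "R v"] p(2)[OF d, of "R w"] that(3) by (simp add: inner_diff_right)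
    then have "(norm (R (v - w)))\<^sup>2 = 0"
      using lin_on_diff[OF U bop_lin[OF R] that(1,2)] by (simp add: power2_norm_eq_inner)
    then have "\<alpha> * (norm (v - w))\<^sup>2 \<le> 0" using coer[OF d] by simp
    then show ?thesis using \<alpha> by (simp add: mult_le_0_iff)
  qed
  have gl: "lin_on U (\<lambda>u. badj U V R (R u))"
    unfolding lin_on_def
  proof (intro ballI allI conjI badj_eqI[OF U R])
    fix x y z :: 'u and a :: real assume xyz: "x \<in> U" "y \<in> U" "z \<in> U"
    show "inner (R z) (R (x + y)) = inner z (badj U V R (R x) + badj U V R (R y))"
      using lin_on_add[OF bop_lin[OF R] xyz(1,2)] by (simp add: inner_add_right p(2)[OF xyz(3)])
    show "inner (R z) (R (a *\<^sub>R x)) = inner z (a *\<^sub>R badj U V R (R x))"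
      using lin_on_scaleR[OF bop_lin[OF R] xyz(1)] by (simp add: p(2)[OF xyz(3)])
  qed (use p UI in auto)
  have "lin_on U Qi"
    unfolding lin_on_def
  proof (intro ballI allI conjI)
    fix x y :: 'u and a :: real assume xy: "x \<in> U" "y \<in> U"
    have Q: "Qi x \<in> U" "Qi y \<in> U" using ex xy by blast+
    show "Qi (x + y) = Qi x + Qi y"
    proof (rule inj)
      show "badj U V R (R (Qi (x + y))) = badj U V R (R (Qi x + Qi y))"
        unfolding lin_on_add[OF gl Q] using ex xy UI(2)[OF xy] by metis
    qed (simp_all add: ex UI(2,4) Q xy)
    show "Qi (a *\<^sub>R x) = a *\<^sub>R Qi x"
    proof (rule inj)
      show "badj U V R (R (Qi (a *\<^sub>R x))) = badj U V R (R (a *\<^sub>R Qi x))"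
        unfolding lin_on_scaleR[OF gl Q(1)] using ex xy UI(4)[OF xy(1)] by metis
    qed (simp_all add: ex UI(2,4) Q xy)
  qed
  with bnd ex show "bop U U Qi" unfolding bop_def by blast
qed

text \<open>Banach-Steinhaus on a carrier set. Baire's theorem is applied to \<open>X\<close> with
  its subspace topology: the relatively closed sets \<open>A k\<close> cover \<open>X\<close>, so
  one of them contains a relative ball, and linearity spreads its bound to all of
  \<open>X\<close>.\<close>

lemma uniform_boundedness_on:
  fixes X :: "'a::banach set" and F :: "nat \<Rightarrow> 'a \<Rightarrow> 'b::real_normed_vector"
  assumes X: "closed_subspace X" and F: "\<And>n. bop X Y (F n)"
    and bdd: "\<And>x. x \<in> X \<Longrightarrow> bounded (range (\<lambda>n. F n x))"
  shows "\<exists>M. \<forall>n. \<forall>x\<in>X. norm (F n x) \<le> M * norm x"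
proof -
  note XI = closed_subspace_intros[OF X]
  define A where "A k = {x\<in>X. \<forall>n. norm (F n x) \<le> real k}" for k :: nat
  let ?T = "top_of_set X"
  have clA: "closedin ?T (A k)" for k
  proof -
    have "closedin ?T (X \<inter> (\<lambda>x. norm (F n x)) -` {..real k})" for n
      by (intro continuous_closedin_preimage continuous_intros bop_continuous_on[OF X F])
    then have "closedin ?T (\<Inter>n. X \<inter> (\<lambda>x. norm (F n x)) -` {..real k})" by (intro closedin_INT) auto
    moreover have "(\<Inter>n. X \<inter> (\<lambda>x. norm (F n x)) -` {..real k}) = A k" by (auto simp: A_def)
    ultimately show ?thesis by simp
  qed
  have un: "(\<Union>k. A k) = X"
  proof -
    have "\<exists>k. x \<in> A k" if x: "x \<in> X" for x
    proof -
      obtain B where B: "\<And>n. norm (F n x) \<le> B" using bdd[OF x] by (auto simp: bounded_iff)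
      obtain k where "B \<le> real k" using real_arch_simple by blast
      then show ?thesis using B x unfolding A_def by (auto intro: order_trans)
    qed
    then show ?thesis by (auto simp: A_def)
  qed
  have "\<exists>k. ?T interior_of (A k) \<noteq> {}"
  proof (rule ccontr)
    assume a: "\<not> ?thesis"
    have "completely_metrizable_space ?T"
      using completely_metrizable_space_closedin[OF completely_metrizable_space_euclidean, of X] XI(5)
      by simp
    then have "?T interior_of \<Union>(range A) = {}"
      using a clA by (intro Baire_category_alt) auto
    then have "?T interior_of X = {}" using un by simp
    moreover have "?T interior_of X = X" by (metis interior_of_topspace topspace_euclidean_subtopology)
    ultimately show False using XI(1) by blast
  qed
  then obtain k x0 where x0: "x0 \<in> ?T interior_of (A k)" by blast
  then obtain W where W: "openin ?T W" "x0 \<in> W" "W \<subseteq> A k" by (auto simp: interior_of_def)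
  then obtain e where e: "e > 0" "\<And>y. y \<in> X \<Longrightarrow> dist y x0 < e \<Longrightarrow> y \<in> A k"
    unfolding openin_euclidean_subtopology_iff by blast
  have x0X: "x0 \<in> X" using W by (auto simp: A_def)
  have "norm (F n x) \<le> (4 * real k / e) * norm x" if x: "x \<in> X" for n x
  proof (cases "x = 0")
    case True
    then show ?thesis using lin_on_scaleR[OF bop_lin[OF F] XI(1), of n 0] by simp
  next
    case False
    \<comment> \<open>Half the radius, so that \<open>x0 + c x\<close> stays in the ball. Then
      \<open>c (F n x)\<close> is a difference of two values of norm at most \<open>k\<close>, and
      \<open>2 k / c\<close> is the claimed \<open>4 k / e\<close> times
      \<open>norm x\<close>.\<close>
    define c where "c = e / (2 * norm x)"
    have c: "c > 0" using e False by (simp add: c_def)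
    have "x0 + c *\<^sub>R x \<in> A k"
      using e(1) False x x0X XI by (intro e(2)) (auto simp: dist_norm c_def)
    moreover have "x0 \<in> A k" using W by blast
    moreover have "F n (x0 + c *\<^sub>R x) = F n x0 + c *\<^sub>R F n x"
      using lin_on_add[OF bop_lin[OF F] x0X] lin_on_scaleR[OF bop_lin[OF F] x] XI x by metis
    ultimately have "norm (F n x0 + c *\<^sub>R F n x) \<le> real k" "norm (F n x0) \<le> real k"
      by (auto simp: A_def simp flip: \<open>F n (x0 + c *\<^sub>R x) = F n x0 + c *\<^sub>R F n x\<close>)
    then have "norm (c *\<^sub>R F n x) \<le> 2 * real k"
      using norm_triangle_ineq4[of "F n x0 + c *\<^sub>R F n x" "F n x0"] by simp
    then have "c * norm (F n x) \<le> 2 * real k" using c by simp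
    then have "norm (F n x) \<le> 2 * real k / c" using c by (simp add: field_simps)
    also have "\<dots> = (4 * real k / e) * norm x" using e False by (simp add: c_def field_simps)
    finally show ?thesis .
  qed
  then show ?thesis by blast
qed

section \<open>Strongly continuous semigroups\<close>

text \<open>The adjoint of the inclusion of a closed subspace is the orthogonal projection onto
  it.\<close>

lemma projection_subspace:
  fixes X :: "'a::{real_inner,banach} set"
  assumes X: "closed_subspace X"
  shows "bop UNIV X (badj X UNIV (\<lambda>x. x))" "x \<in> X \<Longrightarrow> badj X UNIV (\<lambda>x. x) x = x"
proof -
  have U: "closed_subspace (UNIV :: 'a set)" by (simp add: closed_subspace_def)
  have i: "bop X UNIV (\<lambda>x. x)" by (auto simp: bop_def lin_on_def intro!: exI[of _ 1])
  show "bop UNIV X (badj X UNIV (\<lambda>x. x))" by (rule badj_bop[OF X U i])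
  show "badj X UNIV (\<lambda>x. x) x = x" if "x \<in> X" by (rule badj_eqI[OF X i that]) simp
qed

lemma bop_UNIV_bounded_linear:
  assumes "bop UNIV Y F"
  shows "bounded_linear F"
proof -
  obtain M where M: "M > 0" "\<And>x. x \<in> UNIV \<Longrightarrow> norm (F x) \<le> M * norm x"
    using assms by (rule bop_bound) blast
  show ?thesis
    using lin_on_add[OF bop_lin[OF assms]] lin_on_scaleR[OF bop_lin[OF assms]] M
    by (intro bounded_linear_intro[of F M]) (auto simp: ac_simps)
qed

text \<open>Composition with the projection yields an operator on the whole ambient space, to which
  theorems on integrals of bounded linear images apply.\<close>

lemma bop_extend:
  fixes X :: "'a::{real_inner,banach} set"
  assumes X: "closed_subspace X" and F: "bop X Y F"
  obtains G where "bounded_linear G" "\<And>x. x \<in> X \<Longrightarrow> G x = F x" "\<And>x. G x \<in> Y"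
proof
  let ?P = "badj X UNIV (\<lambda>x. x)"
  note p = projection_subspace[OF X]
  show "bounded_linear (\<lambda>x. F (?P x))" by (rule bop_UNIV_bounded_linear[OF bop_comp[OF p(1) F]])
  show "F (?P x) = F x" if "x \<in> X" for x using p(2)[OF that] by simp
  show "F (?P x) \<in> Y" for x using bop_mem[OF F bop_mem[OF p(1)]] by simp
qed

lemma set_integral_inner_right:
  fixes f :: "real \<Rightarrow> 'x::{real_inner,banach,second_countable_topology}"
  assumes "set_integrable M A f"
  shows "inner q (LINT t:A|M. f t) = (LINT t:A|M. inner q (f t))"
    "set_integrable M A (\<lambda>t. inner q (f t))"
proof -
  have i: "integrable M (\<lambda>t. indicator A t *\<^sub>R f t)" using assms by (simp add: set_integrable_def)
  have e: "inner q (indicator A t *\<^sub>R f t) = indicator A t *\<^sub>R inner q (f t)" for t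
    by simp
  show "inner q (LINT t:A|M. f t) = (LINT t:A|M. inner q (f t))"
    using integral_bounded_linear[OF bounded_linear_inner_right i, of q]
    unfolding set_lebesgue_integral_def e by simp
  show "set_integrable M A (\<lambda>t. inner q (f t))"
    using integrable_bounded_linear[OF bounded_linear_inner_right i, of q]
    unfolding set_integrable_def e by simp
qed

text \<open>Generators are defined by difference quotients; this is the bridge to derivatives,
  one-sided ones included through the set \<open>A\<close>.\<close>

lemma has_vector_derivative_iff_tendsto:
  fixes f :: "real \<Rightarrow> 'a::real_normed_vector"
  shows "(f has_vector_derivative d) (at t within A) \<longleftrightarrow>
    ((\<lambda>s. (1 / (s - t)) *\<^sub>R (f s - f t)) \<longlongrightarrow> d) (at t within A)"
proof -
  have "(f has_vector_derivative d) (at t within A) \<longleftrightarrow>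
    ((\<lambda>s. norm (f s - f t - (s - t) *\<^sub>R d) / norm (s - t)) \<longlongrightarrow> 0) (at t within A)"
    unfolding has_vector_derivative_def has_derivative_iff_norm
    by (simp add: bounded_linear_scaleR_left)
  also have "\<dots> \<longleftrightarrow> ((\<lambda>s. norm ((1 / (s - t)) *\<^sub>R (f s - f t) - d)) \<longlongrightarrow> 0) (at t within A)"
  proof (rule filterlim_cong[OF refl refl])
    show "\<forall>\<^sub>F s in at t within A. norm (f s - f t - (s - t) *\<^sub>R d) / norm (s - t) =
      norm ((1 / (s - t)) *\<^sub>R (f s - f t) - d)"
      unfolding eventually_at_filter
    proof (rule always_eventually, intro allI impI)
      fix s assume "s \<noteq> t" "s \<in> A"
      then have "(1 / (s - t)) *\<^sub>R (f s - f t) - d = (1 / (s - t)) *\<^sub>R (f s - f t - (s - t) *\<^sub>R d)"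
        by (simp add: scaleR_right_diff_distrib)
      then show "norm (f s - f t - (s - t) *\<^sub>R d) / norm (s - t) =
        norm ((1 / (s - t)) *\<^sub>R (f s - f t) - d)" by simp
    qed
  qed
  also have "\<dots> \<longleftrightarrow> ((\<lambda>s. (1 / (s - t)) *\<^sub>R (f s - f t)) \<longlongrightarrow> d) (at t within A)"
    by (simp add: tendsto_norm_zero_iff LIM_zero_iff)
  finally show ?thesis .
qed

lemma c0_semigroupD:
  assumes "c0_semigroup X S"
  shows "t \<ge> 0 \<Longrightarrow> bop X X (S t)" "x \<in> X \<Longrightarrow> S 0 x = x"
    "s \<ge> 0 \<Longrightarrow> t \<ge> 0 \<Longrightarrow> x \<in> X \<Longrightarrow> S (s + t) x = S s (S t x)"
    "t \<ge> 0 \<Longrightarrow> x \<in> X \<Longrightarrow> S t x \<in> X"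
    "x \<in> X \<Longrightarrow> ((\<lambda>t. S t x) \<longlongrightarrow> x) (at 0 within {0..})"
  using assms unfolding c0_semigroup_def bop_def at_within_Ici_at_right by auto

text \<open>If no bound held near 0, there would be times \<open>t n\<close> tending to 0 at which
  it fails. Each orbit converges along them and is bounded there, which contradicts uniform
  boundedness. The semigroup law then propagates the bound from a short interval to
  \<open>T\<close>.\<close>

lemma c0_semigroup_locally_bounded:
  fixes X :: "'x::banach set"
  assumes X: "closed_subspace X" and S: "c0_semigroup X S"
  obtains M where "M > 0" "\<And>t x. 0 \<le> t \<Longrightarrow> t \<le> T \<Longrightarrow> x \<in> X \<Longrightarrow> norm (S t x) \<le> M * norm x"
proof -
  note SD = c0_semigroupD[OF S]
  \<comment> \<open>A single \<open>n\<close> gives both the length of the interval and the bound,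
    so that the negation directly yields a sequence with \<open>t n\<close> tending to 0 and norms
    exceeding every multiple.\<close>
  have "\<exists>n::nat. \<forall>t\<in>{0..1 / Suc n}. \<forall>x\<in>X. norm (S t x) \<le> real n * norm x"
  proof (rule ccontr)
    assume "\<not> ?thesis"
    then have "\<forall>n. \<exists>t x. 0 \<le> t \<and> t \<le> 1 / Suc n \<and> x \<in> X \<and> norm (S t x) > real n * norm x"
      by (metis atLeastAtMost_iff not_le)
    then obtain t x where tx: "\<And>n. 0 \<le> t n" "\<And>n. t n \<le> 1 / Suc n" "\<And>n. x n \<in> X"
      "\<And>n. norm (S (t n) (x n)) > real n * norm (x n)" by metis
    have t0: "t \<longlonglongrightarrow> 0"
      by (rule tendsto_sandwich[OF _ _ tendsto_const LIMSEQ_inverse_real_of_nat])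
        (use tx in \<open>auto simp: inverse_eq_divide\<close>)
    have "bounded (range (\<lambda>n. S (t n) y))" if y: "y \<in> X" for y
    proof -
      have "continuous (at 0 within {0..}) (\<lambda>t. S t y)"
        using SD(5)[OF y] SD(2)[OF y] by (simp add: continuous_within)
      then have "(\<lambda>n. S (t n) y) \<longlonglongrightarrow> S 0 y"
        using t0 tx(1) by (auto simp: continuous_within_sequentially o_def)
      then show ?thesis by (rule convergent_imp_bounded)
    qed
    then obtain M where M: "\<And>n y. y \<in> X \<Longrightarrow> norm (S (t n) y) \<le> M * norm y"
      using uniform_boundedness_on[OF X, of X "\<lambda>n. S (t n)"] SD(1) tx(1) by blast
    obtain n where n: "M \<le> real n" using real_arch_simple by blast
    have "norm (S (t n) (x n)) \<le> real n * norm (x n)"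
      using M[OF tx(3)] n by (meson mult_right_mono norm_ge_zero order_trans)
    with tx(4)[of n] show False by simp
  qed
  then obtain n :: nat where n: "\<And>t x. 0 \<le> t \<Longrightarrow> t \<le> 1 / Suc n \<Longrightarrow> x \<in> X \<Longrightarrow> norm (S t x) \<le> real n * norm x"
    by (meson atLeastAtMost_iff)
  define d where "d = 1 / real (Suc n)"
  have d: "d > 0" by (simp add: d_def)
  \<comment> \<open>The extra 1 makes \<open>K\<close> at least 1, so its powers increase and the
    bound for few steps also serves for many.\<close>
  define K where "K = real n + 1"
  have step: "norm (S t x) \<le> K * norm x" if "0 \<le> t" "t \<le> d" "x \<in> X" for t x
    using n[OF that(1) _ that(3)] that(2) unfolding d_def K_def
    by (smt (verit) mult_right_mono norm_ge_zero)
  have iter: "norm (S t x) \<le> K ^ Suc m * norm x" if "0 \<le> t" "t \<le> real (Suc m) * d" "x \<in> X" for m t x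
    using that
  proof (induction m arbitrary: t x)
    case 0
    then show ?case using step by simp
  next
    case (Suc m)
    show ?case
    proof (cases "t \<le> d")
      case True
      have "norm (S t x) \<le> K * norm x" using step Suc.prems True by blast
      also have "\<dots> \<le> K ^ Suc (Suc m) * norm x"
        by (intro mult_right_mono) (simp_all add: K_def self_le_power del: power_Suc)
      finally show ?thesis .
    next
      case False
      then have "S t x = S d (S (t - d) x)"
        using SD(3)[of d "t - d" x] Suc.prems d by simp
      also have "norm \<dots> \<le> K * norm (S (t - d) x)"
        using step[of d] SD(4)[of "t - d" x] Suc.prems False d by simp
      also have "\<dots> \<le> K * (K ^ Suc m * norm x)"
        using Suc.prems False by (intro mult_left_mono Suc.IH) (auto simp: K_def algebra_simps)
      finally show ?thesis by (simp add: mult.assoc)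
    qed
  qed
  obtain m :: nat where "T / d \<le> real m" using real_arch_simple by blast
  then have m: "T \<le> real (Suc m) * d" using d by (simp add: field_simps)
  show ?thesis
    by (rule that[of "K ^ Suc m"]) (use iter m in \<open>auto simp: K_def simp del: power_Suc intro: order_trans\<close>)
qed

text \<open>Left and right continuity at once: up to sign, \<open>S s x - S t x\<close> is
  \<open>S (min s t)\<close> applied to \<open>S \<bar>s - t\<bar> x - x\<close>, which is small by
  continuity at 0, and \<open>S (min s t)\<close> is locally bounded.\<close>

lemma c0_semigroup_continuous_on:
  fixes X :: "'x::banach set"
  assumes X: "closed_subspace X" and S: "c0_semigroup X S" and x: "x \<in> X"
  shows "continuous_on {0..} (\<lambda>t. S t x)"
  unfolding continuous_on_def
proof
  note SD = c0_semigroupD[OF S]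
  note XI = closed_subspace_intros[OF X]
  fix t :: real assume t: "t \<in> {0..}"
  obtain M where M: "M > 0" "\<And>s x. 0 \<le> s \<Longrightarrow> s \<le> t + 1 \<Longrightarrow> x \<in> X \<Longrightarrow> norm (S s x) \<le> M * norm x"
    using c0_semigroup_locally_bounded[OF X S] by blast
  have ab: "((\<lambda>s. \<bar>s - t\<bar>) \<longlongrightarrow> 0) (at t within {0..})"
    by (intro tendsto_eq_intros) auto
  have "continuous (at 0 within {0..}) (\<lambda>t. S t x)"
    using SD(5)[OF x] SD(2)[OF x] by (simp add: continuous_within)
  then have "((\<lambda>s. S \<bar>s - t\<bar> x) \<longlongrightarrow> S 0 x) (at t within {0..})"
    by (rule continuous_within_tendsto_compose[OF _ _ ab]) auto
  then have "((\<lambda>s. M * norm (S \<bar>s - t\<bar> x - x)) \<longlongrightarrow> M * norm (x - x)) (at t within {0..})"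
    using SD(2)[OF x] by (intro tendsto_intros) simp
  then have lim: "((\<lambda>s. M * norm (S \<bar>s - t\<bar> x - x)) \<longlongrightarrow> 0) (at t within {0..})" by simp
  have "((\<lambda>s. S s x - S t x) \<longlongrightarrow> 0) (at t within {0..})"
  proof (rule Lim_null_comparison[OF _ lim])
    have le: "norm (S s x - S t x) \<le> M * norm (S \<bar>s - t\<bar> x - x)" if s: "0 \<le> s" "s < t + 1" for s
    proof -
      define m where "m = min s t"
      have m: "0 \<le> m" "m \<le> t + 1" using s t by (auto simp: m_def)
      have SX: "S \<bar>s - t\<bar> x \<in> X" using SD(4) x by simp
      have "S m (S \<bar>s - t\<bar> x - x) = S m (S \<bar>s - t\<bar> x) - S m x"
        by (rule lin_on_diff[OF X bop_lin[OF SD(1)[OF m(1)]] SX x])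
      also have "S m (S \<bar>s - t\<bar> x) = S (m + \<bar>s - t\<bar>) x" using SD(3) m x by simp
      also have "m + \<bar>s - t\<bar> = max s t" by (auto simp: m_def)
      finally have "norm (S m (S \<bar>s - t\<bar> x - x)) = norm (S s x - S t x)"
        by (cases "s \<le> t") (auto simp: m_def norm_minus_commute)
      then show ?thesis using M(2)[OF m XI(3)[OF SX x]] by simp
    qed
    have "eventually (\<lambda>s. s < t + 1) (at t within {0..})"
      by (rule order_tendstoD(2)[OF tendsto_ident_at]) simp
    moreover have "eventually (\<lambda>s. s \<in> {0..}) (at t within {0..})"
      by (simp add: eventually_at_filter)
    ultimately show "\<forall>\<^sub>F s in at t within {0..}. norm (S s x - S t x) \<le> M * norm (S \<bar>s - t\<bar> x - x)"
      by eventually_elim (use le in auto)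
  qed
  then show "((\<lambda>s. S s x) \<longlongrightarrow> S t x) (at t within {0..})" by (simp add: LIM_zero_iff)
qed

text \<open>Continuity of single orbits is combined with the local uniform bound, which controls the
  change of the initial value.\<close>

lemma c0_semigroup_jointly_continuous:
  fixes X :: "'x::banach set"
  assumes X: "closed_subspace X" and S: "c0_semigroup X S"
  shows "continuous_on ({0..} \<times> X) (\<lambda>(t, x). S t x)"
  unfolding continuous_on_def
proof
  note SD = c0_semigroupD[OF S]
  note XI = closed_subspace_intros[OF X]
  fix p assume "p \<in> {0::real..} \<times> X"
  then obtain t x where p: "p = (t, x)" and t: "0 \<le> t" and x: "x \<in> X" by auto
  obtain M where M: "M > 0" "\<And>s x. 0 \<le> s \<Longrightarrow> s \<le> t + 1 \<Longrightarrow> x \<in> X \<Longrightarrow> norm (S s x) \<le> M * norm x"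
    using c0_semigroup_locally_bounded[OF X S] by blast
  let ?F = "at (t, x) within {0..} \<times> X"
  have f: "(fst \<longlongrightarrow> t) ?F" "(snd \<longlongrightarrow> x) ?F"
    by (auto intro!: tendsto_eq_intros)
  have inn: "eventually (\<lambda>q. q \<in> {0..} \<times> X) ?F" by (simp add: eventually_at_filter)
  have "((\<lambda>q. S (fst q) x) \<longlongrightarrow> S t x) ?F"
    by (rule continuous_on_tendsto_compose[OF c0_semigroup_continuous_on[OF X S x] f(1)])
      (use t inn in \<open>auto elim: eventually_mono\<close>)
  then have "((\<lambda>q. M * norm (snd q - x) + norm (S (fst q) x - S t x)) \<longlongrightarrow>
      M * norm (x - x) + norm (S t x - S t x)) ?F"
    by (intro tendsto_intros f)
  then have lim: "((\<lambda>q. M * norm (snd q - x) + norm (S (fst q) x - S t x)) \<longlongrightarrow> 0) ?F" by simp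
  have "((\<lambda>q. S (fst q) (snd q) - S t x) \<longlongrightarrow> 0) ?F"
  proof (rule Lim_null_comparison[OF _ lim])
    have le: "norm (S (fst q) (snd q) - S t x) \<le> M * norm (snd q - x) + norm (S (fst q) x - S t x)"
      if q: "q \<in> {0..} \<times> X" "fst q < t + 1" for q
    proof -
      have q': "0 \<le> fst q" "snd q \<in> X" using q by auto
      have "S (fst q) (snd q - x) = S (fst q) (snd q) - S (fst q) x"
        by (rule lin_on_diff[OF X bop_lin[OF SD(1)[OF q'(1)]] q'(2) x])
      then have "norm (S (fst q) (snd q) - S (fst q) x) \<le> M * norm (snd q - x)"
        using M(2)[OF q'(1) _ XI(3)[OF q'(2) x]] q(2) by simp
      then show ?thesis
        using norm_triangle_ineq[of "S (fst q) (snd q) - S (fst q) x" "S (fst q) x - S t x"] by simp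
    qed
    have "eventually (\<lambda>q. fst q < t + 1) ?F"
      by (rule order_tendstoD(2)[OF f(1)]) simp
    with inn show "\<forall>\<^sub>F q in ?F. norm (S (fst q) (snd q) - S t x)
        \<le> M * norm (snd q - x) + norm (S (fst q) x - S t x)"
      by eventually_elim (use le in auto)
  qed
  then show "((\<lambda>(t, x). S t x) \<longlongrightarrow> (\<lambda>(t, x). S t x) p) (at p within {0..} \<times> X)"
    by (simp add: LIM_zero_iff p case_prod_unfold)
qed

lemma tendsto_c0_semigroup:
  fixes X :: "'x::banach set"
  assumes X: "closed_subspace X" and S: "c0_semigroup X S"
    and t: "(t \<longlongrightarrow> t0) F" "0 \<le> t0" "eventually (\<lambda>s. 0 \<le> t s) F"
    and y: "(y \<longlongrightarrow> y0) F" "y0 \<in> X" "eventually (\<lambda>s. y s \<in> X) F"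
  shows "((\<lambda>s. S (t s) (y s)) \<longlongrightarrow> S t0 y0) F"
proof -
  have "((\<lambda>s. (\<lambda>(t, x). S t x) (t s, y s)) \<longlongrightarrow> (\<lambda>(t, x). S t x) (t0, y0)) F"
    by (rule continuous_on_tendsto_compose[OF c0_semigroup_jointly_continuous[OF X S]
          tendsto_Pair[OF t(1) y(1)]])
      (use t y in \<open>auto elim: eventually_elim2\<close>)
  then show ?thesis by simp
qed

section \<open>Generators: invariance of the domain, differentiability of orbits, density\<close>

lemma generatesD:
  assumes "generates X D A S"
  shows "c0_semigroup X S" "x \<in> D \<Longrightarrow> x \<in> X"
    "x \<in> D \<Longrightarrow> ((\<lambda>h. (1 / h) *\<^sub>R (S h x - x)) \<longlongrightarrow> A x) (at_right 0)"
    "x \<in> X \<Longrightarrow> ((\<lambda>h. (1 / h) *\<^sub>R (S h x - x)) \<longlongrightarrow> y) (at_right 0) \<Longrightarrow> x \<in> D"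
  using assms unfolding generates_def by auto

lemma generates_mem:
  fixes X :: "'x::banach set"
  assumes X: "closed_subspace X" and g: "generates X D A S" and x: "x \<in> D"
  shows "A x \<in> X"
proof -
  note SD = c0_semigroupD[OF generatesD(1)[OF g]]
  note XI = closed_subspace_intros[OF X]
  have xX: "x \<in> X" using generatesD(2)[OF g x] .
  show ?thesis
  proof (rule Lim_in_closed_set[OF XI(5) _ _ generatesD(3)[OF g x]])
    have "eventually (\<lambda>h. h > 0) (at_right (0::real))" by (simp add: eventually_at_filter)
    then show "\<forall>\<^sub>F h in at_right 0. (1 / h) *\<^sub>R (S h x - x) \<in> X"
      by eventually_elim (intro XI SD xX, simp)
  qed simp
qed

text \<open>\<open>S t\<close> commutes with \<open>S h\<close>, hence maps the difference quotient
  at \<open>x\<close> to the one at \<open>S t x\<close>; continuity of \<open>S t\<close> passes to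
  the limit.\<close>

lemma generates_invariant:
  fixes X :: "'x::banach set"
  assumes X: "closed_subspace X" and g: "generates X D A S" and x: "x \<in> D" and t: "t \<ge> 0"
  shows "S t x \<in> D" "A (S t x) = S t (A x)"
proof -
  note S = generatesD(1)[OF g]
  note SD = c0_semigroupD[OF S]
  note XI = closed_subspace_intros[OF X]
  have xX: "x \<in> X" using generatesD(2)[OF g x] .
  have ev: "eventually (\<lambda>h. h > 0) (at_right (0::real))" by (simp add: eventually_at_filter)
  have "((\<lambda>h. S t ((1 / h) *\<^sub>R (S h x - x))) \<longlongrightarrow> S t (A x)) (at_right 0)"
    by (rule tendsto_c0_semigroup[OF X S tendsto_const t _ generatesD(3)[OF g x] generates_mem[OF X g x]])
      (use t ev in \<open>auto elim!: eventually_mono intro!: XI SD xX\<close>)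
  moreover have "\<forall>\<^sub>F h in at_right 0. S t ((1 / h) *\<^sub>R (S h x - x)) = (1 / h) *\<^sub>R (S h (S t x) - S t x)"
    using ev
  proof eventually_elim
    fix h :: real assume h: "h > 0"
    then have hX: "S h x \<in> X" using SD(4) xX by simp
    note l = bop_lin[OF SD(1)[OF t]]
    have "S t ((1 / h) *\<^sub>R (S h x - x)) = (1 / h) *\<^sub>R (S t (S h x) - S t x)"
      using lin_on_scaleR[OF l XI(3)[OF hX xX]] lin_on_diff[OF X l hX xX] by simp
    also have "S t (S h x) = S h (S t x)"
      using SD(3)[of t h x] SD(3)[of h t x] h t xX by (simp add: add.commute)
    finally show "S t ((1 / h) *\<^sub>R (S h x - x)) = (1 / h) *\<^sub>R (S h (S t x) - S t x)" .
  qed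
  ultimately have lim: "((\<lambda>h. (1 / h) *\<^sub>R (S h (S t x) - S t x)) \<longlongrightarrow> S t (A x)) (at_right 0)"
    by (rule Lim_transform_eventually)
  then show D: "S t x \<in> D" by (rule generatesD(4)[OF g SD(4)[OF t xX]])
  show "A (S t x) = S t (A x)"
    by (rule tendsto_unique[OF _ generatesD(3)[OF g D] lim]) simp
qed

text \<open>The generator only provides a right derivative at 0. Writing every quotient at
  \<open>t\<close> as \<open>S (min s t)\<close> applied to the quotient at 0 with step
  \<open>\<bar>s - t\<bar>\<close> covers both sides; joint continuity is needed because the time
  \<open>min s t\<close> moves as well.\<close>

lemma generates_has_vector_derivative:
  fixes X :: "'x::banach set"
  assumes X: "closed_subspace X" and g: "generates X D A S" and x: "x \<in> D" and t: "t \<ge> 0"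
  shows "((\<lambda>s. S s x) has_vector_derivative S t (A x)) (at t within {0..})"
  unfolding has_vector_derivative_iff_tendsto
proof (rule Lim_transform_eventually)
  note S = generatesD(1)[OF g]
  note SD = c0_semigroupD[OF S]
  note XI = closed_subspace_intros[OF X]
  have xX: "x \<in> X" using generatesD(2)[OF g x] .
  let ?F = "at t within {0..}"
  let ?q = "\<lambda>h. (1 / h) *\<^sub>R (S h x - x)"
  have inn: "eventually (\<lambda>s. s \<in> {0..} \<and> s \<noteq> t) ?F" by (simp add: eventually_at_filter)
  have "((\<lambda>s. \<bar>s - t\<bar>) \<longlongrightarrow> 0) ?F" by (intro tendsto_eq_intros) auto
  then have ab: "filterlim (\<lambda>s. \<bar>s - t\<bar>) (at_right 0) ?F"
    unfolding filterlim_at using inn by (auto elim: eventually_mono)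
  have mn: "((\<lambda>s. min s t) \<longlongrightarrow> t) ?F"
    by (rule tendsto_eq_intros | simp)+
  show "((\<lambda>s. S (min s t) (?q \<bar>s - t\<bar>)) \<longlongrightarrow> S t (A x)) ?F"
    by (rule tendsto_c0_semigroup[OF X S mn t _
          filterlim_compose[OF generatesD(3)[OF g x] ab] generates_mem[OF X g x]])
      (use t inn in \<open>auto elim!: eventually_mono intro!: XI SD xX\<close>)
  show "\<forall>\<^sub>F s in ?F. S (min s t) (?q \<bar>s - t\<bar>) = (1 / (s - t)) *\<^sub>R (S s x - S t x)"
    using inn
  proof eventually_elim
    fix s assume s: "s \<in> {0..} \<and> s \<noteq> t"
    define m where "m = min s t"
    have m: "m \<ge> 0" using s t by (simp add: m_def)
    have hX: "S \<bar>s - t\<bar> x \<in> X" using SD(4) xX by simp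
    note l = bop_lin[OF SD(1)[OF m]]
    have "S m (?q \<bar>s - t\<bar>) = (1 / \<bar>s - t\<bar>) *\<^sub>R (S m (S \<bar>s - t\<bar> x) - S m x)"
      using lin_on_scaleR[OF l XI(3)[OF hX xX]] lin_on_diff[OF X l hX xX] by simp
    also have "S m (S \<bar>s - t\<bar> x) = S (m + \<bar>s - t\<bar>) x" using SD(3) m xX by simp
    also have "m + \<bar>s - t\<bar> = max s t" by (auto simp: m_def)
    also have "(1 / \<bar>s - t\<bar>) *\<^sub>R (S (max s t) x - S m x) = (1 / (s - t)) *\<^sub>R (S s x - S t x)"
    proof (cases "s < t")
      case True
      have "1 / (s - t) = - (1 / (t - s))" by (metis minus_diff_eq divide_minus_right)
      then have "(1 / (s - t)) *\<^sub>R (S s x - S t x) = (1 / (t - s)) *\<^sub>R (S t x - S s x)"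
        by (metis minus_diff_eq scaleR_minus_left scaleR_minus_right)
      then show ?thesis using True by (simp add: m_def)
    qed (use s in \<open>simp add: m_def\<close>)
    finally show "S (min s t) (?q \<bar>s - t\<bar>) = (1 / (s - t)) *\<^sub>R (S s x - S t x)"
      by (simp add: m_def)
  qed
qed

text \<open>The averages \<open>(1/h) \<integral>\<^sub>0\<^sup>h S(s) x ds\<close> lie in the domain and converge to \<open>x\<close>.\<close>
lemma generator_domain_dense:
  fixes X :: "'x::{real_inner,banach} set"
  assumes X: "closed_subspace X" and g: "generates X D A S"
  shows "X \<subseteq> closure D"
proof
  note S = generatesD(1)[OF g]
  note SD = c0_semigroupD[OF S]
  note XI = closed_subspace_intros[OF X]
  fix x assume x: "x \<in> X"
  define f where "f s = S s x" for s
  define I where "I u = integral {0..u} f" for u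
  have cf: "continuous_on {0..b} f" for b
    unfolding f_def by (rule continuous_on_subset[OF c0_semigroup_continuous_on[OF X S x]]) auto
  have dI: "(I has_vector_derivative f u) (at u within {0..b})" if "u \<in> {0..b}" for u b
    unfolding I_def by (rule integral_has_vector_derivative[OF cf that])
  have I0: "I 0 = 0" by (simp add: I_def)
  have quot: "((\<lambda>h. (1 / h) *\<^sub>R (I (u + h) - I u)) \<longlongrightarrow> f u) (at_right 0)" if u: "u \<ge> 0" for u
  proof -
    have "((\<lambda>s. (1 / (s - u)) *\<^sub>R (I s - I u)) \<longlongrightarrow> f u) (at u within {0..u+1})"
      using dI[of u "u + 1"] u by (simp add: has_vector_derivative_iff_tendsto)
    moreover have "filterlim (\<lambda>h. u + h) (at u within {0..u+1}) (at_right 0)"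
      unfolding filterlim_at
    proof
      have "eventually (\<lambda>h. h > 0 \<and> h < 1) (at_right (0::real))"
        by (simp add: eventually_at_right_field) (meson zero_less_one)
      then show "\<forall>\<^sub>F h in at_right 0. u + h \<in> {0..u + 1} \<and> u + h \<noteq> u"
        by eventually_elim (use u in auto)
    qed (auto intro!: tendsto_eq_intros)
    ultimately show ?thesis by (auto dest: filterlim_compose)
  qed
  have IX: "I h \<in> X \<and> (\<forall>\<tau>\<ge>0. S \<tau> (I h) = I (h + \<tau>) - I \<tau>)" if h: "h \<ge> 0" for h
  proof -
    have int: "(f has_integral I h) {0..h}"
      unfolding I_def using integrable_continuous_real[OF cf] by (rule integrable_integral)
    \<comment> \<open>Moving \<open>S \<tau>\<close> under the integral shifts the orbit by
      \<open>\<tau>\<close>. \<open>S'\<close> is an extension of \<open>S \<tau>\<close> to the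
      ambient space, because it is not yet known that \<open>I h\<close> lies in
      \<open>X\<close>.\<close>
    have lin: "S' (I h) = I (h + \<tau>) - I \<tau>" if "\<tau> \<ge> 0" "bounded_linear S'" "\<And>y. y \<in> X \<Longrightarrow> S' y = S \<tau> y" for S' \<tau>
    proof -
      have "((S' \<circ> f) has_integral S' (I h)) {0..h}"
        by (rule has_integral_linear[OF int that(2)])
      moreover have "((\<lambda>s. f (\<tau> + s)) has_integral I (\<tau> + h) - I (\<tau> + 0)) {0..h}"
      proof (rule fundamental_theorem_of_calculus[OF h])
        fix s assume s: "s \<in> {0..h}"
        have "((I \<circ> (\<lambda>s. \<tau> + s)) has_vector_derivative (1 *\<^sub>R f (\<tau> + s))) (at s within {0..h})"
        proof (rule vector_diff_chain_within)
          show "((+) \<tau> has_vector_derivative 1) (at s within {0..h})"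
            by (auto intro!: derivative_eq_intros)
          show "(I has_vector_derivative f (\<tau> + s)) (at (\<tau> + s) within (+) \<tau> ` {0..h})"
            by (rule has_vector_derivative_within_subset[OF dI[of _ "\<tau> + h"]]) (use s that in auto)
        qed
        then show "((\<lambda>s. I (\<tau> + s)) has_vector_derivative f (\<tau> + s)) (at s within {0..h})"
          by (simp add: o_def)
      qed
      then have "((S' \<circ> f) has_integral I (\<tau> + h) - I (\<tau> + 0)) {0..h}"
      proof (rule has_integral_eq[rotated])
        fix s assume "s \<in> {0..h}"
        then show "f (\<tau> + s) = (S' \<circ> f) s"
          using that(1,3) x SD(3,4) by (simp add: f_def)
      qed
      ultimately show ?thesis
        using has_integral_unique[of "S' \<circ> f"] by (simp add: add.commute)
    qed
    \<comment> \<open>With \<open>\<tau> = 0\<close> the shift formula reads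
      \<open>P (I h) = I h\<close>; as all values of \<open>P\<close> lie in \<open>X\<close>, so
      does \<open>I h\<close>.\<close>
    obtain P :: "'x \<Rightarrow> 'x" where P: "bounded_linear P" "\<And>x. x \<in> X \<Longrightarrow> P x = S 0 x" "\<And>x. P x \<in> X"
      using bop_extend[OF X SD(1)[of 0]] by auto
    have IhX: "I h \<in> X" using lin[OF order_refl P(1,2)] P(3)[of "I h"] I0 by simp
    have "S \<tau> (I h) = I (h + \<tau>) - I \<tau>" if \<tau>: "\<tau> \<ge> 0" for \<tau>
    proof -
      obtain P :: "'x \<Rightarrow> 'x" where P: "bounded_linear P" "\<And>x. x \<in> X \<Longrightarrow> P x = S \<tau> x"
        using bop_extend[OF X SD(1)[OF \<tau>]] by metis
      show ?thesis using lin[OF \<tau> P] P(2)[OF IhX] by simp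
    qed
    with IhX show ?thesis by blast
  qed
  have ID: "(1 / h) *\<^sub>R I h \<in> D" if h: "h > 0" for h
  proof (rule generatesD(4)[OF g])
    show "(1 / h) *\<^sub>R I h \<in> X" using IX h XI by simp
    \<comment> \<open>By the shift formula, the quotient of the average is a difference of two
      quotients of the primitive \<open>I\<close>, one at \<open>h\<close> and one at 0.\<close>
    have "((\<lambda>\<tau>. (1 / h) *\<^sub>R ((1 / \<tau>) *\<^sub>R (I (h + \<tau>) - I h) - (1 / \<tau>) *\<^sub>R (I (0 + \<tau>) - I 0)))
       \<longlongrightarrow> (1 / h) *\<^sub>R (f h - f 0)) (at_right 0)"
      using h by (intro tendsto_intros quot) auto
    moreover have "\<forall>\<^sub>F \<tau> in at_right 0.
      (1 / h) *\<^sub>R ((1 / \<tau>) *\<^sub>R (I (h + \<tau>) - I h) - (1 / \<tau>) *\<^sub>R (I (0 + \<tau>) - I 0)) =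
      (1 / \<tau>) *\<^sub>R (S \<tau> ((1 / h) *\<^sub>R I h) - (1 / h) *\<^sub>R I h)"
    proof -
      have "eventually (\<lambda>h. h > 0) (at_right (0::real))" by (simp add: eventually_at_filter)
      then show ?thesis
      proof eventually_elim
        fix \<tau> :: real assume \<tau>: "\<tau> > 0"
        have e: "S \<tau> ((1 / h) *\<^sub>R I h) = (1 / h) *\<^sub>R (I (h + \<tau>) - I \<tau>)"
          using lin_on_scaleR[OF bop_lin[OF SD(1)], of \<tau> "I h" "1 / h"] IX[of h] \<tau> h by simp
        show "(1 / h) *\<^sub>R ((1 / \<tau>) *\<^sub>R (I (h + \<tau>) - I h) - (1 / \<tau>) *\<^sub>R (I (0 + \<tau>) - I 0)) =
          (1 / \<tau>) *\<^sub>R (S \<tau> ((1 / h) *\<^sub>R I h) - (1 / h) *\<^sub>R I h)"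
          unfolding e by (simp add: I0 algebra_simps)
      qed
    qed
    ultimately show "((\<lambda>\<tau>. (1 / \<tau>) *\<^sub>R (S \<tau> ((1 / h) *\<^sub>R I h) - (1 / h) *\<^sub>R I h))
       \<longlongrightarrow> (1 / h) *\<^sub>R (f h - f 0)) (at_right 0)"
      by (rule Lim_transform_eventually)
  qed
  have "((\<lambda>h. (1 / h) *\<^sub>R I h) \<longlongrightarrow> x) (at_right 0)"
    using quot[of 0] I0 SD(2)[OF x] by (simp add: f_def)
  moreover have "\<forall>\<^sub>F h in at_right 0. (1 / h) *\<^sub>R I h \<in> closure D"
  proof -
    have "eventually (\<lambda>h. h > 0) (at_right (0::real))" by (simp add: eventually_at_filter)
    then show ?thesis by eventually_elim (use ID closure_subset in blast)
  qed
  ultimately show "x \<in> closure D"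
    by (intro Lim_in_closed_set[OF closed_closure _ _ ]) auto
qed

section \<open>Duhamel's formula for perturbed generators\<close>

lemma abs_set_integral_le:
  fixes f :: "'a \<Rightarrow> real"
  assumes "set_integrable M A f" "set_integrable M A g" "\<And>s. s \<in> A \<Longrightarrow> \<bar>f s\<bar> \<le> g s"
  shows "\<bar>LINT s:A|M. f s\<bar> \<le> (LINT s:A|M. g s)"
proof -
  have "\<bar>LINT s:A|M. f s\<bar> \<le> (LINT s:A|M. \<bar>f s\<bar>)"
    using set_integral_norm_bound[OF assms(1)] by simp
  also have "\<dots> \<le> (LINT s:A|M. g s)"
    using assms by (intro set_integral_mono set_integrable_abs) auto
  finally show ?thesis .
qed

lemma abs_set_integral_Icc_le:
  fixes f :: "real \<Rightarrow> real"
  assumes "set_integrable lborel {0..t} f" "t \<ge> 0" "\<And>s. s \<in> {0..t} \<Longrightarrow> \<bar>f s\<bar> \<le> K"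
  shows "\<bar>LINT s:{0..t}|lborel. f s\<bar> \<le> t * K"
proof -
  have "\<bar>LINT s:{0..t}|lborel. f s\<bar> \<le> (LINT s:{0..t}|lborel. K)"
    by (rule abs_set_integral_le[OF assms(1) borel_integrable_atLeastAtMost'])
      (use assms(3) in auto)
  also have "\<dots> = t * K" using assms(2) by (simp add: set_lebesgue_integral_def)
  finally show ?thesis .
qed

text \<open>Extends identities from the domain of a generator to the whole space; \<open>err\<close>
  stands for the difference of their two sides.\<close>

lemma bounded_linear_zero_on_dense:
  fixes err :: "'a::real_normed_vector \<Rightarrow> real"
  assumes X: "closed_subspace X" and l: "lin_on X err" "\<And>x. x \<in> X \<Longrightarrow> \<bar>err x\<bar> \<le> K * norm x"
    and D: "D \<subseteq> X" "X \<subseteq> closure D" "\<And>x. x \<in> D \<Longrightarrow> err x = 0" and x: "x \<in> X"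
  shows "err x = 0"
proof -
  have "bop X UNIV err" using l by (auto simp: bop_def)
  then have "continuous_on X err" by (rule bop_continuous_on[OF X])
  moreover have "closed X" using closed_subspace_intros(5)[OF X] .
  ultimately have "closed {y\<in>X. err y = 0}"
    by (rule continuous_closed_preimage_constant)
  moreover have "D \<subseteq> {y\<in>X. err y = 0}" using D by auto
  ultimately have "closure D \<subseteq> {y\<in>X. err y = 0}" by (rule closure_minimal[rotated])
  with D x show ?thesis by auto
qed

lemma continuous_on_orbit_pairing:
  fixes X :: "'x::banach set" and \<phi> :: "real \<Rightarrow> 'x \<Rightarrow> real"
  assumes X: "closed_subspace X" and N: "c0_semigroup X N" and E: "bop X X E"
    and \<phi>: "continuous_on ({0..} \<times> X) (\<lambda>(\<tau>, y). \<phi> \<tau> y)" and z: "z \<in> X"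
  shows "continuous_on {0..t} (\<lambda>s. \<phi> (t - s) (E (N s z)))"
proof -
  note ND = c0_semigroupD[OF N]
  have 1: "continuous_on {0..t} (\<lambda>s. N s z)"
    by (rule continuous_on_subset[OF c0_semigroup_continuous_on[OF X N z]]) auto
  have 2: "continuous_on {0..t} (\<lambda>s. E (N s z))"
    by (rule continuous_on_compose2[OF bop_continuous_on[OF X E] 1]) (use ND z in auto)
  have "continuous_on {0..t} (\<lambda>s. (t - s, E (N s z)))"
    by (intro continuous_intros 2)
  moreover have "(\<lambda>s. (t - s, E (N s z))) ` {0..t} \<subseteq> {0..} \<times> X"
    using ND z bop_mem[OF E] by auto
  ultimately show ?thesis using continuous_on_compose2[OF \<phi>] by fastforce
qed

text \<open>Applied with \<open>\<phi> \<tau> y = \<langle>S(\<tau>) y, q\<rangle>\<close> when \<open>A\<close> generates \<open>S\<close>, and with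
  \<open>\<phi> \<tau> y = \<langle>S(\<tau>) p, y\<rangle>\<close> when \<open>A\<close> is the adjoint of the generator of \<open>S\<close>.\<close>
lemma duhamel_on_domain:
  fixes X :: "'x::banach set" and \<phi> :: "real \<Rightarrow> 'x \<Rightarrow> real"
  assumes X: "closed_subspace X" and N: "generates X D (\<lambda>x. A x + E x) N" and E: "bop X X E"
    and \<phi>c: "continuous_on ({0..} \<times> X) (\<lambda>(\<tau>, y). \<phi> \<tau> y)"
    and \<phi>l: "\<And>\<tau>. \<tau> \<ge> 0 \<Longrightarrow> lin_on X (\<phi> \<tau>)"
    and \<phi>d: "\<And>\<tau> y. \<tau> \<ge> 0 \<Longrightarrow> y \<in> D \<Longrightarrow>
      ((\<lambda>s. \<phi> s y) has_vector_derivative \<phi> \<tau> (A y)) (at \<tau> within {0..})"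
    and z: "z \<in> D" and t: "t \<ge> 0"
  shows "\<phi> 0 (N t z) - \<phi> t z = (LINT s:{0..t}|lborel. \<phi> (t - s) (E (N s z)))"
proof -
  note XI = closed_subspace_intros[OF X]
  note Ns = generatesD(1)[OF N]
  note ND = c0_semigroupD[OF Ns]
  have zX: "z \<in> X" using generatesD(2)[OF N z] .
  \<comment> \<open>\<open>F\<close> joins \<open>\<phi> t z\<close> at \<open>s = 0\<close> to
    \<open>\<phi> 0 (N t z)\<close> at \<open>s = t\<close>. In its derivative the contributions of
    \<open>A\<close> from the two factors cancel and only the perturbation \<open>E\<close>
    remains.\<close>
  define F where "F s = \<phi> (t - s) (N s z)" for s
  have der: "(F has_vector_derivative \<phi> (t - s) (E (N s z))) (at s within {0..t})"
    if s: "0 \<le> s" "s \<le> t" for s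
    unfolding has_vector_derivative_iff_tendsto
  proof -
    let ?F = "at s within {0..t}"
    define y where "y = N s z"
    define G where "G = A y + E y"
    have yD: "y \<in> D" and Ny: "G = N s (A z + E z)"
      using generates_invariant[OF X N z s(1)] by (simp_all add: y_def G_def)
    have yX: "y \<in> X" using generatesD(2)[OF N yD] .
    have GX: "G \<in> X" using generates_mem[OF X N yD] by (simp add: G_def)
    have EX: "E y \<in> X" using bop_mem[OF E yX] .
    \<comment> \<open>No hypothesis places values of \<open>A\<close> alone in \<open>X\<close>;
      only the perturbed operator is a generator here, so \<open>A y\<close> is recovered as
      \<open>G - E y\<close>.\<close>
    have AX: "A y \<in> X" using XI(3)[OF GX EX] by (simp add: G_def)
    have inn: "eventually (\<lambda>s'. s' \<in> {0..t} \<and> s' \<noteq> s) ?F" by (simp add: eventually_at_filter)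
    have "((\<lambda>s. N s z) has_vector_derivative G) (at s within {0..t})"
      unfolding Ny
      by (rule has_vector_derivative_within_subset[OF generates_has_vector_derivative[OF X N z s(1)]]) auto
    then have q: "((\<lambda>s'. (1 / (s' - s)) *\<^sub>R (N s' z - y)) \<longlongrightarrow> G) ?F"
      by (simp add: has_vector_derivative_iff_tendsto y_def)
    \<comment> \<open>Product rule by hand: in the first part both arguments of
      \<open>\<phi>\<close> vary with \<open>s'\<close>, so joint continuity is used; in the second
      only the time varies.\<close>
    have "((\<lambda>s'. (t - s', (1 / (s' - s)) *\<^sub>R (N s' z - y))) \<longlongrightarrow> (t - s, G)) ?F"
      by (intro tendsto_intros q)
    moreover have "\<forall>\<^sub>F s' in ?F. (t - s', (1 / (s' - s)) *\<^sub>R (N s' z - y)) \<in> {0..} \<times> X"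
      using inn by eventually_elim (use ND(4) yX zX in \<open>auto intro!: XI(3,4)\<close>)
    ultimately have "((\<lambda>s'. \<phi> (t - s') ((1 / (s' - s)) *\<^sub>R (N s' z - y))) \<longlongrightarrow> \<phi> (t - s) G) ?F"
      using continuous_on_tendsto_compose[OF \<phi>c] s GX by fastforce
    moreover have "((\<lambda>s'. (1 / (s' - s)) *\<^sub>R (\<phi> (t - s') y - \<phi> (t - s) y)) \<longlongrightarrow> - \<phi> (t - s) (A y)) ?F"
    proof -
      have "((\<lambda>\<sigma>. \<phi> \<sigma> y) \<circ> (\<lambda>s. t - s) has_vector_derivative ((-1) *\<^sub>R \<phi> (t - s) (A y))) ?F"
      proof (rule vector_diff_chain_within)
        show "((-) t has_vector_derivative - 1) ?F" by (auto intro!: derivative_eq_intros)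
        show "((\<lambda>\<sigma>. \<phi> \<sigma> y) has_vector_derivative \<phi> (t - s) (A y)) (at (t - s) within (-) t ` {0..t})"
          by (rule has_vector_derivative_within_subset[OF \<phi>d[OF _ yD]]) (use s in auto)
      qed
      then show ?thesis by (simp add: has_vector_derivative_iff_tendsto o_def)
    qed
    ultimately have lim: "((\<lambda>s'. \<phi> (t - s') ((1 / (s' - s)) *\<^sub>R (N s' z - y)) +
        (1 / (s' - s)) *\<^sub>R (\<phi> (t - s') y - \<phi> (t - s) y)) \<longlongrightarrow> \<phi> (t - s) G + - \<phi> (t - s) (A y)) ?F"
      by (rule tendsto_add)
    have eq: "\<phi> (t - s) G + - \<phi> (t - s) (A y) = \<phi> (t - s) (E y)"
      using lin_on_add[OF \<phi>l AX EX, of "t - s"] s by (simp add: G_def)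
    have ev: "\<forall>\<^sub>F s' in ?F. \<phi> (t - s') ((1 / (s' - s)) *\<^sub>R (N s' z - y)) +
        (1 / (s' - s)) *\<^sub>R (\<phi> (t - s') y - \<phi> (t - s) y) = (1 / (s' - s)) *\<^sub>R (F s' - F s)"
      using inn
    proof eventually_elim
      fix s' assume s': "s' \<in> {0..t} \<and> s' \<noteq> s"
      then have NX: "N s' z \<in> X" using ND(4) zX by simp
      have l: "lin_on X (\<phi> (t - s'))" using \<phi>l s' by simp
      have "\<phi> (t - s') ((1 / (s' - s)) *\<^sub>R (N s' z - y)) =
        (1 / (s' - s)) *\<^sub>R (\<phi> (t - s') (N s' z) - \<phi> (t - s') y)"
        using lin_on_scaleR[OF l XI(3)[OF NX yX]] lin_on_diff[OF X l NX yX] by simp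
      then show "\<phi> (t - s') ((1 / (s' - s)) *\<^sub>R (N s' z - y)) +
        (1 / (s' - s)) *\<^sub>R (\<phi> (t - s') y - \<phi> (t - s) y) = (1 / (s' - s)) *\<^sub>R (F s' - F s)"
        unfolding F_def y_def[symmetric] by (simp only: scaleR_add_right[symmetric]) simp
    qed
    show "((\<lambda>s'. (1 / (s' - s)) *\<^sub>R (F s' - F s)) \<longlongrightarrow> \<phi> (t - s) (E (N s z))) ?F"
      using Lim_transform_eventually[OF lim ev] unfolding eq y_def[symmetric] .
  qed
  have "(LINT s:{0..t}|lborel. \<phi> (t - s) (E (N s z))) = F t - F 0"
    unfolding set_lebesgue_integral_def
    by (rule integral_FTC_Icc[OF t der continuous_on_orbit_pairing[OF X Ns E \<phi>c zX]])
  then show ?thesis using ND(2)[OF zX] by (simp add: F_def)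
qed

text \<open>Both sides are bounded linear in \<open>z\<close>, by the bound \<open>K\<close> on
  \<open>\<phi>\<close> and local bounds on \<open>N\<close> and \<open>E\<close>, and they agree on
  the dense domain of the generator of \<open>N\<close>.\<close>

lemma duhamel:
  fixes X :: "'x::{real_inner,banach} set" and \<phi> :: "real \<Rightarrow> 'x \<Rightarrow> real"
  assumes X: "closed_subspace X" and N: "generates X D (\<lambda>x. A x + E x) N" and E: "bop X X E"
    and \<phi>c: "continuous_on ({0..} \<times> X) (\<lambda>(\<tau>, y). \<phi> \<tau> y)"
    and \<phi>l: "\<And>\<tau>. \<tau> \<ge> 0 \<Longrightarrow> lin_on X (\<phi> \<tau>)"
    and \<phi>d: "\<And>\<tau> y. \<tau> \<ge> 0 \<Longrightarrow> y \<in> D \<Longrightarrow>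
      ((\<lambda>s. \<phi> s y) has_vector_derivative \<phi> \<tau> (A y)) (at \<tau> within {0..})"
    and \<phi>b: "\<And>\<tau> y. 0 \<le> \<tau> \<Longrightarrow> \<tau> \<le> t \<Longrightarrow> y \<in> X \<Longrightarrow> \<bar>\<phi> \<tau> y\<bar> \<le> K * norm y" and K: "K \<ge> 0"
    and z: "z \<in> X" and t: "t \<ge> 0"
  shows "\<phi> 0 (N t z) - \<phi> t z = (LINT s:{0..t}|lborel. \<phi> (t - s) (E (N s z)))"
proof -
  note XI = closed_subspace_intros[OF X]
  note Ns = generatesD(1)[OF N]
  note ND = c0_semigroupD[OF Ns]
  note ci = borel_integrable_atLeastAtMost'[OF continuous_on_orbit_pairing[OF X Ns E \<phi>c]]
  define err where "err z = \<phi> 0 (N t z) - \<phi> t z - (LINT s:{0..t}|lborel. \<phi> (t - s) (E (N s z)))" for z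
  obtain M where M: "M > 0" "\<And>s x. 0 \<le> s \<Longrightarrow> s \<le> t \<Longrightarrow> x \<in> X \<Longrightarrow> norm (N s x) \<le> M * norm x"
    using c0_semigroup_locally_bounded[OF X Ns] by blast
  obtain e where e: "e > 0" "\<And>x. x \<in> X \<Longrightarrow> norm (E x) \<le> e * norm x"
    using E by (rule bop_bound) blast
  have lin: "lin_on X err"
    unfolding lin_on_def
  proof (intro ballI allI conjI)
    fix x y :: 'x and a :: real assume xy: "x \<in> X" "y \<in> X"
    have Na: "N s (x + y) = N s x + N s y" "N s (a *\<^sub>R x) = a *\<^sub>R N s x" if "s \<ge> 0" for s
      using lin_on_add[OF bop_lin[OF ND(1)] xy] lin_on_scaleR[OF bop_lin[OF ND(1)] xy(1)] that by auto
    have NX: "N s x \<in> X" "N s y \<in> X" "E (N s x) \<in> X" "E (N s y) \<in> X" if "s \<ge> 0" for s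
      using ND(4) that xy bop_mem[OF E] by auto
    have "(LINT s:{0..t}|lborel. \<phi> (t - s) (E (N s (x + y)))) =
        (LINT s:{0..t}|lborel. \<phi> (t - s) (E (N s x)) + \<phi> (t - s) (E (N s y)))"
      by (rule set_lebesgue_integral_cong)
        (auto simp: Na lin_on_add[OF bop_lin[OF E]] lin_on_add[OF \<phi>l] NX)
    also have "\<dots> = (LINT s:{0..t}|lborel. \<phi> (t - s) (E (N s x))) + (LINT s:{0..t}|lborel. \<phi> (t - s) (E (N s y)))"
      by (rule set_integral_add(2)[OF ci[OF xy(1)] ci[OF xy(2)]])
    finally show "err (x + y) = err x + err y"
      using t xy by (simp add: err_def Na lin_on_add[OF \<phi>l] NX)
    have "(LINT s:{0..t}|lborel. \<phi> (t - s) (E (N s (a *\<^sub>R x)))) =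
        (LINT s:{0..t}|lborel. a * \<phi> (t - s) (E (N s x)))"
      by (rule set_lebesgue_integral_cong)
        (auto simp: Na lin_on_scaleR[OF bop_lin[OF E]] lin_on_scaleR[OF \<phi>l] NX)
    then show "err (a *\<^sub>R x) = a *\<^sub>R err x"
      using t xy by (simp add: err_def Na lin_on_scaleR[OF \<phi>l] NX algebra_simps)
  qed
  show ?thesis
  proof -
    have "err z = 0"
    proof (rule bounded_linear_zero_on_dense[OF X lin _ _ generator_domain_dense[OF X N] _ z])
      fix x assume x: "x \<in> X"
      have NX: "N s x \<in> X" "E (N s x) \<in> X" if "s \<ge> 0" for s
        using ND(4) that x bop_mem[OF E] by auto
      have "\<bar>\<phi> (t - s) (E (N s x))\<bar> \<le> K * (e * (M * norm x))" if s: "s \<in> {0..t}" for s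
      proof -
        have "\<bar>\<phi> (t - s) (E (N s x))\<bar> \<le> K * norm (E (N s x))" using s \<phi>b NX by simp
        also have "\<dots> \<le> K * (e * norm (N s x))"
          using s K e(2)[OF NX(1)] by (intro mult_left_mono) auto
        also have "\<dots> \<le> K * (e * (M * norm x))"
          using s K e(1) M(2) x by (intro mult_left_mono) auto
        finally show ?thesis .
      qed
      from abs_set_integral_Icc_le[OF ci[OF x] t this]
      have "\<bar>LINT s:{0..t}|lborel. \<phi> (t - s) (E (N s x))\<bar> \<le> t * (K * (e * (M * norm x)))" by simp
      moreover have "\<bar>\<phi> 0 (N t x)\<bar> \<le> K * (M * norm x)"
        using \<phi>b[of 0 "N t x"] NX[OF t] t K mult_left_mono[OF M(2)[of t x], of K] x by simp
      moreover have "\<bar>\<phi> t x\<bar> \<le> K * norm x" using \<phi>b t x by simp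
      ultimately have "\<bar>err x\<bar> \<le> t * (K * (e * (M * norm x))) + K * (M * norm x) + K * norm x"
        unfolding err_def by linarith
      then show "\<bar>err x\<bar> \<le> (t * (K * (e * M)) + K * M + K) * norm x" by (simp add: algebra_simps)
    next
      show "D \<subseteq> X" using generatesD(2)[OF N] by blast
    next
      fix x assume "x \<in> D"
      then show "err x = 0"
        unfolding err_def using duhamel_on_domain[OF X N E \<phi>c \<phi>l \<phi>d _ t] by simp
    qed
    then show ?thesis by (simp add: err_def)
  qed
qed

text \<open>Here \<open>\<phi> \<tau> y = inner (S \<tau> y) q\<close>. It is differentiable on the
  domain of the generator of \<open>W\<close> because that domain coincides with the domain of
  \<open>A\<close>.\<close>

lemma duhamel_perturbed_semigroup:
  fixes X :: "'x::{real_inner,banach} set"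
  assumes X: "closed_subspace X" and S: "generates X D A S"
    and W: "generates X D (\<lambda>x. A x + E x) W" and E: "bop X X E"
    and p: "p \<in> X" and t: "t \<ge> 0"
  shows "inner (W t p) q - inner (S t p) q = (LINT s:{0..t}|lborel. inner (S (t - s) (E (W s p))) q)"
proof -
  note Ss = generatesD(1)[OF S]
  note SD = c0_semigroupD[OF Ss]
  obtain M where M: "M > 0" "\<And>s x. 0 \<le> s \<Longrightarrow> s \<le> t \<Longrightarrow> x \<in> X \<Longrightarrow> norm (S s x) \<le> M * norm x"
    using c0_semigroup_locally_bounded[OF X Ss] by blast
  have "inner (S 0 (W t p)) q - inner (S t p) q = (LINT s:{0..t}|lborel. inner (S (t - s) (E (W s p))) q)"
  proof (rule duhamel[OF X W E, where \<phi> = "\<lambda>\<tau> y. inner (S \<tau> y) q" and K = "M * norm q"])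
    show "continuous_on ({0..} \<times> X) (\<lambda>(\<tau>, y). inner (S \<tau> y) q)"
      using continuous_on_inner[OF c0_semigroup_jointly_continuous[OF X Ss] continuous_on_const, of q]
      by (simp add: case_prod_unfold)
    show "lin_on X (\<lambda>y. inner (S \<tau> y) q)" if "\<tau> \<ge> 0" for \<tau>
      using bop_lin[OF SD(1)[OF that]] by (simp add: lin_on_def inner_add_left)
    show "((\<lambda>s. inner (S s y) q) has_vector_derivative inner (S \<tau> (A y)) q) (at \<tau> within {0..})"
      if "\<tau> \<ge> 0" "y \<in> D" for \<tau> y
      by (rule bounded_linear.has_vector_derivative[OF bounded_linear_inner_left
            generates_has_vector_derivative[OF X S that(2,1)]])
    show "\<bar>inner (S \<tau> y) q\<bar> \<le> M * norm q * norm y" if "0 \<le> \<tau>" "\<tau> \<le> t" "y \<in> X" for \<tau> y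
      using Cauchy_Schwarz_ineq2[of "S \<tau> y" q] mult_right_mono[OF M(2)[OF that], of "norm q"]
      by (simp add: ac_simps)
  qed (use M p t in auto)
  then show ?thesis
    using SD(2) c0_semigroupD(4)[OF generatesD(1)[OF W] t p] by simp
qed

lemma uadj_inner:
  assumes "y \<in> uadj_dom X D A"
  shows "uadj X D A y \<in> X" "x \<in> D \<Longrightarrow> inner (A x) y = inner x (uadj X D A y)"
proof -
  have "\<exists>z. z \<in> X \<and> (\<forall>x\<in>D. inner (A x) y = inner x z)"
    using assms by (auto simp: uadj_dom_def)
  then have "uadj X D A y \<in> X \<and> (\<forall>x\<in>D. inner (A x) y = inner x (uadj X D A y))"
    unfolding uadj_def by (rule someI_ex)
  then show "uadj X D A y \<in> X" "x \<in> D \<Longrightarrow> inner (A x) y = inner x (uadj X D A y)" by auto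
qed

text \<open>Here \<open>\<phi> \<tau> y = inner (S \<tau> p) y\<close>. For \<open>p\<close> in
  \<open>D\<close>, the derivative \<open>inner (A (S \<tau> p)) y\<close> becomes
  \<open>inner (S \<tau> p) (uadj X D A y)\<close>. This relates \<open>V\<close> to
  \<open>S\<close> without first constructing the adjoint semigroup.\<close>

lemma duhamel_perturbed_adjoint:
  fixes X :: "'x::{real_inner,banach} set"
  assumes X: "closed_subspace X" and S: "generates X D A S"
    and V: "generates X (uadj_dom X D A) (\<lambda>x. uadj X D A x + E x) V" and E: "bop X X E"
    and p: "p \<in> X" and z: "z \<in> X" and t: "t \<ge> 0"
  shows "inner p (V t z) - inner (S t p) z = (LINT s:{0..t}|lborel. inner (S (t - s) p) (E (V s z)))"
proof -
  note Ss = generatesD(1)[OF S]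
  note SD = c0_semigroupD[OF Ss]
  note Vs = generatesD(1)[OF V]
  note VD = c0_semigroupD[OF Vs]
  obtain M where M: "M > 0" "\<And>s x. 0 \<le> s \<Longrightarrow> s \<le> t \<Longrightarrow> x \<in> X \<Longrightarrow> norm (S s x) \<le> M * norm x"
    using c0_semigroup_locally_bounded[OF X Ss] by blast
  have cont: "continuous_on ({0..} \<times> X) (\<lambda>(\<tau>, y). inner (S \<tau> p) y)" if p: "p \<in> X" for p
  proof -
    have "continuous_on ({0..} \<times> X) (\<lambda>q. S (fst q) p)"
      by (rule continuous_on_compose2[OF c0_semigroup_continuous_on[OF X Ss p]])
        (auto intro!: continuous_intros)
    then show ?thesis by (auto simp: case_prod_unfold intro!: continuous_intros)
  qed
  have bd: "\<bar>inner (S \<tau> p) y\<bar> \<le> M * norm p * norm y" if "0 \<le> \<tau>" "\<tau> \<le> t" "p \<in> X" for \<tau> y p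
    using Cauchy_Schwarz_ineq2[of "S \<tau> p" y] mult_right_mono[OF M(2)[OF that], of "norm y"]
    by simp
  have core: "inner p (V t z) - inner (S t p) z = (LINT s:{0..t}|lborel. inner (S (t - s) p) (E (V s z)))"
    if p: "p \<in> D" for p
  proof -
    have pX: "p \<in> X" using generatesD(2)[OF S p] .
    have "inner (S 0 p) (V t z) - inner (S t p) z = (LINT s:{0..t}|lborel. inner (S (t - s) p) (E (V s z)))"
    proof (rule duhamel[OF X V E cont[OF pX], where K = "M * norm p"])
      show "lin_on X (\<lambda>y. inner (S \<tau> p) y)" for \<tau>
        by (simp add: lin_on_def inner_add_right)
      show "((\<lambda>s. inner (S s p) y) has_vector_derivative inner (S \<tau> p) (uadj X D A y)) (at \<tau> within {0..})"
        if "\<tau> \<ge> 0" "y \<in> uadj_dom X D A" for \<tau> y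
      proof -
        have "((\<lambda>s. inner (S s p) y) has_vector_derivative inner (S \<tau> (A p)) y) (at \<tau> within {0..})"
          by (rule bounded_linear.has_vector_derivative[OF bounded_linear_inner_left
            generates_has_vector_derivative[OF X S p that(1)]])
        moreover have "inner (S \<tau> (A p)) y = inner (S \<tau> p) (uadj X D A y)"
          using generates_invariant[OF X S p that(1)] uadj_inner(2)[OF that(2)] by metis
        ultimately show ?thesis by simp
      qed
    qed (use M bd pX z t in auto)
    then show ?thesis using SD(2)[OF pX] by simp
  qed
  have ci: "set_integrable lborel {0..t} (\<lambda>s. inner (S (t - s) p) (E (V s z)))" if "p \<in> X" for p
    by (rule borel_integrable_atLeastAtMost'[OF continuous_on_orbit_pairing[OF X Vs E cont[OF that] z]])
  define err where "err p = inner p (V t z) - inner (S t p) z -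
    (LINT s:{0..t}|lborel. inner (S (t - s) p) (E (V s z)))" for p
  have lin: "lin_on X err"
    unfolding lin_on_def
  proof (intro ballI allI conjI)
    fix x y :: 'x and a :: real assume xy: "x \<in> X" "y \<in> X"
    have Sa: "S s (x + y) = S s x + S s y" "S s (a *\<^sub>R x) = a *\<^sub>R S s x" if "s \<ge> 0" for s
      using lin_on_add[OF bop_lin[OF SD(1)] xy] lin_on_scaleR[OF bop_lin[OF SD(1)] xy(1)] that by auto
    have "(LINT s:{0..t}|lborel. inner (S (t - s) (x + y)) (E (V s z))) =
        (LINT s:{0..t}|lborel. inner (S (t - s) x) (E (V s z)) + inner (S (t - s) y) (E (V s z)))"
      by (rule set_lebesgue_integral_cong) (auto simp: Sa inner_add_left)
    also have "\<dots> = (LINT s:{0..t}|lborel. inner (S (t - s) x) (E (V s z))) +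
        (LINT s:{0..t}|lborel. inner (S (t - s) y) (E (V s z)))"
      by (rule set_integral_add(2)[OF ci[OF xy(1)] ci[OF xy(2)]])
    finally show "err (x + y) = err x + err y"
      using t by (simp add: err_def Sa inner_add_left)
    have "(LINT s:{0..t}|lborel. inner (S (t - s) (a *\<^sub>R x)) (E (V s z))) =
        (LINT s:{0..t}|lborel. a * inner (S (t - s) x) (E (V s z)))"
      by (rule set_lebesgue_integral_cong) (auto simp: Sa)
    then show "err (a *\<^sub>R x) = a *\<^sub>R err x"
      using t by (simp add: err_def Sa algebra_simps)
  qed
  obtain L where L: "L > 0" "\<And>s x. 0 \<le> s \<Longrightarrow> s \<le> t \<Longrightarrow> x \<in> X \<Longrightarrow> norm (V s x) \<le> L * norm x"
    using c0_semigroup_locally_bounded[OF X Vs] by blast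
  obtain e where e: "e > 0" "\<And>x. x \<in> X \<Longrightarrow> norm (E x) \<le> e * norm x"
    using E by (rule bop_bound) blast
  \<comment> \<open>A second density argument, now in \<open>p\<close>: the identity has so far been
    obtained for \<open>p\<close> in \<open>D\<close> only, where the orbit of \<open>p\<close> is
    differentiable.\<close>
  have "err p = 0"
  proof (rule bounded_linear_zero_on_dense[OF X lin _ _ generator_domain_dense[OF X S] _ p])
    fix x assume x: "x \<in> X"
    have "\<bar>inner (S (t - s) x) (E (V s z))\<bar> \<le> M * norm x * (e * (L * norm z))" if s: "s \<in> {0..t}" for s
    proof -
      have "norm (E (V s z)) \<le> e * norm (V s z)" using e(2) VD(4) s z by simp
      also have "\<dots> \<le> e * (L * norm z)" using e(1) L(2) s z by (intro mult_left_mono) auto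
      finally have "M * norm x * norm (E (V s z)) \<le> M * norm x * (e * (L * norm z))"
        using M(1) by (intro mult_left_mono) auto
      then show ?thesis using bd[of "t - s" x "E (V s z)"] s x by simp
    qed
    from abs_set_integral_Icc_le[OF ci[OF x] t this]
    have "\<bar>LINT s:{0..t}|lborel. inner (S (t - s) x) (E (V s z))\<bar> \<le> t * (M * norm x * (e * (L * norm z)))"
      by simp
    moreover have "\<bar>inner x (V t z)\<bar> \<le> norm x * norm (V t z)" by (rule Cauchy_Schwarz_ineq2)
    moreover have "\<bar>inner (S t x) z\<bar> \<le> M * norm x * norm z" using bd t x by simp
    ultimately have "\<bar>err x\<bar> \<le> t * (M * norm x * (e * (L * norm z))) + norm x * norm (V t z) + M * norm x * norm z"
      unfolding err_def by linarith
    then show "\<bar>err x\<bar> \<le> (t * (M * (e * (L * norm z))) + norm (V t z) + M * norm z) * norm x"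
      by (simp add: algebra_simps)
  next
    show "D \<subseteq> X" using generatesD(2)[OF S] by blast
  next
    fix x assume "x \<in> D"
    then show "err x = 0" unfolding err_def using core by simp
  qed
  then show ?thesis by (simp add: err_def)
qed

section \<open>Duality of mild solutions\<close>

text \<open>Strong continuity comes from comparison with the perturbed adjoint semigroup \<open>V\<close>, so that the
  weak-implies-strong continuity theorem is not needed.\<close>
lemma adjoint_c0_semigroup:
  fixes X :: "'x::{real_inner,banach} set"
  assumes X: "closed_subspace X" and S: "generates X D A S"
    and V: "generates X (uadj_dom X D A) (\<lambda>x. uadj X D A x + E x) V" and E: "bop X X E"
  shows "c0_semigroup X (\<lambda>t. badj X X (S t))"
proof -
  note Ss = generatesD(1)[OF S]
  note SD = c0_semigroupD[OF Ss]
  note Vs = generatesD(1)[OF V]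
  note VD = c0_semigroupD[OF Vs]
  note XI = closed_subspace_intros[OF X]
  note p = badj_props[OF X SD(1)]
  show ?thesis
    unfolding c0_semigroup_def
  proof (intro conjI allI ballI impI)
    show "bop X X (badj X X (S t))" if "t \<ge> 0" for t by (rule badj_bop[OF X X SD(1)[OF that]])
    show "badj X X (S 0) x = x" if "x \<in> X" for x
      by (rule badj_eqI[OF X SD(1) that]) (auto simp: SD(2))
    show "badj X X (S (s + t)) x = badj X X (S s) (badj X X (S t) x)" if "0 \<le> s" "0 \<le> t" "x \<in> X" for s t x
    proof (rule badj_eqI[OF X SD(1)])
      fix y assume y: "y \<in> X"
      have "S (s + t) y = S t (S s y)" using SD(3)[of t s y] that y by (simp add: add.commute)
      then show "inner (S (s + t) y) x = inner y (badj X X (S s) (badj X X (S t) x))"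
        using p(2)[OF that(2) SD(4)[OF that(1) y], of x] p(2)[OF that(1) y] by simp
    qed (use that p(1) in auto)
    fix z assume z: "z \<in> X"
    obtain M where M: "M > 0" "\<And>s x. 0 \<le> s \<Longrightarrow> s \<le> 1 \<Longrightarrow> x \<in> X \<Longrightarrow> norm (S s x) \<le> M * norm x"
      using c0_semigroup_locally_bounded[OF X Ss] by blast
    obtain L where L: "L > 0" "\<And>s x. 0 \<le> s \<Longrightarrow> s \<le> 1 \<Longrightarrow> x \<in> X \<Longrightarrow> norm (V s x) \<le> L * norm x"
      using c0_semigroup_locally_bounded[OF X Vs] by blast
    obtain e where e: "e > 0" "\<And>x. x \<in> X \<Longrightarrow> norm (E x) \<le> e * norm x"
      using E by (rule bop_bound) blast
    define K where "K = M * (e * (L * norm z))"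
    have close: "norm (badj X X (S t) z - V t z) \<le> t * K" if t: "0 \<le> t" "t \<le> 1" for t
    proof -
      \<comment> \<open>Duhamel's formula is tested with the difference itself: its left side
        becomes \<open>inner q q\<close>, its right side is at most \<open>t K\<close> times
        \<open>norm q\<close>.\<close>
      define q where "q = V t z - badj X X (S t) z"
      have q: "q \<in> X" unfolding q_def using XI(3) VD(4) p(1) t z by simp
      have "continuous_on {0..t} (\<lambda>s. inner (S (t - s) q) (E (V s z)))"
      proof (intro continuous_intros)
        show "continuous_on {0..t} (\<lambda>s. S (t - s) q)"
          by (rule continuous_on_compose2[OF c0_semigroup_continuous_on[OF X Ss q]])
            (auto intro!: continuous_intros)
        have "continuous_on {0..t} (\<lambda>s. V s z)"
          by (rule continuous_on_subset[OF c0_semigroup_continuous_on[OF X Vs z]]) auto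
        then show "continuous_on {0..t} (\<lambda>s. E (V s z))"
          by (rule continuous_on_compose2[OF bop_continuous_on[OF X E]]) (use VD z in auto)
      qed
      then have "set_integrable lborel {0..t} (\<lambda>s. inner (S (t - s) q) (E (V s z)))"
        by (rule borel_integrable_atLeastAtMost')
      moreover have "\<bar>inner (S (t - s) q) (E (V s z))\<bar> \<le> norm q * K" if s: "s \<in> {0..t}" for s
      proof -
        have "norm (E (V s z)) \<le> e * norm (V s z)" using e(2) VD(4) s z by simp
        also have "\<dots> \<le> e * (L * norm z)" using e(1) L(2) s t z by (intro mult_left_mono) auto
        finally have "norm (S (t - s) q) * norm (E (V s z)) \<le> (M * norm q) * (e * (L * norm z))"
          using M s t q by (intro mult_mono) auto
        then show ?thesis
          using Cauchy_Schwarz_ineq2[of "S (t - s) q" "E (V s z)"] by (simp add: K_def ac_simps)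
      qed
      ultimately have "\<bar>LINT s:{0..t}|lborel. inner (S (t - s) q) (E (V s z))\<bar> \<le> t * (norm q * K)"
        using abs_set_integral_Icc_le t(1) by blast
      moreover have "(LINT s:{0..t}|lborel. inner (S (t - s) q) (E (V s z))) = inner q q"
        unfolding duhamel_perturbed_adjoint[OF X S V E q z t(1), symmetric]
        using p(2)[OF t(1) q] by (simp add: q_def inner_diff_right)
      ultimately have "norm q * norm q \<le> norm q * (t * K)"
        by (simp add: power2_norm_eq_inner[symmetric] power2_eq_square ac_simps)
      moreover have "0 \<le> t * K" using t M(1) e(1) L(1) by (simp add: K_def)
      ultimately have "norm q \<le> t * K" by (cases "q = 0") auto
      then show ?thesis by (simp add: q_def norm_minus_commute)
    qed
    have "((\<lambda>t. t * K) \<longlongrightarrow> 0 * K) (at_right 0)" by (intro tendsto_intros)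
    then have lim: "((\<lambda>t. t * K) \<longlongrightarrow> 0) (at_right 0)" by simp
    have "eventually (\<lambda>h. h > 0 \<and> h < 1) (at_right (0::real))"
      by (simp add: eventually_at_right_field) (meson zero_less_one)
    then have "\<forall>\<^sub>F t in at_right 0. norm (badj X X (S t) z - V t z) \<le> t * K"
      by eventually_elim (use close in auto)
    from Lim_null_comparison[OF this lim]
    have "((\<lambda>t. (badj X X (S t) z - V t z) + V t z) \<longlongrightarrow> 0 + z) (at_right 0)"
      using VD(5)[OF z] by (intro tendsto_add) (auto simp: at_within_Ici_at_right)
    then show "((\<lambda>t. badj X X (S t) z) \<longlongrightarrow> z) (at_right 0)" by simp
  qed
qed

section \<open>Measurability, integrability and Fubini's theorem for semigroup kernels\<close>

lemma borel_measurable_c0_semigroup: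
  fixes X :: "'x::{banach,second_countable_topology} set"
  assumes X: "closed_subspace X" and S: "c0_semigroup X S"
    and \<tau>: "\<tau> \<in> borel_measurable M" and f: "f \<in> borel_measurable M"
    and r: "\<And>x. \<tau> x \<ge> 0" "\<And>x. f x \<in> X"
  shows "(\<lambda>x. S (\<tau> x) (f x)) \<in> borel_measurable M"
proof -
  let ?A = "{0::real..} \<times> X"
  have "closed ?A" using closed_subspace_intros(5)[OF X] by (intro closed_Times) auto
  \<comment> \<open>Joint continuity holds only on the closed set \<open>?A\<close>; extension by
    zero is Borel, and composition stays inside \<open>?A\<close> because \<open>r\<close> holds at
    every point.\<close>
  then have "(\<lambda>q. indicator ?A q *\<^sub>R (\<lambda>(t, x). S t x) q) \<in> borel_measurable borel"
    by (intro borel_measurable_continuous_on_indicator c0_semigroup_jointly_continuous[OF X S]) auto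
  then have "(\<lambda>x. indicator ?A (\<tau> x, f x) *\<^sub>R (\<lambda>(t, x). S t x) (\<tau> x, f x)) \<in> borel_measurable M"
    using measurable_compose[OF borel_measurable_Pair[OF \<tau> f]] by fast
  then show ?thesis using r by simp
qed

lemma set_integrable_c0_semigroup:
  fixes X :: "'x::{banach,second_countable_topology} set"
  assumes X: "closed_subspace X" and S: "c0_semigroup X S"
    and f: "set_integrable lborel A f" "\<And>s. s \<in> A \<Longrightarrow> f s \<in> X" and A: "A \<in> sets borel"
    and \<tau>: "\<tau> \<in> borel_measurable borel" "\<And>s. s \<in> A \<Longrightarrow> 0 \<le> \<tau> s \<and> \<tau> s \<le> T"
  shows "set_integrable lborel A (\<lambda>s. S (\<tau> s) (f s))"
proof -
  note SD = c0_semigroupD[OF S]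
  note XI = closed_subspace_intros[OF X]
  obtain M where M: "M > 0" "\<And>s x. 0 \<le> s \<Longrightarrow> s \<le> max 0 T \<Longrightarrow> x \<in> X \<Longrightarrow> norm (S s x) \<le> M * norm x"
    using c0_semigroup_locally_bounded[OF X S] by blast
  \<comment> \<open>Time and value are cut off to zero outside \<open>A\<close>, so that the range
    conditions hold on the whole line; the integrand there is \<open>S 0 0 = 0\<close>.\<close>
  define t where "t s = indicator A s * \<tau> s" for s
  define f1 where "f1 s = indicator A s *\<^sub>R f s" for s
  have t: "t \<in> borel_measurable lborel" "\<And>s. 0 \<le> t s" "\<And>s. t s \<le> max 0 T"
    using \<tau> A by (auto simp: t_def[abs_def] indicator_def le_max_iff_disj)
  have f1: "integrable lborel f1" "\<And>s. f1 s \<in> X"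
    using f XI(1) by (auto simp: f1_def[abs_def] set_integrable_def indicator_def)
  have eq: "indicator A s *\<^sub>R S (\<tau> s) (f s) = S (t s) (f1 s)" for s
    using lin_on_scaleR[OF bop_lin[OF SD(1)[of 0]] XI(1), of 0] by (simp add: t_def f1_def indicator_def)
  have "integrable lborel (\<lambda>s. M * norm (f1 s))" using f1(1) by simp
  then have "integrable lborel (\<lambda>s. S (t s) (f1 s))"
    by (rule Bochner_Integration.integrable_bound)
      (use t f1 M in \<open>auto intro!: borel_measurable_c0_semigroup[OF X S] AE_I2 order_trans[OF M(2)]\<close>)
  then show ?thesis unfolding set_integrable_def eq .
qed

lemma set_integrable_inner_continuous:
  fixes u g :: "real \<Rightarrow> 'x::{real_inner,banach,second_countable_topology}"
  assumes u: "continuous_on {a..b} u" and g: "set_integrable lborel {a..b} g"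
  shows "set_integrable lborel {a..b} (\<lambda>s. inner (u s) (g s))"
proof -
  have "bounded (u ` {a..b})" by (intro compact_imp_bounded compact_continuous_image u) auto
  then obtain K where K: "\<And>s. s \<in> {a..b} \<Longrightarrow> norm (u s) \<le> K" by (metis bounded_iff imageI)
  define u1 where "u1 s = indicator {a..b} s *\<^sub>R u s" for s
  define g1 where "g1 s = indicator {a..b} s *\<^sub>R g s" for s
  have u1: "u1 \<in> borel_measurable borel"
    unfolding u1_def[abs_def] by (rule borel_measurable_continuous_on_indicator[OF _ u]) auto
  have g1: "integrable lborel g1" using g by (simp add: set_integrable_def g1_def[abs_def])
  have eq: "indicator {a..b} s *\<^sub>R inner (u s) (g s) = inner (u1 s) (g1 s)" for s
    by (simp add: u1_def g1_def indicator_def)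
  have "integrable lborel (\<lambda>s. K * norm (g1 s))" using g1 by simp
  then have "integrable lborel (\<lambda>s. inner (u1 s) (g1 s))"
  proof (rule Bochner_Integration.integrable_bound)
    show "(\<lambda>s. inner (u1 s) (g1 s)) \<in> borel_measurable lborel" using u1 g1 by simp
    show "AE s in lborel. norm (inner (u1 s) (g1 s)) \<le> norm (K * norm (g1 s))"
    proof (rule AE_I2)
      fix s
      have "\<bar>inner (u1 s) (g1 s)\<bar> \<le> norm (u1 s) * norm (g1 s)" by (rule Cauchy_Schwarz_ineq2)
      also have "\<dots> \<le> \<bar>K\<bar> * norm (g1 s)"
        using K[of s] by (intro mult_right_mono) (auto simp: u1_def indicator_def)
      finally show "norm (inner (u1 s) (g1 s)) \<le> norm (K * norm (g1 s))" by (simp add: abs_mult)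
    qed
  qed
  then show ?thesis unfolding set_integrable_def eq .
qed

lemma integrable_prod_mult:
  fixes u v :: "real \<Rightarrow> real"
  assumes "integrable lborel u" "integrable lborel v"
  shows "integrable (lborel \<Otimes>\<^sub>M lborel) (\<lambda>(s, \<sigma>). u s * v \<sigma>)"
proof (rule lborel_pair.Fubini_integrable)
  show "(\<lambda>(s, \<sigma>). u s * v \<sigma>) \<in> borel_measurable (lborel \<Otimes>\<^sub>M lborel)"
    using assms by (simp add: case_prod_unfold)
  show "integrable lborel (\<lambda>x. \<integral>y. norm (case (x, y) of (s, \<sigma>) \<Rightarrow> u s * v \<sigma>) \<partial>lborel)"
    using assms by (simp add: abs_mult)
  show "AE x in lborel. integrable lborel (\<lambda>y. case (x, y) of (s, \<sigma>) \<Rightarrow> u s * v \<sigma>)"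
    using assms by simp
qed

text \<open>Fubini on the triangle \<open>a \<le> s \<le> \<sigma> \<le> b\<close>; the kernel is
  dominated by \<open>M\<close> times the product of the norms of \<open>f\<close> and
  \<open>g\<close>.\<close>

lemma semigroup_kernel_Fubini:
  fixes X :: "'x::{real_inner,banach,second_countable_topology} set"
  assumes X: "closed_subspace X" and S: "c0_semigroup X S"
    and f: "set_integrable lborel {a..b} f" "\<And>s. s \<in> {a..b} \<Longrightarrow> f s \<in> X"
    and g: "set_integrable lborel {a..b} g"
  shows "set_integrable lborel {a..b} (\<lambda>s. LINT \<sigma>:{s..b}|lborel. inner (S (\<sigma> - s) (f s)) (g \<sigma>))"
    "set_integrable lborel {a..b} (\<lambda>\<sigma>. LINT s:{a..\<sigma>}|lborel. inner (S (\<sigma> - s) (f s)) (g \<sigma>))"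
    "(LINT s:{a..b}|lborel. LINT \<sigma>:{s..b}|lborel. inner (S (\<sigma> - s) (f s)) (g \<sigma>)) =
     (LINT \<sigma>:{a..b}|lborel. LINT s:{a..\<sigma>}|lborel. inner (S (\<sigma> - s) (f s)) (g \<sigma>))"
proof -
  note XI = closed_subspace_intros[OF X]
  obtain M where M: "M > 0" "\<And>s x. 0 \<le> s \<Longrightarrow> s \<le> b - a \<Longrightarrow> x \<in> X \<Longrightarrow> norm (S s x) \<le> M * norm x"
    using c0_semigroup_locally_bounded[OF X S] by blast
  define f1 where "f1 s = indicator {a..b} s *\<^sub>R f s" for s
  define g1 where "g1 s = indicator {a..b} s *\<^sub>R g s" for s
  \<comment> \<open>The \<open>max 0\<close> keeps the time nonnegative off the triangle as well, as
    the measurability lemma demands; the value there is discarded.\<close>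
  define k where "k s \<sigma> = (if s \<le> \<sigma> then inner (S (max 0 (\<sigma> - s)) (f1 s)) (g1 \<sigma>) else 0)" for s \<sigma>
  have f1: "integrable lborel f1" "\<And>s. f1 s \<in> X"
    using f XI(1) by (auto simp: f1_def[abs_def] set_integrable_def indicator_def)
  have g1: "integrable lborel g1" using g by (simp add: set_integrable_def g1_def[abs_def])
  have "(\<lambda>p. S (max 0 (snd p - fst p)) (f1 (fst p))) \<in> borel_measurable (lborel \<Otimes>\<^sub>M lborel)"
    using f1 by (intro borel_measurable_c0_semigroup[OF X S]) auto
  then have km: "(\<lambda>(s, \<sigma>). k s \<sigma>) \<in> borel_measurable (lborel \<Otimes>\<^sub>M lborel)"
    unfolding k_def case_prod_unfold using g1 by measurable
  have int: "integrable (lborel \<Otimes>\<^sub>M lborel) (\<lambda>(s, \<sigma>). k s \<sigma>)"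
  proof (rule Bochner_Integration.integrable_bound[OF _ km])
    show "integrable (lborel \<Otimes>\<^sub>M lborel) (\<lambda>(s, \<sigma>). (M * norm (f1 s)) * norm (g1 \<sigma>))"
      using f1 g1 by (intro integrable_prod_mult) auto
    show "AE p in lborel \<Otimes>\<^sub>M lborel. norm (case p of (s, \<sigma>) \<Rightarrow> k s \<sigma>)
        \<le> norm (case p of (s, \<sigma>) \<Rightarrow> M * norm (f1 s) * norm (g1 \<sigma>))"
    proof (rule AE_I2, clarify)
      fix s \<sigma> :: real
      show "norm (k s \<sigma>) \<le> norm (M * norm (f1 s) * norm (g1 \<sigma>))"
      proof (cases "s \<le> \<sigma> \<and> s \<in> {a..b} \<and> \<sigma> \<in> {a..b}")
        case True
        then have "norm (S (\<sigma> - s) (f1 s)) \<le> M * norm (f1 s)" using f1(2) by (intro M(2)) auto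
        then have "norm (S (\<sigma> - s) (f1 s)) * norm (g1 \<sigma>) \<le> M * norm (f1 s) * norm (g1 \<sigma>)"
          by (intro mult_right_mono) auto
        then show ?thesis
          using True M(1) Cauchy_Schwarz_ineq2[of "S (\<sigma> - s) (f1 s)" "g1 \<sigma>"] by (simp add: k_def abs_mult)
      next
        case False
        then have "k s \<sigma> = 0"
          using lin_on_scaleR[OF bop_lin[OF c0_semigroupD(1)[OF S]] XI(1), of "\<sigma> - s" 0]
          by (auto simp: k_def f1_def g1_def)
        then show ?thesis by simp
      qed
    qed
  qed
  have S0: "S t 0 = 0" if "t \<ge> 0" for t
    using lin_on_scaleR[OF bop_lin[OF c0_semigroupD(1)[OF S that]] XI(1), of 0] by simp
  have e1: "(\<integral>\<sigma>. k s \<sigma> \<partial>lborel) = indicator {a..b} s *\<^sub>R (LINT \<sigma>:{s..b}|lborel. inner (S (\<sigma> - s) (f s)) (g \<sigma>))" for s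
  proof (cases "s \<in> {a..b}")
    case True
    then have "k s \<sigma> = indicator {s..b} \<sigma> *\<^sub>R inner (S (\<sigma> - s) (f s)) (g \<sigma>)" for \<sigma>
      by (auto simp: k_def f1_def g1_def indicator_def)
    then show ?thesis using True by (simp add: set_lebesgue_integral_def)
  next
    case False
    then have "k s \<sigma> = 0" for \<sigma> by (simp add: k_def f1_def S0)
    with False show ?thesis by simp
  qed
  have e2: "(\<integral>s. k s \<sigma> \<partial>lborel) = indicator {a..b} \<sigma> *\<^sub>R (LINT s:{a..\<sigma>}|lborel. inner (S (\<sigma> - s) (f s)) (g \<sigma>))" for \<sigma>
  proof (cases "\<sigma> \<in> {a..b}")
    case True
    then have "k s \<sigma> = indicator {a..\<sigma>} s *\<^sub>R inner (S (\<sigma> - s) (f s)) (g \<sigma>)" for s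
      by (auto simp: k_def f1_def g1_def indicator_def S0)
    then show ?thesis using True by (simp add: set_lebesgue_integral_def)
  next
    case False
    then have "k s \<sigma> = 0" for s by (auto simp: k_def g1_def)
    with False show ?thesis by simp
  qed
  show "set_integrable lborel {a..b} (\<lambda>s. LINT \<sigma>:{s..b}|lborel. inner (S (\<sigma> - s) (f s)) (g \<sigma>))"
    using lborel_pair.integrable_fst'[OF int] by (simp add: set_integrable_def e1)
  show "set_integrable lborel {a..b} (\<lambda>\<sigma>. LINT s:{a..\<sigma>}|lborel. inner (S (\<sigma> - s) (f s)) (g \<sigma>))"
    using lborel_pair.integrable_snd[OF int] by (simp add: set_integrable_def e2)
  show "(LINT s:{a..b}|lborel. LINT \<sigma>:{s..b}|lborel. inner (S (\<sigma> - s) (f s)) (g \<sigma>)) =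
     (LINT \<sigma>:{a..b}|lborel. LINT s:{a..\<sigma>}|lborel. inner (S (\<sigma> - s) (f s)) (g \<sigma>))"
    using lborel_pair.Fubini_integral[OF int] unfolding e1 e2 set_lebesgue_integral_def by simp
qed

text \<open>Formally the integral of \<open>d/dt \<langle>x, \<lambda>\<rangle>\<close> for \<open>x' = A x + f\<close> and \<open>\<lambda>' = - A\<^sup>* \<lambda> - g\<close>.\<close>
lemma mild_duality:
  fixes X :: "'x::{real_inner,banach,second_countable_topology} set"
  assumes X: "closed_subspace X" and S: "c0_semigroup X S" and ab: "a \<le> b"
    and f: "set_integrable lborel {a..b} f" "\<And>s. s \<in> {a..b} \<Longrightarrow> f s \<in> X"
    and g: "set_integrable lborel {a..b} g" "\<And>s. s \<in> {a..b} \<Longrightarrow> g s \<in> X"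
    and x0: "x0 \<in> X" and lb: "lb \<in> X"
    and x: "\<And>t q. t \<in> {a..b} \<Longrightarrow> q \<in> X \<Longrightarrow> inner (x t) q =
      inner (S (t - a) x0) q + (LINT s:{a..t}|lborel. inner (S (t - s) (f s)) q)"
    and l: "\<And>t p. t \<in> {a..b} \<Longrightarrow> p \<in> X \<Longrightarrow> inner p (lam t) =
      inner (S (b - t) p) lb + (LINT s:{t..b}|lborel. inner (S (s - t) p) (g s))"
  shows "inner (x b) lb - inner x0 (lam a) =
    (LINT s:{a..b}|lborel. inner (f s) (lam s)) - (LINT s:{a..b}|lborel. inner (x s) (g s))"
proof -
  note F = semigroup_kernel_Fubini[OF X S f g(1)]
  have "set_integrable lborel {a..b} (\<lambda>s. S (b - s) (f s))"
    by (rule set_integrable_c0_semigroup[OF X S f, where T = "b - a"]) auto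
  from set_integral_inner_right(2)[OF this, of lb]
  have i1: "set_integrable lborel {a..b} (\<lambda>s. inner (S (b - s) (f s)) lb)" by (simp add: inner_commute)
  have "continuous_on {a..b} (\<lambda>s. S (s - a) x0)"
    by (rule continuous_on_compose2[OF c0_semigroup_continuous_on[OF X S x0]]) (auto intro!: continuous_intros)
  then have i2: "set_integrable lborel {a..b} (\<lambda>s. inner (S (s - a) x0) (g s))"
    by (rule set_integrable_inner_continuous[OF _ g(1)])
  have "(LINT s:{a..b}|lborel. inner (f s) (lam s)) =
    (LINT s:{a..b}|lborel. inner (S (b - s) (f s)) lb + (LINT \<sigma>:{s..b}|lborel. inner (S (\<sigma> - s) (f s)) (g \<sigma>)))"
    by (rule set_lebesgue_integral_cong) (auto intro!: l f)
  also have "\<dots> = (LINT s:{a..b}|lborel. inner (S (b - s) (f s)) lb) +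
    (LINT s:{a..b}|lborel. LINT \<sigma>:{s..b}|lborel. inner (S (\<sigma> - s) (f s)) (g \<sigma>))"
    by (rule set_integral_add(2)[OF i1 F(1)])
  finally have 1: "(LINT s:{a..b}|lborel. inner (f s) (lam s)) = \<dots>" .
  have "(LINT s:{a..b}|lborel. inner (x s) (g s)) =
    (LINT s:{a..b}|lborel. inner (S (s - a) x0) (g s) + (LINT \<sigma>:{a..s}|lborel. inner (S (s - \<sigma>) (f \<sigma>)) (g s)))"
    by (rule set_lebesgue_integral_cong) (auto intro!: x g)
  also have "\<dots> = (LINT s:{a..b}|lborel. inner (S (s - a) x0) (g s)) +
    (LINT s:{a..b}|lborel. LINT \<sigma>:{a..s}|lborel. inner (S (s - \<sigma>) (f \<sigma>)) (g s))"
    by (rule set_integral_add(2)[OF i2 F(2)])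
  finally have 2: "(LINT s:{a..b}|lborel. inner (x s) (g s)) = \<dots>" .
  \<comment> \<open>The double integrals agree by Fubini, and the single ones are what remains of
    the two boundary pairings after the common term \<open>inner (S (b - a) x0) lb\<close>
    cancels.\<close>
  show ?thesis
    unfolding 1 2 using F(3) x[of b lb] l[of a x0] ab lb x0 by simp
qed

section \<open>Pointwise bounds by stable semigroups\<close>

lemma set_integral_shift_Icc:
  fixes h :: "real \<Rightarrow> real"
  shows "(LINT r:{0..s - t}|lborel. h r) = (LINT \<sigma>:{t..s}|lborel. h (\<sigma> - t))"
  unfolding set_lebesgue_integral_def
  by (subst lborel_integral_real_affine[where c = 1 and t = "- t"])
    (auto intro!: Bochner_Integration.integral_cong simp: indicator_def)

lemma set_integral_reflect_Icc:
  fixes h :: "real \<Rightarrow> real"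
  shows "(LINT r:{0..t - s}|lborel. h r) = (LINT \<sigma>:{s..t}|lborel. h (t - \<sigma>))"
  unfolding set_lebesgue_integral_def
  by (subst lborel_integral_real_affine[where c = "-1" and t = t])
    (auto intro!: Bochner_Integration.integral_cong simp: indicator_def)

lemma continuous_on_orbit:
  fixes X :: "'x::banach set"
  assumes X: "closed_subspace X" and S: "c0_semigroup X S" and x: "x \<in> X"
    and \<tau>: "continuous_on I \<tau>" "\<And>s. s \<in> I \<Longrightarrow> 0 \<le> \<tau> s"
  shows "continuous_on I (\<lambda>s. S (\<tau> s) x)"
  by (rule continuous_on_compose2[OF c0_semigroup_continuous_on[OF X S x] \<tau>(1)]) (use \<tau>(2) in auto)

lemma continuous_on_bop:
  assumes X: "closed_subspace X" and F: "bop X Y F" and u: "continuous_on I u" "\<And>s. s \<in> I \<Longrightarrow> u s \<in> X"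
  shows "continuous_on I (\<lambda>s. F (u s))"
  by (rule continuous_on_compose2[OF bop_continuous_on[OF X F] u(1)]) (use u(2) in auto)

lemma set_integrable_mult_continuous:
  fixes u h :: "real \<Rightarrow> real"
  assumes "continuous_on {a..b} u" "set_integrable lborel {a..b} h"
  shows "set_integrable lborel {a..b} (\<lambda>s. u s * h s)"
  using set_integrable_inner_continuous[OF assms] by simp

lemma mild_solution_weak_form:
  fixes X :: "'x::{real_inner,banach,second_countable_topology} set"
  assumes X: "closed_subspace X" and S: "c0_semigroup X S"
    and f: "set_integrable lborel {a..b} f" "\<And>s. s \<in> {a..b} \<Longrightarrow> f s \<in> X"
    and t: "t \<in> {a..b}"
    and x: "x = S (t - a) x0 + (LINT s:{a..t}|lborel. S (t - s) (f s))"
  shows "inner x q = inner (S (t - a) x0) q + (LINT s:{a..t}|lborel. inner (S (t - s) (f s)) q)"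
proof -
  have "set_integrable lborel {a..t} f"
    by (rule set_integrable_subset[OF f(1)]) (use t in auto)
  then have "set_integrable lborel {a..t} (\<lambda>s. S (t - s) (f s))"
    by (rule set_integrable_c0_semigroup[OF X S, where T = "t - a"]) (use f t in auto)
  from set_integral_inner_right(1)[OF this, of q] show ?thesis
    by (simp add: x inner_add_right inner_commute[of _ q])
qed

text \<open>Strong continuity of the adjoint family makes the integrand Bochner integrable; the
  pairing with \<open>p\<close> may then be moved under the integral, where it falls on
  \<open>S\<close>.\<close>

lemma mild_adjoint_solution_weak_form:
  fixes X :: "'x::{real_inner,banach,second_countable_topology} set"
  assumes X: "closed_subspace X" and S: "\<And>t. t \<ge> 0 \<Longrightarrow> bop X X (S t)"
    and S': "c0_semigroup X (\<lambda>t. badj X X (S t))"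
    and g: "set_integrable lborel {a..b} g" "\<And>s. s \<in> {a..b} \<Longrightarrow> g s \<in> X"
    and t: "t \<in> {a..b}" and p: "p \<in> X"
    and l: "l = badj X X (S (b - t)) lb + (LINT s:{t..b}|lborel. badj X X (S (s - t)) (g s))"
  shows "inner p l = inner (S (b - t) p) lb + (LINT s:{t..b}|lborel. inner (S (s - t) p) (g s))"
proof -
  have "set_integrable lborel {t..b} g"
    by (rule set_integrable_subset[OF g(1)]) (use t in auto)
  then have "set_integrable lborel {t..b} (\<lambda>s. badj X X (S (s - t)) (g s))"
    by (rule set_integrable_c0_semigroup[OF X S', where T = "b - t"]) (use g t in auto)
  from set_integral_inner_right(1)[OF this, of p]
  have "inner p l = inner p (badj X X (S (b - t)) lb) +
      (LINT s:{t..b}|lborel. inner p (badj X X (S (s - t)) (g s)))"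
    by (simp add: l inner_add_right)
  also have "(LINT s:{t..b}|lborel. inner p (badj X X (S (s - t)) (g s))) =
      (LINT s:{t..b}|lborel. inner (S (s - t) p) (g s))"
    by (rule set_lebesgue_integral_cong) (auto simp: badj_props(2)[OF X S p])
  also have "inner p (badj X X (S (b - t)) lb) = inner (S (b - t) p) lb"
    using t by (simp add: badj_props(2)[OF X S p])
  finally show ?thesis .
qed

text \<open>By Duhamel the backward orbit \<open>V (t - s) z\<close> is a mild costate with source
  \<open>g\<close>. Pairing it with \<open>x\<close> for \<open>z = x t\<close>,
  \<open>mild_duality\<close> expresses \<open>inner z z\<close> through \<open>x0\<close>,
  \<open>f\<close> and \<open>C x\<close>, each tested against \<open>V\<close>. The decay of
  \<open>V\<close> leaves one factor \<open>norm z\<close>, which is divided out.\<close>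

lemma detectable_state_bound:
  fixes X :: "'x::{real_inner,banach,second_countable_topology} set" and C :: "'x \<Rightarrow> 'y::{real_inner,banach}"
  assumes X: "closed_subspace X" and Y: "closed_subspace Y" and S: "generates X D A S"
    and C: "bop X Y C" and L: "bop X Y L" "\<And>x. x \<in> X \<Longrightarrow> norm (L x) \<le> CL * norm x"
    and V: "generates X (uadj_dom X D A) (\<lambda>x. uadj X D A x + badj X Y C (L x)) V"
    and stable: "\<And>t z. t \<ge> 0 \<Longrightarrow> z \<in> X \<Longrightarrow> norm (V t z) \<le> M * exp (- k * t) * norm z" and M: "M \<ge> 0"
    and f: "set_integrable lborel {0..T} f" "\<And>s. s \<in> {0..T} \<Longrightarrow> f s \<in> X"
    and x: "continuous_on {0..T} x" "\<And>s. s \<in> {0..T} \<Longrightarrow> x s \<in> X" and x0: "x0 \<in> X"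
    and weak: "\<And>t q. t \<in> {0..T} \<Longrightarrow> q \<in> X \<Longrightarrow> inner (x t) q =
      inner (S t x0) q + (LINT s:{0..t}|lborel. inner (S (t - s) (f s)) q)"
    and t: "t \<in> {0..T}" and CL: "CL \<ge> 0"
  shows "norm (x t) \<le> M * exp (- k * t) * norm x0 +
    (LINT s:{0..t}|lborel. M * exp (- k * (t - s)) * (norm (f s) + CL * norm (C (x s))))"
proof -
  note Ss = generatesD(1)[OF S]
  note Vs = generatesD(1)[OF V]
  note VD = c0_semigroupD[OF Vs]
  have E: "bop X X (\<lambda>x. badj X Y C (L x))" by (rule bop_comp[OF L(1) badj_bop[OF X Y C]])
  define z where "z = x t"
  have z: "z \<in> X" using x(2)[OF t] by (simp add: z_def)
  have sub: "s \<in> {0..T}" if "s \<in> {0..t}" for s using that t by auto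
  have f': "set_integrable lborel {0..t} f"
    by (rule set_integrable_subset[OF f(1)]) (use t in auto)
  have x': "continuous_on {0..t} x" by (rule continuous_on_subset[OF x(1)]) (use t in auto)
  define g where "g \<sigma> = badj X Y C (L (V (t - \<sigma>) z))" for \<sigma>
  have cV: "continuous_on {0..t} (\<lambda>\<sigma>. V (t - \<sigma>) z)"
    by (rule continuous_on_orbit[OF X Vs z]) (auto intro!: continuous_intros)
  have cg: "continuous_on {0..t} g"
    unfolding g_def by (rule continuous_on_bop[OF X E cV]) (use VD z in auto)
  have gX: "g \<sigma> \<in> X" if "\<sigma> \<in> {0..t}" for \<sigma> unfolding g_def using bop_mem[OF E] VD(4) z that by simp
  have dual: "inner (x t) z - inner x0 (V (t - 0) z) =
    (LINT s:{0..t}|lborel. inner (f s) (V (t - s) z)) - (LINT s:{0..t}|lborel. inner (x s) (g s))"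
  proof (rule mild_duality[OF X Ss _ f' _ borel_integrable_atLeastAtMost'[OF cg] gX x0 z])
    show "inner (x s) q = inner (S (s - 0) x0) q + (LINT \<sigma>:{0..s}|lborel. inner (S (s - \<sigma>) (f \<sigma>)) q)"
      if "s \<in> {0..t}" "q \<in> X" for s q using weak[OF sub that(2)] that by simp
    fix s p assume s: "s \<in> {0..t}" and p: "p \<in> X"
    then have "inner p (V (t - s) z) = inner (S (t - s) p) z +
        (LINT r:{0..t - s}|lborel. inner (S (t - s - r) p) (badj X Y C (L (V r z))))"
      using duhamel_perturbed_adjoint[OF X S V E p z, of "t - s"] by simp
    then show "inner p (V (t - s) z) = inner (S (t - s) p) z +
        (LINT \<sigma>:{s..t}|lborel. inner (S (\<sigma> - s) p) (g \<sigma>))"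
      unfolding set_integral_reflect_Icc g_def by (simp add: algebra_simps)
  qed (use t f sub in auto)
  define m where "m s = M * exp (- k * (t - s)) * (norm (f s) + CL * norm (C (x s)))" for s
  have nf: "set_integrable lborel {0..t} (\<lambda>s. norm (f s))" using f' by (rule set_integrable_norm)
  have cC: "continuous_on {0..t} (\<lambda>s. CL * norm (C (x s)))"
    using sub x(2) by (intro continuous_intros continuous_on_bop[OF X C x']) auto
  have "set_integrable lborel {0..t} (\<lambda>s. norm (f s) + CL * norm (C (x s)))"
    by (rule set_integral_add(1)[OF nf borel_integrable_atLeastAtMost'[OF cC]])
  then have m_int: "set_integrable lborel {0..t} m"
    unfolding m_def by (intro set_integrable_mult_continuous continuous_intros)
  have fV: "set_integrable lborel {0..t} (\<lambda>s. inner (f s) (V (t - s) z))"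
    using set_integrable_inner_continuous[OF cV f'] by (simp add: inner_commute)
  have xg: "set_integrable lborel {0..t} (\<lambda>s. inner (x s) (g s))"
    by (intro borel_integrable_atLeastAtMost' continuous_intros x' cg)
  have "\<bar>LINT s:{0..t}|lborel. inner (f s) (V (t - s) z) - inner (x s) (g s)\<bar> \<le> (LINT s:{0..t}|lborel. norm z * m s)"
  proof (rule abs_set_integral_le[OF set_integral_diff(1)[OF fV xg]])
    show "set_integrable lborel {0..t} (\<lambda>s. norm z * m s)" using m_int by simp
    fix s assume s: "s \<in> {0..t}"
    then have VX: "V (t - s) z \<in> X" and xX: "x s \<in> X" using VD(4) z x(2) sub by auto
    have nV: "norm (V (t - s) z) \<le> M * exp (- k * (t - s)) * norm z" using stable s z by simp
    have "\<bar>inner (f s) (V (t - s) z)\<bar> \<le> norm (f s) * norm (V (t - s) z)" by (rule Cauchy_Schwarz_ineq2)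
    \<comment> \<open>The adjoint of \<open>C\<close> is moved back onto \<open>x s\<close>, so that
      the state enters the forcing only through \<open>C (x s)\<close>, which the energy
      controls.\<close>
    moreover have "inner (x s) (g s) = inner (C (x s)) (L (V (t - s) z))"
      unfolding g_def using badj_props(2)[OF X C xX] by simp
    then have "\<bar>inner (x s) (g s)\<bar> \<le> norm (C (x s)) * norm (L (V (t - s) z))"
      by (simp add: Cauchy_Schwarz_ineq2)
    moreover have "norm (C (x s)) * norm (L (V (t - s) z)) \<le> norm (C (x s)) * (CL * norm (V (t - s) z))"
      by (intro mult_left_mono L(2) VX) auto
    ultimately have "\<bar>inner (f s) (V (t - s) z) - inner (x s) (g s)\<bar> \<le>
        (norm (f s) + CL * norm (C (x s))) * norm (V (t - s) z)"
      by (simp add: algebra_simps)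
    also have "\<dots> \<le> (norm (f s) + CL * norm (C (x s))) * (M * exp (- k * (t - s)) * norm z)"
      using CL by (intro mult_left_mono nV) auto
    finally show "\<bar>inner (f s) (V (t - s) z) - inner (x s) (g s)\<bar> \<le> norm z * m s"
      by (simp add: m_def ac_simps)
  qed
  then have "\<bar>inner z z - inner x0 (V t z)\<bar> \<le> norm z * (LINT s:{0..t}|lborel. m s)"
    using dual set_integral_diff(2)[OF fV xg] by (simp add: z_def)
  moreover have "inner x0 (V t z) \<le> norm x0 * (M * exp (- k * t) * norm z)"
    using norm_cauchy_schwarz[of x0 "V t z"] mult_left_mono[OF stable[of t z], of "norm x0"] t z by simp
  ultimately have "norm z * norm z \<le> norm z * (M * exp (- k * t) * norm x0 + (LINT s:{0..t}|lborel. m s))"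
    by (simp add: power2_norm_eq_inner[symmetric] power2_eq_square algebra_simps)
  moreover have "0 \<le> M * exp (- k * t) * norm x0 + (LINT s:{0..t}|lborel. m s)"
    using M CL by (auto simp: m_def set_lebesgue_integral_def intro!: add_nonneg_nonneg Bochner_Integration.integral_nonneg)
  ultimately show ?thesis unfolding m_def[symmetric] z_def[symmetric] by (cases "z = 0") auto
qed

text \<open>Mirror image of the state bound: for \<open>z = lam t\<close> the forward orbit
  \<open>W (s - t) z\<close> is a mild state on \<open>[t, T]\<close> with forcing
  \<open>B (K (W (s - t) z))\<close>, and moving \<open>B\<close> onto \<open>lam\<close> leaves
  only its adjoint applied to \<open>lam\<close>.\<close>

lemma stabilizable_costate_bound:
  fixes X :: "'x::{real_inner,banach,second_countable_topology} set" and B :: "'u::{real_inner,banach} \<Rightarrow> 'x"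
  assumes X: "closed_subspace X" and U: "closed_subspace U" and S: "generates X D A S"
    and B: "bop U X B" and K: "bop X U K" "\<And>x. x \<in> X \<Longrightarrow> norm (K x) \<le> CK * norm x"
    and W: "generates X D (\<lambda>x. A x + B (K x)) W"
    and stable: "\<And>t z. t \<ge> 0 \<Longrightarrow> z \<in> X \<Longrightarrow> norm (W t z) \<le> M * exp (- k * t) * norm z" and M: "M \<ge> 0"
    and g: "set_integrable lborel {0..T} g" "\<And>s. s \<in> {0..T} \<Longrightarrow> g s \<in> X"
    and lam: "continuous_on {0..T} lam" "\<And>s. s \<in> {0..T} \<Longrightarrow> lam s \<in> X" and lT: "lT \<in> X"
    and weak: "\<And>t p. t \<in> {0..T} \<Longrightarrow> p \<in> X \<Longrightarrow> inner p (lam t) =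
      inner (S (T - t) p) lT + (LINT s:{t..T}|lborel. inner (S (s - t) p) (g s))"
    and t: "t \<in> {0..T}" and CK: "CK \<ge> 0"
  shows "norm (lam t) \<le> M * exp (- k * (T - t)) * norm lT +
    (LINT s:{t..T}|lborel. M * exp (- k * (s - t)) * (norm (g s) + CK * norm (badj U X B (lam s))))"
proof -
  note Ss = generatesD(1)[OF S]
  note Ws = generatesD(1)[OF W]
  note WD = c0_semigroupD[OF Ws]
  have E: "bop X X (\<lambda>x. B (K x))" by (rule bop_comp[OF K(1) B])
  have B': "bop X U (badj U X B)" by (rule badj_bop[OF U X B])
  define z where "z = lam t"
  have z: "z \<in> X" using lam(2)[OF t] by (simp add: z_def)
  have sub: "s \<in> {0..T}" if "s \<in> {t..T}" for s using that t by auto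
  have g': "set_integrable lborel {t..T} g"
    by (rule set_integrable_subset[OF g(1)]) (use t in auto)
  have lam': "continuous_on {t..T} lam" by (rule continuous_on_subset[OF lam(1)]) (use t in auto)
  define f where "f \<sigma> = B (K (W (\<sigma> - t) z))" for \<sigma>
  have cW: "continuous_on {t..T} (\<lambda>\<sigma>. W (\<sigma> - t) z)"
    by (rule continuous_on_orbit[OF X Ws z]) (auto intro!: continuous_intros)
  have cf: "continuous_on {t..T} f"
    unfolding f_def by (rule continuous_on_bop[OF X E cW]) (use WD z in auto)
  have fX: "f \<sigma> \<in> X" if "\<sigma> \<in> {t..T}" for \<sigma> unfolding f_def using bop_mem[OF E] WD(4) z that by simp
  have dual: "inner (W (T - t) z) lT - inner z (lam t) =
    (LINT s:{t..T}|lborel. inner (f s) (lam s)) - (LINT s:{t..T}|lborel. inner (W (s - t) z) (g s))"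
  proof (rule mild_duality[OF X Ss _ borel_integrable_atLeastAtMost'[OF cf] fX g' _ z lT])
    show "inner p (lam s) = inner (S (T - s) p) lT + (LINT \<sigma>:{s..T}|lborel. inner (S (\<sigma> - s) p) (g \<sigma>))"
      if "s \<in> {t..T}" "p \<in> X" for s p using weak[OF sub that(2)] that by simp
    fix s q assume s: "s \<in> {t..T}" and q: "q \<in> X"
    then have "inner (W (s - t) z) q = inner (S (s - t) z) q +
        (LINT r:{0..s - t}|lborel. inner (S (s - t - r) (B (K (W r z)))) q)"
      using duhamel_perturbed_semigroup[OF X S W E z, of "s - t" q] by simp
    then show "inner (W (s - t) z) q = inner (S (s - t) z) q +
        (LINT \<sigma>:{t..s}|lborel. inner (S (s - \<sigma>) (f \<sigma>)) q)"
      unfolding set_integral_shift_Icc f_def by (simp add: algebra_simps)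
  qed (use t g sub in auto)
  define m where "m s = M * exp (- k * (s - t)) * (norm (g s) + CK * norm (badj U X B (lam s)))" for s
  have ng: "set_integrable lborel {t..T} (\<lambda>s. norm (g s))" using g' by (rule set_integrable_norm)
  have cB: "continuous_on {t..T} (\<lambda>s. CK * norm (badj U X B (lam s)))"
    using sub lam(2) by (intro continuous_intros continuous_on_bop[OF X B' lam']) auto
  have "set_integrable lborel {t..T} (\<lambda>s. norm (g s) + CK * norm (badj U X B (lam s)))"
    by (rule set_integral_add(1)[OF ng borel_integrable_atLeastAtMost'[OF cB]])
  then have m_int: "set_integrable lborel {t..T} m"
    unfolding m_def by (intro set_integrable_mult_continuous continuous_intros)
  have Wg: "set_integrable lborel {t..T} (\<lambda>s. inner (W (s - t) z) (g s))"
    by (rule set_integrable_inner_continuous[OF cW g'])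
  have fl: "set_integrable lborel {t..T} (\<lambda>s. inner (f s) (lam s))"
    by (intro borel_integrable_atLeastAtMost' continuous_intros lam' cf)
  have "\<bar>LINT s:{t..T}|lborel. inner (f s) (lam s) - inner (W (s - t) z) (g s)\<bar> \<le> (LINT s:{t..T}|lborel. norm z * m s)"
  proof (rule abs_set_integral_le[OF set_integral_diff(1)[OF fl Wg]])
    show "set_integrable lborel {t..T} (\<lambda>s. norm z * m s)" using m_int by simp
    fix s assume s: "s \<in> {t..T}"
    then have WX: "W (s - t) z \<in> X" using WD(4) z by auto
    have nW: "norm (W (s - t) z) \<le> M * exp (- k * (s - t)) * norm z" using stable s z by simp
    have "\<bar>inner (W (s - t) z) (g s)\<bar> \<le> norm (W (s - t) z) * norm (g s)" by (rule Cauchy_Schwarz_ineq2)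
    moreover have "inner (f s) (lam s) = inner (K (W (s - t) z)) (badj U X B (lam s))"
      unfolding f_def using badj_props(2)[OF U B bop_mem[OF K(1) WX]] by simp
    then have "\<bar>inner (f s) (lam s)\<bar> \<le> norm (K (W (s - t) z)) * norm (badj U X B (lam s))"
      by (simp add: Cauchy_Schwarz_ineq2)
    moreover have "norm (K (W (s - t) z)) * norm (badj U X B (lam s)) \<le>
        (CK * norm (W (s - t) z)) * norm (badj U X B (lam s))"
      by (intro mult_right_mono K(2) WX) auto
    ultimately have "\<bar>inner (f s) (lam s) - inner (W (s - t) z) (g s)\<bar> \<le>
        (norm (g s) + CK * norm (badj U X B (lam s))) * norm (W (s - t) z)"
      by (simp add: algebra_simps)
    also have "\<dots> \<le> (norm (g s) + CK * norm (badj U X B (lam s))) * (M * exp (- k * (s - t)) * norm z)"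
      using CK by (intro mult_left_mono nW) auto
    finally show "\<bar>inner (f s) (lam s) - inner (W (s - t) z) (g s)\<bar> \<le> norm z * m s"
      by (simp add: m_def ac_simps)
  qed
  then have "\<bar>inner (W (T - t) z) lT - inner z z\<bar> \<le> norm z * (LINT s:{t..T}|lborel. m s)"
    using dual set_integral_diff(2)[OF fl Wg] by (simp add: z_def)
  moreover have "inner (W (T - t) z) lT \<le> (M * exp (- k * (T - t)) * norm z) * norm lT"
    using norm_cauchy_schwarz[of "W (T - t) z" lT] mult_right_mono[OF stable[of "T - t" z], of "norm lT"] t z by simp
  ultimately have "norm z * norm z \<le> norm z * (M * exp (- k * (T - t)) * norm lT + (LINT s:{t..T}|lborel. m s))"
    by (simp add: power2_norm_eq_inner[symmetric] power2_eq_square algebra_simps)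
  moreover have "0 \<le> M * exp (- k * (T - t)) * norm lT + (LINT s:{t..T}|lborel. m s)"
    using M CK by (auto simp: m_def set_lebesgue_integral_def intro!: add_nonneg_nonneg Bochner_Integration.integral_nonneg)
  ultimately show ?thesis unfolding m_def[symmetric] z_def[symmetric] by (cases "z = 0") auto
qed

section \<open>Convolution with the exponential kernel\<close>

lemma set_integral_Cauchy_Schwarz:
  fixes u v :: "'a \<Rightarrow> real"
  assumes u: "set_integrable M A (\<lambda>s. (u s)\<^sup>2)" and v: "set_integrable M A (\<lambda>s. (v s)\<^sup>2)"
    and uv: "set_integrable M A (\<lambda>s. u s * v s)"
  shows "(LINT s:A|M. u s * v s)\<^sup>2 \<le> (LINT s:A|M. (u s)\<^sup>2) * (LINT s:A|M. (v s)\<^sup>2)"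
proof -
  let ?a = "LINT s:A|M. (u s)\<^sup>2" and ?b = "LINT s:A|M. u s * v s" and ?d = "LINT s:A|M. (v s)\<^sup>2"
  have q: "0 \<le> ?a - 2 * c * ?b + c\<^sup>2 * ?d" for c
  proof -
    have "0 \<le> (LINT s:A|M. (u s - c * v s)\<^sup>2)"
      unfolding set_lebesgue_integral_def by (rule Bochner_Integration.integral_nonneg) simp
    also have "\<dots> = (LINT s:A|M. ((u s)\<^sup>2 - 2 * c * (u s * v s)) + c\<^sup>2 * (v s)\<^sup>2)"
      by (simp add: power2_eq_square algebra_simps)
    also have "\<dots> = (LINT s:A|M. (u s)\<^sup>2 - 2 * c * (u s * v s)) + (LINT s:A|M. c\<^sup>2 * (v s)\<^sup>2)"
      using u v uv by (intro set_integral_add(2) set_integral_diff(1) set_integrable_mult_right) auto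
    also have "(LINT s:A|M. (u s)\<^sup>2 - 2 * c * (u s * v s)) = ?a - (LINT s:A|M. 2 * c * (u s * v s))"
      using u v uv by (intro set_integral_diff(2) set_integrable_mult_right) auto
    finally show ?thesis by simp
  qed
  have d: "0 \<le> ?d"
    unfolding set_lebesgue_integral_def by (rule Bochner_Integration.integral_nonneg) simp
  show ?thesis
  proof (cases "?d = 0")
    case True
    have "?b = 0"
    proof (rule ccontr)
      assume "?b \<noteq> 0"
      \<comment> \<open>For this \<open>c\<close> the right side of \<open>q\<close> equals
        \<open>-1\<close>.\<close>
      then show False using q[of "(?a + 1) / (2 * ?b)"] True by simp
    qed
    then show ?thesis using True by simp
  next
    case False
    with d have "?d > 0" by simp
    then show ?thesis using q[of "?b / ?d"] by (simp add: power2_eq_square field_simps)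
  qed
qed

text \<open>Each side of \<open>s\<close> contributes at most \<open>1 / \<kappa>\<close>, whatever
  \<open>T\<close> is. Every constant that is uniform in the horizon rests on this.\<close>

lemma exp_kernel_integral_le:
  fixes \<kappa> :: real
  assumes \<kappa>: "\<kappa> > 0" and s: "s \<in> {0..T}"
  shows "(LINT t:{0..T}|lborel. exp (- \<kappa> * \<bar>t - s\<bar>)) \<le> 2 / \<kappa>"
proof -
  let ?f = "\<lambda>t. exp (- \<kappa> * \<bar>t - s\<bar>)"
  have c: "continuous_on {0..T} ?f" by (intro continuous_intros)
  have l: "(?f has_integral exp (- \<kappa> * (s - s)) / \<kappa> - exp (- \<kappa> * (s - 0)) / \<kappa>) {0..s}"
  proof (rule has_integral_eq[rotated])
    show "((\<lambda>t. exp (- \<kappa> * (s - t))) has_integral exp (- \<kappa> * (s - s)) / \<kappa> - exp (- \<kappa> * (s - 0)) / \<kappa>) {0..s}"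
      using \<kappa> s by (intro fundamental_theorem_of_calculus)
        (auto intro!: derivative_eq_intros simp: has_real_derivative_iff_has_vector_derivative[symmetric])
  qed auto
  have r: "(?f has_integral - exp (- \<kappa> * (T - s)) / \<kappa> - - exp (- \<kappa> * (s - s)) / \<kappa>) {s..T}"
  proof (rule has_integral_eq[rotated])
    show "((\<lambda>t. exp (- \<kappa> * (t - s))) has_integral - exp (- \<kappa> * (T - s)) / \<kappa> - - exp (- \<kappa> * (s - s)) / \<kappa>) {s..T}"
      using \<kappa> s by (intro fundamental_theorem_of_calculus)
        (auto intro!: derivative_eq_intros simp: has_real_derivative_iff_has_vector_derivative[symmetric])
  qed auto
  have "(LINT t:{0..T}|lborel. ?f t) = integral {0..T} ?f"
    by (rule set_borel_integral_eq_integral(2)[OF borel_integrable_atLeastAtMost'[OF c]])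
  also have "\<dots> = (exp (- \<kappa> * (s - s)) / \<kappa> - exp (- \<kappa> * (s - 0)) / \<kappa>) +
      (- exp (- \<kappa> * (T - s)) / \<kappa> - - exp (- \<kappa> * (s - s)) / \<kappa>)"
    by (rule integral_unique[OF has_integral_combine[OF _ _ l r]]) (use s in auto)
  also have "\<dots> \<le> 2 / \<kappa>" using \<kappa> by (simp add: field_simps)
  finally show ?thesis .
qed

text \<open>The L1 case of Young's inequality: after exchanging the integrals, the inner one is the
  kernel mass.\<close>

lemma exp_kernel_double_integral:
  fixes q :: "real \<Rightarrow> real"
  assumes \<kappa>: "\<kappa> > 0" and q: "set_integrable lborel {0..T} q" "\<And>s. s \<in> {0..T} \<Longrightarrow> 0 \<le> q s"
  shows "set_integrable lborel {0..T} (\<lambda>t. LINT s:{0..T}|lborel. exp (- \<kappa> * \<bar>t - s\<bar>) * q s)"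
    "(LINT t:{0..T}|lborel. LINT s:{0..T}|lborel. exp (- \<kappa> * \<bar>t - s\<bar>) * q s) \<le>
      2 / \<kappa> * (LINT s:{0..T}|lborel. q s)"
proof -
  define q1 where "q1 s = indicator {0..T} s * q s" for s
  define k where "k t s = indicator {0..T} t * exp (- \<kappa> * \<bar>t - s\<bar>) * q1 s" for t s :: real
  have q1: "integrable lborel q1" using q(1) by (simp add: set_integrable_def q1_def[abs_def])
  then have m [measurable]: "q1 \<in> borel_measurable borel" by simp
  have int: "integrable (lborel \<Otimes>\<^sub>M lborel) (\<lambda>(t, s). k t s)"
  proof (rule Bochner_Integration.integrable_bound)
    show "integrable (lborel \<Otimes>\<^sub>M lborel) (\<lambda>(t, s). indicator {0..T} t * q1 s)"
      using q1 by (intro integrable_prod_mult integrable_real_indicator) (auto simp: emeasure_lborel_Icc_eq)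
    show "(\<lambda>(t, s). k t s) \<in> borel_measurable (lborel \<Otimes>\<^sub>M lborel)"
      unfolding k_def by measurable
    show "AE p in lborel \<Otimes>\<^sub>M lborel. norm (case p of (t, s) \<Rightarrow> k t s)
        \<le> norm (case p of (t, s) \<Rightarrow> indicator {0..T} t * q1 s)"
      using \<kappa> by (intro AE_I2) (auto simp: k_def abs_mult indicator_def intro!: mult_left_le_one_le)
  qed
  have e1: "(\<integral>s. k t s \<partial>lborel) = indicator {0..T} t *\<^sub>R (LINT s:{0..T}|lborel. exp (- \<kappa> * \<bar>t - s\<bar>) * q s)" for t
    by (cases "t \<in> {0..T}") (simp_all add: k_def q1_def set_lebesgue_integral_def mult.left_commute)
  have e2: "(\<integral>t. k t s \<partial>lborel) = q1 s * (LINT t:{0..T}|lborel. exp (- \<kappa> * \<bar>t - s\<bar>))" for s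
    by (simp add: k_def set_lebesgue_integral_def mult.commute)
  show "set_integrable lborel {0..T} (\<lambda>t. LINT s:{0..T}|lborel. exp (- \<kappa> * \<bar>t - s\<bar>) * q s)"
    using lborel_pair.integrable_fst'[OF int] by (simp add: set_integrable_def e1)
  have "(LINT t:{0..T}|lborel. LINT s:{0..T}|lborel. exp (- \<kappa> * \<bar>t - s\<bar>) * q s) = (\<integral>t. (\<integral>s. k t s \<partial>lborel) \<partial>lborel)"
    by (simp add: e1 set_lebesgue_integral_def)
  also have "\<dots> = (\<integral>s. (\<integral>t. k t s \<partial>lborel) \<partial>lborel)"
    using lborel_pair.Fubini_integral[OF int] by simp
  also have "\<dots> \<le> (\<integral>s. q1 s * (2 / \<kappa>) \<partial>lborel)"
  proof (rule integral_mono)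
    show "integrable lborel (\<lambda>s. \<integral>t. k t s \<partial>lborel)" using lborel_pair.integrable_snd[OF int] by simp
    show "integrable lborel (\<lambda>s. q1 s * (2 / \<kappa>))" using q1 by simp
    show "(\<integral>t. k t s \<partial>lborel) \<le> q1 s * (2 / \<kappa>)" for s
      unfolding e2 using mult_left_mono[OF exp_kernel_integral_le[OF \<kappa>, of s T] q(2)[of s]]
      by (cases "s \<in> {0..T}") (simp_all add: q1_def)
  qed
  also have "\<dots> = 2 / \<kappa> * (LINT s:{0..T}|lborel. q s)"
    using q1 by (simp add: q1_def set_lebesgue_integral_def)
  finally show "(LINT t:{0..T}|lborel. LINT s:{0..T}|lborel. exp (- \<kappa> * \<bar>t - s\<bar>) * q s) \<le>
      2 / \<kappa> * (LINT s:{0..T}|lborel. q s)" .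
qed

lemma norm_1v2_nonneg: "0 \<le> norm_1v2 T f"
  unfolding norm_1v2_def L1norm_def L2norm_def set_lebesgue_integral_def
  by (auto intro!: Bochner_Integration.integral_nonneg)

text \<open>Whichever norm attains the minimum, the L2 branch brings square integrability with it;
  the estimates below are proved branch by branch.\<close>

lemma norm_1v2_cases:
  obtains "norm_1v2 T f = L1norm T f"
  | "set_integrable lborel {0..T} (\<lambda>t. (norm (f t))\<^sup>2)" "norm_1v2 T f = L2norm T f"
proof -
  have "norm_1v2 T f = L1norm T f \<or>
    set_integrable lborel {0..T} (\<lambda>t. (norm (f t))\<^sup>2) \<and> norm_1v2 T f = L2norm T f"
    unfolding norm_1v2_def by (auto simp: min_def)
  then show ?thesis using that by blast
qed

lemma L2norm_sq: "(L2norm T f)\<^sup>2 = (LINT t:{0..T}|lborel. (norm (f t))\<^sup>2)"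
  unfolding L2norm_def set_lebesgue_integral_def
  by (intro real_sqrt_pow2 Bochner_Integration.integral_nonneg) simp

lemma L2norm_nonneg: "0 \<le> L2norm T f"
  unfolding L2norm_def set_lebesgue_integral_def by (simp add: Bochner_Integration.integral_nonneg)

text \<open>The symmetric kernel on all of \<open>[0, T]\<close> dominates the forward kernel of the state equation and
  the backward kernel of the costate equation alike.\<close>
definition exp_conv :: "real \<Rightarrow> real \<Rightarrow> (real \<Rightarrow> real) \<Rightarrow> real \<Rightarrow> real" where
  "exp_conv k T h t = (LINT s:{0..T}|lborel. exp (- k * \<bar>t - s\<bar>) * h s)"

text \<open>Four Young inequalities in one: the factor is 1 from L1 to sup,
  \<open>1 / sqrt k\<close> from L2 to sup and from L1 to L2, and \<open>2 / k\<close> from L2 to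
  L2. The constant \<open>c\<close> is a common bound for all of them.\<close>

lemma exp_conv_bounds:
  fixes h :: "real \<Rightarrow> real"
  assumes k: "k > 0" and h: "set_integrable lborel {0..T} h" "\<And>s. s \<in> {0..T} \<Longrightarrow> 0 \<le> h s"
  defines "c \<equiv> 1 + 1 / sqrt k + 2 / k"
  shows "0 \<le> exp_conv k T h t" "t \<in> {0..T} \<Longrightarrow> exp_conv k T h t \<le> c * norm_1v2 T h"
    "set_integrable lborel {0..T} (\<lambda>t. (exp_conv k T h t)\<^sup>2)"
    "(LINT t:{0..T}|lborel. (exp_conv k T h t)\<^sup>2) \<le> (c * norm_1v2 T h)\<^sup>2"
proof -
  have c: "c \<ge> 1" "c \<ge> 1 / sqrt k" "c \<ge> 2 / k" "c > 0"
    using k by (auto simp: c_def intro!: add_pos_pos add_nonneg_pos)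
  define n where "n = norm_1v2 T h"
  have n: "n \<ge> 0" by (simp add: n_def norm_1v2_nonneg)
  have ceq: "continuous_on {0..T} (\<lambda>s. exp (- \<kappa> * \<bar>t - s\<bar>))" for \<kappa> t :: real by (intro continuous_intros)
  have ki: "set_integrable lborel {0..T} (\<lambda>s. exp (- \<kappa> * \<bar>t - s\<bar>) * h s)" for \<kappa> t
    by (rule set_integrable_mult_continuous[OF ceq h(1)])
  show nn: "0 \<le> exp_conv k T h t" for t
    unfolding exp_conv_def set_lebesgue_integral_def
    using h(2) by (intro Bochner_Integration.integral_nonneg) (auto simp: indicator_def)
  have L1eq: "L1norm T h = (LINT s:{0..T}|lborel. h s)"
    unfolding L1norm_def using h(2) by (intro set_lebesgue_integral_cong) auto
  have b1: "exp_conv k T h t \<le> L1norm T h" for t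
    unfolding exp_conv_def L1eq
    using k h by (intro set_integral_mono ki) (simp_all add: mult_left_le_one_le)
  \<comment> \<open>Cauchy-Schwarz with \<open>h\<close> split as \<open>sqrt h * sqrt h\<close> and
    the whole kernel on one factor; its square has rate \<open>2 k\<close>.\<close>
  have sq1: "(exp_conv k T h t)\<^sup>2 \<le> L1norm T h * (LINT s:{0..T}|lborel. exp (- (2 * k) * \<bar>t - s\<bar>) * h s)" for t
  proof -
    have e: "(exp (- k * \<bar>t - s\<bar>) * sqrt (h s))\<^sup>2 = exp (- (2 * k) * \<bar>t - s\<bar>) * h s" if "s \<in> {0..T}" for s
      using h(2)[OF that] by (simp add: power_mult_distrib exp_double[symmetric] mult.assoc)
    have i: "set_integrable lborel {0..T} (\<lambda>s. (exp (- k * \<bar>t - s\<bar>) * sqrt (h s))\<^sup>2)"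
      using ki[of "2 * k" t] e by (subst set_integrable_cong[OF refl refl e]) auto
    have i2: "set_integrable lborel {0..T} (\<lambda>s. (sqrt (h s))\<^sup>2)"
      using h by (subst set_integrable_cong[OF refl refl, of _ _ h]) auto
    have i3: "set_integrable lborel {0..T} (\<lambda>s. sqrt (h s) * (exp (- k * \<bar>t - s\<bar>) * sqrt (h s)))"
      using h ki[of k t] by (subst set_integrable_cong[OF refl refl, of _ _ "\<lambda>s. exp (- k * \<bar>t - s\<bar>) * h s"]) auto
    have "(LINT s:{0..T}|lborel. sqrt (h s) * (exp (- k * \<bar>t - s\<bar>) * sqrt (h s)))\<^sup>2 \<le>
      (LINT s:{0..T}|lborel. (sqrt (h s))\<^sup>2) * (LINT s:{0..T}|lborel. (exp (- k * \<bar>t - s\<bar>) * sqrt (h s))\<^sup>2)"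
      by (rule set_integral_Cauchy_Schwarz[OF i2 i i3])
    moreover have "(LINT s:{0..T}|lborel. sqrt (h s) * (exp (- k * \<bar>t - s\<bar>) * sqrt (h s))) = exp_conv k T h t"
      unfolding exp_conv_def using h(2) by (intro set_lebesgue_integral_cong) auto
    moreover have "(LINT s:{0..T}|lborel. (sqrt (h s))\<^sup>2) = L1norm T h"
      unfolding L1eq using h(2) by (intro set_lebesgue_integral_cong) auto
    moreover have "(LINT s:{0..T}|lborel. (exp (- k * \<bar>t - s\<bar>) * sqrt (h s))\<^sup>2) =
        (LINT s:{0..T}|lborel. exp (- (2 * k) * \<bar>t - s\<bar>) * h s)"
      using e by (intro set_lebesgue_integral_cong) auto
    ultimately show ?thesis by simp
  qed
  \<comment> \<open>Cauchy-Schwarz with the decay rate divided as \<open>\<kappa> / 2\<close> and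
    \<open>k - \<kappa> / 2\<close>. The choice \<open>\<kappa> = 2 k\<close> leaves no kernel on
    \<open>h\<close> and gives the sup bound; \<open>\<kappa> = k\<close> keeps an integrable kernel
    on \<open>h\<close> and gives the L2 bound.\<close>
  have sq2: "(exp_conv k T h t)\<^sup>2 \<le> (LINT s:{0..T}|lborel. exp (- \<kappa> * \<bar>t - s\<bar>)) *
      (LINT s:{0..T}|lborel. exp (- (2 * k - \<kappa>) * \<bar>t - s\<bar>) * (h s)\<^sup>2)"
    if h2: "set_integrable lborel {0..T} (\<lambda>s. (h s)\<^sup>2)" for t \<kappa>
  proof -
    define u where "u s = exp (- (\<kappa> / 2) * \<bar>t - s\<bar>)" for s
    define v where "v s = exp (- (k - \<kappa> / 2) * \<bar>t - s\<bar>) * h s" for s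
    have u2: "(u s)\<^sup>2 = exp (- \<kappa> * \<bar>t - s\<bar>)" for s
      by (simp add: u_def exp_double[symmetric])
    have v2: "(v s)\<^sup>2 = exp (- (2 * k - \<kappa>) * \<bar>t - s\<bar>) * (h s)\<^sup>2" for s
      by (simp add: v_def exp_double[symmetric] power_mult_distrib algebra_simps)
    have uv: "u s * v s = exp (- k * \<bar>t - s\<bar>) * h s" for s
      by (simp add: u_def v_def exp_add[symmetric] mult.assoc[symmetric] algebra_simps)
    have "(LINT s:{0..T}|lborel. u s * v s)\<^sup>2 \<le> (LINT s:{0..T}|lborel. (u s)\<^sup>2) * (LINT s:{0..T}|lborel. (v s)\<^sup>2)"
      by (rule set_integral_Cauchy_Schwarz; unfold u2 v2 uv)
        (intro ki borel_integrable_atLeastAtMost'[OF ceq] set_integrable_mult_continuous[OF ceq h2])+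
    then show ?thesis unfolding u2 v2 uv exp_conv_def .
  qed
  have m0: "set_integrable lborel {0..T} (exp_conv k T h)"
    unfolding exp_conv_def[abs_def] by (rule exp_kernel_double_integral(1)[OF k h])
  \<comment> \<open>Square integrability in either branch: one factor is replaced by its bound
    \<open>L1norm T h\<close>, the other is integrable.\<close>
  have bnd: "\<bar>(exp_conv k T h t)\<^sup>2\<bar> \<le> \<bar>L1norm T h * exp_conv k T h t\<bar>" for t
  proof -
    have "exp_conv k T h t * exp_conv k T h t \<le> L1norm T h * exp_conv k T h t"
      by (rule mult_right_mono[OF b1 nn])
    then show ?thesis using nn[of t] by (simp add: power2_eq_square)
  qed
  have m1: "(\<lambda>t. indicator {0..T} t * exp_conv k T h t) \<in> borel_measurable lborel"
    using borel_measurable_integrable[OF m0[unfolded set_integrable_def]] by simp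
  show int2: "set_integrable lborel {0..T} (\<lambda>t. (exp_conv k T h t)\<^sup>2)"
  proof (rule set_integrable_bound[where f = "\<lambda>t. L1norm T h * exp_conv k T h t"])
    show "set_integrable lborel {0..T} (\<lambda>t. L1norm T h * exp_conv k T h t)" using m0 by simp
    have "(\<lambda>t. (indicator {0..T} t * exp_conv k T h t)\<^sup>2) \<in> borel_measurable lborel" using m1 by measurable
    moreover have "(\<lambda>t. (indicator {0..T} t * exp_conv k T h t)\<^sup>2) =
        (\<lambda>t. indicator {0..T} t *\<^sub>R (exp_conv k T h t)\<^sup>2)" by (auto simp: indicator_def)
    ultimately show "set_borel_measurable lborel {0..T} (\<lambda>t. (exp_conv k T h t)\<^sup>2)"
      unfolding set_borel_measurable_def by simp
    show "AE x in lborel. x \<in> {0..T} \<longrightarrow> norm ((exp_conv k T h x)\<^sup>2) \<le> norm (L1norm T h * exp_conv k T h x)"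
      using bnd by (intro AE_I2) auto
  qed
  show "exp_conv k T h t \<le> c * norm_1v2 T h" if t: "t \<in> {0..T}" for t
  proof (cases rule: norm_1v2_cases[of T h])
    case 1
    have "1 * n \<le> c * n" using c n by (intro mult_right_mono) auto
    then show ?thesis using b1[of t] 1 by (simp add: n_def)
  next
    case 2
    then have h2: "set_integrable lborel {0..T} (\<lambda>s. (h s)\<^sup>2)" by simp
    have "(exp_conv k T h t)\<^sup>2 \<le> (LINT s:{0..T}|lborel. exp (- (2 * k) * \<bar>t - s\<bar>)) * (LINT s:{0..T}|lborel. (h s)\<^sup>2)"
      using sq2[OF h2, of t "2 * k"] by simp
    also have "\<dots> \<le> (2 / (2 * k)) * (LINT s:{0..T}|lborel. (h s)\<^sup>2)"
      using exp_kernel_integral_le[of "2 * k" t T] k t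
      by (intro mult_right_mono) (auto simp: abs_minus_commute set_lebesgue_integral_def intro!: Bochner_Integration.integral_nonneg)
    also have "\<dots> = (1 / sqrt k * n)\<^sup>2"
      using L2norm_sq[of T h] 2(2) k by (simp add: n_def power_mult_distrib power_divide)
    finally have "exp_conv k T h t \<le> 1 / sqrt k * n"
      by (rule power2_le_imp_le) (use k n in simp)
    also have "\<dots> \<le> c * n" using c n by (intro mult_right_mono) auto
    finally show ?thesis by (simp add: n_def)
  qed
  show "(LINT t:{0..T}|lborel. (exp_conv k T h t)\<^sup>2) \<le> (c * norm_1v2 T h)\<^sup>2"
  proof (cases rule: norm_1v2_cases[of T h])
    case 1
    have "(LINT t:{0..T}|lborel. (exp_conv k T h t)\<^sup>2) \<le>
      (LINT t:{0..T}|lborel. L1norm T h * (LINT s:{0..T}|lborel. exp (- (2 * k) * \<bar>t - s\<bar>) * h s))"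
      using sq1 k exp_kernel_double_integral(1)[of "2 * k" T h] h
      by (intro set_integral_mono int2 set_integrable_mult_right) auto
    also have "\<dots> = n * (LINT t:{0..T}|lborel. LINT s:{0..T}|lborel. exp (- (2 * k) * \<bar>t - s\<bar>) * h s)"
      using 1 by (simp add: n_def)
    also have "\<dots> \<le> n * (2 / (2 * k) * n)"
    proof (rule mult_left_mono[OF _ n])
      have "n = (LINT s:{0..T}|lborel. h s)" using 1 by (simp add: n_def L1eq)
      then show "(LINT t:{0..T}|lborel. LINT s:{0..T}|lborel. exp (- (2 * k) * \<bar>t - s\<bar>) * h s) \<le> 2 / (2 * k) * n"
        using exp_kernel_double_integral(2)[of "2 * k" T h] k h by simp
    qed
    also have "\<dots> = (1 / sqrt k * n)\<^sup>2"
      using k by (simp add: power_mult_distrib power_divide power2_eq_square)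
    also have "\<dots> \<le> (c * n)\<^sup>2"
      using c n k by (intro power_mono mult_right_mono) auto
    finally show ?thesis by (simp add: n_def)
  next
    case 2
    then have h2: "set_integrable lborel {0..T} (\<lambda>s. (h s)\<^sup>2)" by simp
    have "(LINT t:{0..T}|lborel. (exp_conv k T h t)\<^sup>2) \<le>
      (LINT t:{0..T}|lborel. (2 / k) * (LINT s:{0..T}|lborel. exp (- k * \<bar>t - s\<bar>) * (h s)\<^sup>2))"
    proof (rule set_integral_mono[OF int2])
      show "set_integrable lborel {0..T} (\<lambda>t. (2 / k) * (LINT s:{0..T}|lborel. exp (- k * \<bar>t - s\<bar>) * (h s)\<^sup>2))"
        using exp_kernel_double_integral(1)[OF k h2] by (intro set_integrable_mult_right) auto
      fix t assume t: "t \<in> {0..T}"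
      have "(exp_conv k T h t)\<^sup>2 \<le> (LINT s:{0..T}|lborel. exp (- k * \<bar>t - s\<bar>)) *
          (LINT s:{0..T}|lborel. exp (- k * \<bar>t - s\<bar>) * (h s)\<^sup>2)"
        using sq2[OF h2, of t k] by simp
      also have "\<dots> \<le> (2 / k) * (LINT s:{0..T}|lborel. exp (- k * \<bar>t - s\<bar>) * (h s)\<^sup>2)"
        using exp_kernel_integral_le[OF k t]
        by (intro mult_right_mono) (auto simp: abs_minus_commute set_lebesgue_integral_def intro!: Bochner_Integration.integral_nonneg)
      finally show "(exp_conv k T h t)\<^sup>2 \<le> (2 / k) * (LINT s:{0..T}|lborel. exp (- k * \<bar>t - s\<bar>) * (h s)\<^sup>2)" .
    qed
    also have "\<dots> = (2 / k) * (LINT t:{0..T}|lborel. LINT s:{0..T}|lborel. exp (- k * \<bar>t - s\<bar>) * (h s)\<^sup>2)"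
      by (rule set_integral_mult_right)
    also have "\<dots> \<le> (2 / k) * (2 / k * n\<^sup>2)"
      using exp_kernel_double_integral(2)[OF k h2] k L2norm_sq[of T h] 2(2)
      by (intro mult_left_mono) (simp_all add: n_def)
    also have "\<dots> = (2 / k * n)\<^sup>2" by (simp add: power2_eq_square)
    also have "\<dots> \<le> (c * n)\<^sup>2"
      using c n k by (intro power_mono mult_right_mono) auto
    finally show ?thesis by (simp add: n_def)
  qed
qed

text \<open>The boundary value of size \<open>a\<close> sits at \<open>t0\<close>, which is 0 for
  the state and \<open>T\<close> for the costate. The factor 2 covers the \<open>sqrt 3\<close> lost
  in the L2 part by squaring a sum of three terms.\<close>

lemma norm_2w_Green_le:
  fixes x :: "real \<Rightarrow> 'x::{banach,second_countable_topology}"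
  assumes T: "T > 0" and k: "k > 0" and M: "M \<ge> 0" and a: "a \<ge> 0" and t0: "t0 \<in> {0..T}"
    and x: "continuous_on {0..T} x"
    and h1: "set_integrable lborel {0..T} h1" "\<And>s. s \<in> {0..T} \<Longrightarrow> 0 \<le> h1 s"
    and h2: "set_integrable lborel {0..T} h2" "\<And>s. s \<in> {0..T} \<Longrightarrow> 0 \<le> h2 s"
    and le: "\<And>t. t \<in> {0..T} \<Longrightarrow>
      norm (x t) \<le> M * (exp (- k * \<bar>t - t0\<bar>) * a + exp_conv k T h1 t + exp_conv k T h2 t)"
  shows "norm_2w T x \<le> 2 * M * (1 + 1 / sqrt k + 2 / k) * (a + norm_1v2 T h1 + norm_1v2 T h2)"
proof -
  define c where "c = 1 + 1 / sqrt k + 2 / k"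
  have c: "c \<ge> 1" "c \<ge> 1 / sqrt k" "c > 0"
    using k by (auto simp: c_def intro!: add_pos_pos add_nonneg_pos)
  define n1 n2 where "n1 = norm_1v2 T h1" and "n2 = norm_1v2 T h2"
  have n: "n1 \<ge> 0" "n2 \<ge> 0" by (simp_all add: n1_def n2_def norm_1v2_nonneg)
  note b1 = exp_conv_bounds[OF k h1, folded c_def n1_def]
  note b2 = exp_conv_bounds[OF k h2, folded c_def n2_def]
  define \<Sigma> where "\<Sigma> = 2 * M * c * (a + n1 + n2)"
  have \<Sigma>0: "0 \<le> \<Sigma>" unfolding \<Sigma>_def using M c a n by simp
  have "norm (x t) \<le> \<Sigma>" if t: "t \<in> {0..T}" for t
  proof -
    have "exp (- k * \<bar>t - t0\<bar>) * a \<le> 1 * a" using k a by (intro mult_right_mono) auto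
    also have "\<dots> \<le> c * a" using c a by (intro mult_right_mono) auto
    finally have "exp (- k * \<bar>t - t0\<bar>) * a + exp_conv k T h1 t + exp_conv k T h2 t \<le> c * (a + n1 + n2)"
      using b1(2)[OF _ t] b2(2)[OF _ t] by (simp add: algebra_simps)
    then have "M * (exp (- k * \<bar>t - t0\<bar>) * a + exp_conv k T h1 t + exp_conv k T h2 t) \<le> M * (c * (a + n1 + n2))"
      using M by (rule mult_left_mono)
    moreover have "0 \<le> M * (c * (a + n1 + n2))" using M c a n by simp
    ultimately show ?thesis using le[OF t] unfolding \<Sigma>_def by linarith
  qed
  then have "supnorm T x \<le> \<Sigma>"
    unfolding supnorm_def using T by (intro cSUP_least) auto
  moreover have "L2norm T x \<le> \<Sigma>"
  proof (rule power2_le_imp_le[OF _ \<Sigma>0])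
    let ?e = "\<lambda>t. exp (- (2 * k) * \<bar>t - t0\<bar>)"
    have ce: "set_integrable lborel {0..T} ?e"
      by (intro borel_integrable_atLeastAtMost' continuous_intros)
    have tri: "(norm (x t))\<^sup>2 \<le> 3 * M\<^sup>2 * (a\<^sup>2 * ?e t + (exp_conv k T h1 t)\<^sup>2 + (exp_conv k T h2 t)\<^sup>2)" if t: "t \<in> {0..T}" for t
    proof -
      define A B C where "A = exp (- k * \<bar>t - t0\<bar>) * a" and "B = exp_conv k T h1 t" and "C = exp_conv k T h2 t"
      have "(norm (x t))\<^sup>2 \<le> (M * (A + B + C))\<^sup>2"
        using le[OF t] by (intro power_mono) (auto simp: A_def B_def C_def)
      also have "\<dots> = M\<^sup>2 * (A + B + C)\<^sup>2" by (simp add: power_mult_distrib)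
      also have "\<dots> \<le> M\<^sup>2 * (3 * (A\<^sup>2 + B\<^sup>2 + C\<^sup>2))"
      proof (intro mult_left_mono)
        have "0 \<le> (A - B)\<^sup>2 + (B - C)\<^sup>2 + (A - C)\<^sup>2" by simp
        then show "(A + B + C)\<^sup>2 \<le> 3 * (A\<^sup>2 + B\<^sup>2 + C\<^sup>2)" by (simp add: power2_eq_square algebra_simps)
      qed simp
      also have "A\<^sup>2 = a\<^sup>2 * ?e t" by (simp add: A_def power_mult_distrib exp_double[symmetric] mult.assoc)
      also have "M\<^sup>2 * (3 * (a\<^sup>2 * ?e t + B\<^sup>2 + C\<^sup>2)) = 3 * M\<^sup>2 * (a\<^sup>2 * ?e t + B\<^sup>2 + C\<^sup>2)"
        by (simp only: mult.assoc mult.left_commute)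
      finally show ?thesis unfolding B_def C_def .
    qed
    have i: "set_integrable lborel {0..T} (\<lambda>t. a\<^sup>2 * ?e t + (exp_conv k T h1 t)\<^sup>2)"
      by (intro set_integral_add(1) set_integrable_mult_right ce b1(3))
    have "(L2norm T x)\<^sup>2 \<le> (LINT t:{0..T}|lborel. 3 * M\<^sup>2 * (a\<^sup>2 * ?e t + (exp_conv k T h1 t)\<^sup>2 + (exp_conv k T h2 t)\<^sup>2))"
      unfolding L2norm_sq
      by (intro set_integral_mono tri borel_integrable_atLeastAtMost' continuous_intros x
          set_integrable_mult_right set_integral_add(1) i b2(3))
    also have "\<dots> = 3 * M\<^sup>2 * (a\<^sup>2 * (LINT t:{0..T}|lborel. ?e t) +
        (LINT t:{0..T}|lborel. (exp_conv k T h1 t)\<^sup>2) + (LINT t:{0..T}|lborel. (exp_conv k T h2 t)\<^sup>2))"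
      using set_integral_add(2)[OF i b2(3)] set_integral_add(2)[OF set_integrable_mult_right[OF ce, of "a\<^sup>2"] b1(3)]
      by (subst set_integral_mult_right) simp
    also have "\<dots> \<le> 3 * M\<^sup>2 * ((c * a)\<^sup>2 + (c * n1)\<^sup>2 + (c * n2)\<^sup>2)"
    proof (intro mult_left_mono add_mono b1(4) b2(4))
      have "a\<^sup>2 * (LINT t:{0..T}|lborel. ?e t) \<le> a\<^sup>2 * (2 / (2 * k))"
        using exp_kernel_integral_le[of "2 * k" t0 T] k t0 by (intro mult_left_mono) auto
      also have "\<dots> = (1 / sqrt k * a)\<^sup>2" using k by (simp add: power_mult_distrib power_divide)
      also have "\<dots> \<le> (c * a)\<^sup>2" using c a k by (intro power_mono mult_right_mono) auto
      finally show "a\<^sup>2 * (LINT t:{0..T}|lborel. ?e t) \<le> (c * a)\<^sup>2" .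
      show "0 \<le> 3 * M\<^sup>2" by simp
    qed
    also have "\<dots> = 3 * M\<^sup>2 * c\<^sup>2 * (a\<^sup>2 + n1\<^sup>2 + n2\<^sup>2)" by (simp add: power_mult_distrib algebra_simps)
    \<comment> \<open>Rounding 3 up to 4 makes the bound the exact square of
      \<open>\<Sigma>\<close>.\<close>
    also have "\<dots> \<le> 4 * M\<^sup>2 * c\<^sup>2 * (a + n1 + n2)\<^sup>2"
    proof (intro mult_mono)
      have "0 \<le> a * n1" "0 \<le> a * n2" "0 \<le> n1 * n2" using a n by auto
      then show "a\<^sup>2 + n1\<^sup>2 + n2\<^sup>2 \<le> (a + n1 + n2)\<^sup>2" by (simp add: power2_eq_square algebra_simps)
    qed auto
    also have "\<dots> = \<Sigma>\<^sup>2" by (simp add: \<Sigma>_def power_mult_distrib)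
    finally show "(L2norm T x)\<^sup>2 \<le> \<Sigma>\<^sup>2" .
  qed
  ultimately show ?thesis unfolding norm_2w_def \<Sigma>_def c_def n1_def n2_def by simp
qed

text \<open>\<open>J\<close> is \<open>[0, t]\<close> or \<open>[t, T]\<close>; once
  \<open>h\<close> is replaced by \<open>h1 + h2\<close> the integrand is nonnegative and the
  integral may be enlarged to \<open>[0, T]\<close>.\<close>

lemma set_integral_exp_le_exp_conv:
  fixes h1 h2 :: "real \<Rightarrow> real"
  assumes h1: "set_integrable lborel {0..T} h1" "\<And>s. s \<in> {0..T} \<Longrightarrow> 0 \<le> h1 s"
    and h2: "set_integrable lborel {0..T} h2" "\<And>s. s \<in> {0..T} \<Longrightarrow> 0 \<le> h2 s"
    and J: "J \<subseteq> {0..T}" "J \<in> sets borel" and M: "M \<ge> 0"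
    and le: "\<And>s. s \<in> J \<Longrightarrow> h s \<le> h1 s + h2 s" and e: "\<And>s. s \<in> J \<Longrightarrow> e s = exp (- k * \<bar>t - s\<bar>)"
    and int: "set_integrable lborel J (\<lambda>s. M * e s * h s)"
  shows "(LINT s:J|lborel. M * e s * h s) \<le> M * (exp_conv k T h1 t + exp_conv k T h2 t)"
proof -
  have i: "set_integrable lborel {0..T} (\<lambda>s. exp (- k * \<bar>t - s\<bar>) * h1 s)"
    "set_integrable lborel {0..T} (\<lambda>s. exp (- k * \<bar>t - s\<bar>) * h2 s)"
    by (intro set_integrable_mult_continuous continuous_intros h1 h2)+
  have "(LINT s:J|lborel. M * e s * h s) \<le>
    (LINT s:{0..T}|lborel. M * (exp (- k * \<bar>t - s\<bar>) * h1 s + exp (- k * \<bar>t - s\<bar>) * h2 s))"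
    unfolding set_lebesgue_integral_def
  proof (rule integral_mono)
    show "integrable lborel (\<lambda>s. indicator J s *\<^sub>R (M * e s * h s))"
      using int by (simp add: set_integrable_def)
    have "set_integrable lborel {0..T} (\<lambda>s. M * (exp (- k * \<bar>t - s\<bar>) * h1 s + exp (- k * \<bar>t - s\<bar>) * h2 s))"
      by (intro set_integrable_mult_right set_integral_add(1) i)
    then show "integrable lborel (\<lambda>s. indicator {0..T} s *\<^sub>R (M * (exp (- k * \<bar>t - s\<bar>) * h1 s + exp (- k * \<bar>t - s\<bar>) * h2 s)))"
      by (simp add: set_integrable_def)
    fix s
    have "M * e s * h s \<le> M * (exp (- k * \<bar>t - s\<bar>) * h1 s + exp (- k * \<bar>t - s\<bar>) * h2 s)" if s: "s \<in> J"
    proof -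
      have "M * exp (- k * \<bar>t - s\<bar>) * h s \<le> M * exp (- k * \<bar>t - s\<bar>) * (h1 s + h2 s)"
        using M by (intro mult_left_mono le[OF s]) auto
      then show ?thesis by (simp add: e[OF s] algebra_simps)
    qed
    moreover have "0 \<le> M * (exp (- k * \<bar>t - s\<bar>) * h1 s + exp (- k * \<bar>t - s\<bar>) * h2 s)" if s: "s \<in> {0..T}"
      using M h1(2)[OF s] h2(2)[OF s] by simp
    ultimately show "indicator J s *\<^sub>R (M * e s * h s) \<le>
        indicator {0..T} s *\<^sub>R (M * (exp (- k * \<bar>t - s\<bar>) * h1 s + exp (- k * \<bar>t - s\<bar>) * h2 s))"
      using J(1) by (cases "s \<in> J"; cases "s \<in> {0..T}") auto
  qed
  also have "\<dots> = M * (exp_conv k T h1 t + exp_conv k T h2 t)"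
    unfolding exp_conv_def by (simp only: set_integral_mult_right set_integral_add(2)[OF i])
  finally show ?thesis .
qed

section \<open>Duality of the data and solution norms, and the absorption argument\<close>

lemma norm_le_supnorm:
  assumes "continuous_on {0..T} x" "t \<in> {0..T}"
  shows "norm (x t) \<le> supnorm T x"
  unfolding supnorm_def
proof (rule cSUP_upper[OF assms(2)])
  have "compact ((\<lambda>t. norm (x t)) ` {0..T})"
    by (intro compact_continuous_image continuous_intros assms(1)) auto
  then show "bdd_above ((\<lambda>t. norm (x t)) ` {0..T})"
    by (intro bounded_imp_bdd_above compact_imp_bounded)
qed

text \<open>If the minimum for \<open>r\<close> is the L1 norm, it is paired with the sup norm of
  \<open>x\<close>, otherwise with the L2 norm; the maximum in \<open>norm_2w\<close> dominates both
  partners.\<close>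

lemma pairing_le_dual_norms:
  fixes r x :: "real \<Rightarrow> 'x::{real_inner,banach,second_countable_topology}"
  assumes r: "set_integrable lborel {0..T} r" and x: "continuous_on {0..T} x"
  shows "\<bar>LINT s:{0..T}|lborel. inner (r s) (x s)\<bar> \<le> norm_1v2 T r * norm_2w T x"
proof -
  have nr: "set_integrable lborel {0..T} (\<lambda>s. norm (r s))" using r by (rule set_integrable_norm)
  have nx: "continuous_on {0..T} (\<lambda>s. norm (x s))" by (intro continuous_intros x)
  have rx: "set_integrable lborel {0..T} (\<lambda>s. norm (r s) * norm (x s))"
    using set_integrable_mult_continuous[OF nx nr] by (simp add: mult.commute)
  have ix: "set_integrable lborel {0..T} (\<lambda>s. inner (r s) (x s))"
    using set_integrable_inner_continuous[OF x r] by (simp add: inner_commute)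
  have 0: "\<bar>LINT s:{0..T}|lborel. inner (r s) (x s)\<bar> \<le> (LINT s:{0..T}|lborel. norm (r s) * norm (x s))"
    by (rule abs_set_integral_le[OF ix rx]) (rule Cauchy_Schwarz_ineq2)
  show ?thesis
  proof (cases rule: norm_1v2_cases[of T r])
    case 1
    have L1: "0 \<le> L1norm T r" using norm_1v2_nonneg[of T r] 1 by simp
    have "(LINT s:{0..T}|lborel. norm (r s) * norm (x s)) \<le> (LINT s:{0..T}|lborel. norm (r s) * supnorm T x)"
      by (intro set_integral_mono rx set_integrable_mult_left nr mult_left_mono norm_le_supnorm x) auto
    also have "\<dots> = L1norm T r * supnorm T x" by (simp add: L1norm_def)
    also have "\<dots> \<le> norm_1v2 T r * norm_2w T x"
      unfolding 1 norm_2w_def using L1 by (intro mult_left_mono) auto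
    finally show ?thesis using 0 by simp
  next
    case 2
    have "set_integrable lborel {0..T} (\<lambda>s. (norm (x s))\<^sup>2)"
      by (intro borel_integrable_atLeastAtMost' continuous_intros x)
    from set_integral_Cauchy_Schwarz[OF 2(1) this rx]
    have "(LINT s:{0..T}|lborel. norm (r s) * norm (x s))\<^sup>2 \<le> (L2norm T r * L2norm T x)\<^sup>2"
      by (simp add: power_mult_distrib L2norm_sq)
    then have "(LINT s:{0..T}|lborel. norm (r s) * norm (x s)) \<le> L2norm T r * L2norm T x"
      by (rule power2_le_imp_le) (simp add: L2norm_nonneg)
    also have "\<dots> \<le> norm_1v2 T r * norm_2w T x"
      unfolding 2(2) norm_2w_def by (intro mult_left_mono L2norm_nonneg) auto
    finally show ?thesis using 0 by simp
  qed
qed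

lemma norm_1v2_le_L2norm:
  assumes "continuous_on {0..T} (\<lambda>t. norm (f t))"
  shows "norm_1v2 T f \<le> L2norm T f"
proof -
  have "set_integrable lborel {0..T} (\<lambda>t. (norm (f t))\<^sup>2)"
    by (intro borel_integrable_atLeastAtMost' continuous_on_power assms)
  then show ?thesis by (simp add: norm_1v2_def)
qed

text \<open>Turns the energy \<open>e\<close> into a bound on the feedback forcing in the equations
  for the stable semigroups, with \<open>u\<close> and \<open>v\<close> the norms of the control
  \<open>w\<close> and of \<open>C x\<close>. The factor 2 comes from
  \<open>(u + v)^2 \<le> 4 (u^2 + v^2)\<close>.\<close>

lemma norm_1v2_combination_le:
  fixes u v :: "real \<Rightarrow> real"
  assumes u: "continuous_on {0..T} u" and v: "continuous_on {0..T} v"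
    and h: "continuous_on {0..T} h" "\<And>t. t \<in> {0..T} \<Longrightarrow> 0 \<le> h t"
    and le: "\<And>t. t \<in> {0..T} \<Longrightarrow> h t \<le> c * (u t + v t)" and c: "c \<ge> 0"
    and e: "(LINT t:{0..T}|lborel. (u t)\<^sup>2 + (v t)\<^sup>2) \<le> e\<^sup>2" "e \<ge> 0"
  shows "norm_1v2 T h \<le> 2 * c * e"
proof -
  have "norm_1v2 T h \<le> L2norm T h" by (rule norm_1v2_le_L2norm) (intro continuous_intros h)
  also have "L2norm T h \<le> 2 * c * e"
  proof (rule power2_le_imp_le)
    have "(L2norm T h)\<^sup>2 \<le> (LINT t:{0..T}|lborel. 4 * c\<^sup>2 * ((u t)\<^sup>2 + (v t)\<^sup>2))"
      unfolding L2norm_sq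
    proof (intro set_integral_mono borel_integrable_atLeastAtMost' continuous_intros h u v)
      fix t assume t: "t \<in> {0..T}"
      have "(norm (h t))\<^sup>2 \<le> (c * (u t + v t))\<^sup>2" using le[OF t] h(2)[OF t] by (intro power_mono) auto
      also have "\<dots> = c\<^sup>2 * (u t + v t)\<^sup>2" by (simp add: power_mult_distrib)
      also have "\<dots> \<le> c\<^sup>2 * (4 * ((u t)\<^sup>2 + (v t)\<^sup>2))"
      proof (intro mult_left_mono)
        have "0 \<le> (u t - v t)\<^sup>2 + 2 * ((u t)\<^sup>2 + (v t)\<^sup>2)" by simp
        then show "(u t + v t)\<^sup>2 \<le> 4 * ((u t)\<^sup>2 + (v t)\<^sup>2)" by (simp add: power2_eq_square algebra_simps)
      qed simp
      finally show "(norm (h t))\<^sup>2 \<le> 4 * c\<^sup>2 * ((u t)\<^sup>2 + (v t)\<^sup>2)" by (simp only: mult.assoc mult.left_commute)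
    qed
    also have "\<dots> = 4 * c\<^sup>2 * (LINT t:{0..T}|lborel. (u t)\<^sup>2 + (v t)\<^sup>2)" by (rule set_integral_mult_right)
    also have "\<dots> \<le> 4 * c\<^sup>2 * e\<^sup>2" by (intro mult_left_mono e(1)) auto
    also have "\<dots> = (2 * c * e)\<^sup>2" by (simp add: power_mult_distrib)
    finally show "(L2norm T h)\<^sup>2 \<le> (2 * c * e)\<^sup>2" .
  qed (use c e in simp)
  finally show ?thesis .
qed

text \<open>\<open>n\<close> is controlled linearly by \<open>e\<close>, but \<open>e^2\<close> only
  linearly by \<open>n\<close>. By the arithmetic-geometric mean inequality \<open>c e\<close> is at
  most half of \<open>n\<close> plus a multiple of \<open>\<rho>\<close>, and the half is absorbed
  on the left.\<close>

lemma quadratic_absorption: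
  fixes n \<rho> e c \<mu> :: real
  assumes \<mu>: "\<mu> > 0" and n: "n \<ge> 0" and \<rho>: "\<rho> \<ge> 0" and c: "c \<ge> 0" and e0: "e \<ge> 0"
    and le: "n \<le> c * (\<rho> + e)" and e: "\<mu> * e\<^sup>2 \<le> n * \<rho>"
  shows "n \<le> (2 * c + c\<^sup>2 / \<mu>) * \<rho>"
proof -
  have "(c * e)\<^sup>2 \<le> n * (c\<^sup>2 * \<rho> / \<mu>)"
  proof -
    have "e\<^sup>2 \<le> n * \<rho> / \<mu>" using e \<mu> by (simp add: field_simps)
    then have "c\<^sup>2 * e\<^sup>2 \<le> c\<^sup>2 * (n * \<rho> / \<mu>)" by (intro mult_left_mono) auto
    then show ?thesis by (simp add: power_mult_distrib ac_simps)
  qed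
  also have "\<dots> \<le> ((n + c\<^sup>2 * \<rho> / \<mu>) / 2)\<^sup>2"
  proof -
    have "n * d \<le> ((n + d) / 2)\<^sup>2" for d :: real
      using zero_le_power2[of "n - d"] by (simp add: power2_eq_square field_simps)
    then show ?thesis .
  qed
  finally have "c * e \<le> (n + c\<^sup>2 * \<rho> / \<mu>) / 2"
    by (rule power2_le_imp_le) (use n \<rho> \<mu> in simp)
  then have "n \<le> 2 * (c * \<rho>) + c\<^sup>2 * \<rho> / \<mu>" using le by (simp add: distrib_left)
  then show ?thesis by (simp add: algebra_simps)
qed

section \<open>The optimality system\<close>

text \<open>In \<open>mild_duality\<close> the pairing of \<open>B w\<close> with \<open>lam\<close>
  equals the square of \<open>norm (R w)\<close>, the pairing of \<open>x\<close> with the feedback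
  through \<open>C\<close> equals the square of \<open>norm (C x)\<close>, and both carry the same
  sign. Every other term contains a datum, as an endpoint pairing or as an integral bounded by
  \<open>pairing_le_dual_norms\<close>.\<close>

lemma energy_bound:
  fixes X :: "'x::{real_inner,banach,second_countable_topology} set"
    and B :: "'u::{real_inner,banach} \<Rightarrow> 'x" and C :: "'x \<Rightarrow> 'y::{real_inner,banach}" and R :: "'u \<Rightarrow> 'u"
  assumes X: "closed_subspace X" and U: "closed_subspace U" and Y: "closed_subspace Y"
    and S: "c0_semigroup X S" and B: "bop U X B" and C: "bop X Y C" and R: "bop U U R"
    and coer: "\<And>u. u \<in> U \<Longrightarrow> (norm (R u))\<^sup>2 \<ge> \<alpha> * (norm u)\<^sup>2" and T: "T > 0"
    and r: "set_integrable lborel {0..T} r1" "set_integrable lborel {0..T} r3"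
      "\<And>t. t \<in> {0..T} \<Longrightarrow> r1 t \<in> X" "\<And>t. t \<in> {0..T} \<Longrightarrow> r3 t \<in> X" "r2 \<in> X" "r4 \<in> X"
    and x: "continuous_on {0..T} x" "\<And>t. t \<in> {0..T} \<Longrightarrow> x t \<in> X"
    and lam: "continuous_on {0..T} lam" "\<And>t. t \<in> {0..T} \<Longrightarrow> lam t \<in> X"
    and w: "continuous_on {0..T} w" "\<And>t. t \<in> {0..T} \<Longrightarrow> w t \<in> U"
      "\<And>t. t \<in> {0..T} \<Longrightarrow> badj U U R (R (w t)) = badj U X B (lam t)"
    and wx: "\<And>t q. t \<in> {0..T} \<Longrightarrow> q \<in> X \<Longrightarrow> inner (x t) q =
      inner (S t r4) q + (LINT s:{0..t}|lborel. inner (S (t - s) (B (w s) + r3 s)) q)"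
    and wl: "\<And>t p. t \<in> {0..T} \<Longrightarrow> p \<in> X \<Longrightarrow> inner p (lam t) = inner (S (T - t) p) r2 +
      (LINT s:{t..T}|lborel. inner (S (s - t) p) (r1 s - badj X Y C (C (x s))))"
  shows "min \<alpha> 1 * (LINT t:{0..T}|lborel. (norm (w t))\<^sup>2 + (norm (C (x t)))\<^sup>2) \<le>
    (norm_2w T x + norm_2w T lam) * (norm r2 + norm r4 + norm_1v2 T r1 + norm_1v2 T r3)"
proof -
  note XI = closed_subspace_intros[OF X]
  have CC: "bop X X (\<lambda>x. badj X Y C (C x))" by (rule bop_comp[OF C badj_bop[OF X Y C]])
  have cBw: "continuous_on {0..T} (\<lambda>s. B (w s))" by (rule continuous_on_bop[OF U B w(1,2)])
  have cCx: "continuous_on {0..T} (\<lambda>s. C (x s))" by (rule continuous_on_bop[OF X C x])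
  have cRw: "continuous_on {0..T} (\<lambda>s. R (w s))" by (rule continuous_on_bop[OF U R w(1,2)])
  have cCCx: "continuous_on {0..T} (\<lambda>s. badj X Y C (C (x s)))" by (rule continuous_on_bop[OF X CC x])
  have f: "set_integrable lborel {0..T} (\<lambda>s. B (w s) + r3 s)"
    by (intro set_integral_add(1) borel_integrable_atLeastAtMost' cBw r)
  have g: "set_integrable lborel {0..T} (\<lambda>s. r1 s - badj X Y C (C (x s)))"
    by (intro set_integral_diff(1) borel_integrable_atLeastAtMost' cCCx r)
  have dual: "inner (x T) r2 - inner r4 (lam 0) = (LINT s:{0..T}|lborel. inner (B (w s) + r3 s) (lam s)) -
      (LINT s:{0..T}|lborel. inner (x s) (r1 s - badj X Y C (C (x s))))"
    by (rule mild_duality[OF X S _ f _ g _ r(6,5)])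
      (use T wx wl r w x bop_mem[OF B] bop_mem[OF CC] in \<open>auto intro!: XI\<close>)
  have Rw: "inner (B (w s)) (lam s) = (norm (R (w s)))\<^sup>2" if s: "s \<in> {0..T}" for s
    using badj_props(2)[OF U B w(2)[OF s], of "lam s"] badj_props(2)[OF U R w(2)[OF s], of "R (w s)"]
      w(3)[OF s] by (simp add: power2_norm_eq_inner)
  have Cx: "inner (x s) (badj X Y C (C (x s))) = (norm (C (x s)))\<^sup>2" if s: "s \<in> {0..T}" for s
    using badj_props(2)[OF X C x(2)[OF s], of "C (x s)"] by (simp add: power2_norm_eq_inner)
  have iR: "set_integrable lborel {0..T} (\<lambda>s. (norm (R (w s)))\<^sup>2)"
    and iC: "set_integrable lborel {0..T} (\<lambda>s. (norm (C (x s)))\<^sup>2)"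
    and iW: "set_integrable lborel {0..T} (\<lambda>s. (norm (w s))\<^sup>2 + (norm (C (x s)))\<^sup>2)"
    by (intro borel_integrable_atLeastAtMost' continuous_intros cRw cCx w)+
  have i3: "set_integrable lborel {0..T} (\<lambda>s. inner (r3 s) (lam s))"
    using set_integrable_inner_continuous[OF lam(1) r(2)] by (simp add: inner_commute)
  have i1: "set_integrable lborel {0..T} (\<lambda>s. inner (x s) (r1 s))"
    by (rule set_integrable_inner_continuous[OF x(1) r(1)])
  have "(LINT s:{0..T}|lborel. inner (B (w s) + r3 s) (lam s)) =
      (LINT s:{0..T}|lborel. (norm (R (w s)))\<^sup>2 + inner (r3 s) (lam s))"
    by (rule set_lebesgue_integral_cong) (auto simp: inner_add_left Rw)
  also have "\<dots> = (LINT s:{0..T}|lborel. (norm (R (w s)))\<^sup>2) + (LINT s:{0..T}|lborel. inner (r3 s) (lam s))"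
    by (rule set_integral_add(2)[OF iR i3])
  finally have e1: "(LINT s:{0..T}|lborel. inner (B (w s) + r3 s) (lam s)) = \<dots>" .
  have "(LINT s:{0..T}|lborel. inner (x s) (r1 s - badj X Y C (C (x s)))) =
      (LINT s:{0..T}|lborel. inner (x s) (r1 s) - (norm (C (x s)))\<^sup>2)"
    by (rule set_lebesgue_integral_cong) (auto simp: inner_diff_right Cx)
  also have "\<dots> = (LINT s:{0..T}|lborel. inner (x s) (r1 s)) - (LINT s:{0..T}|lborel. (norm (C (x s)))\<^sup>2)"
    by (rule set_integral_diff(2)[OF i1 iC])
  finally have e2: "(LINT s:{0..T}|lborel. inner (x s) (r1 s - badj X Y C (C (x s)))) = \<dots>" .
  have "min \<alpha> 1 * (LINT t:{0..T}|lborel. (norm (w t))\<^sup>2 + (norm (C (x t)))\<^sup>2) =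
      (LINT t:{0..T}|lborel. min \<alpha> 1 * ((norm (w t))\<^sup>2 + (norm (C (x t)))\<^sup>2))" by simp
  also have "\<dots> \<le> (LINT t:{0..T}|lborel. (norm (R (w t)))\<^sup>2 + (norm (C (x t)))\<^sup>2)"
  proof (intro set_integral_mono set_integrable_mult_right iW set_integral_add(1) iR iC)
    fix t assume t: "t \<in> {0..T}"
    \<comment> \<open>The control term has coercivity weight \<open>\<alpha>\<close>, the
      observation term weight 1; the minimum serves both.\<close>
    have "min \<alpha> 1 * (norm (w t))\<^sup>2 \<le> \<alpha> * (norm (w t))\<^sup>2"
      "min \<alpha> 1 * (norm (C (x t)))\<^sup>2 \<le> 1 * (norm (C (x t)))\<^sup>2"
      by (intro mult_right_mono; simp)+
    then show "min \<alpha> 1 * ((norm (w t))\<^sup>2 + (norm (C (x t)))\<^sup>2) \<le> (norm (R (w t)))\<^sup>2 + (norm (C (x t)))\<^sup>2"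
      using coer[OF w(2)[OF t]] by (simp add: distrib_left)
  qed
  also have "\<dots> = (LINT t:{0..T}|lborel. (norm (R (w t)))\<^sup>2) + (LINT t:{0..T}|lborel. (norm (C (x t)))\<^sup>2)"
    by (rule set_integral_add(2)[OF iR iC])
  also have "\<dots> = inner (x T) r2 - inner r4 (lam 0) - (LINT s:{0..T}|lborel. inner (r3 s) (lam s)) +
      (LINT s:{0..T}|lborel. inner (r1 s) (x s))"
    using dual e1 e2 by (simp add: inner_commute[of "r1 _"])
  also have "\<dots> \<le> norm_2w T x * norm r2 + norm_2w T lam * norm r4 + norm_1v2 T r3 * norm_2w T lam + norm_1v2 T r1 * norm_2w T x"
  proof -
    have "norm (x T) \<le> norm_2w T x" "norm (lam 0) \<le> norm_2w T lam"
      using norm_le_supnorm[OF x(1), of T] norm_le_supnorm[OF lam(1), of 0] T by (auto simp: norm_2w_def)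
    then have "norm (x T) * norm r2 \<le> norm_2w T x * norm r2" "norm (lam 0) * norm r4 \<le> norm_2w T lam * norm r4"
      by (simp_all add: mult_right_mono)
    then show ?thesis
      using norm_cauchy_schwarz[of "x T" r2] Cauchy_Schwarz_ineq2[of r4 "lam 0"]
        pairing_le_dual_norms[OF r(2) lam(1)] pairing_le_dual_norms[OF r(1) x(1)]
      by (simp add: mult.commute[of "norm r4"])
  qed
  also have "\<dots> \<le> (norm_2w T x + norm_2w T lam) * (norm r2 + norm r4 + norm_1v2 T r1 + norm_1v2 T r3)"
  proof -
    have "0 \<le> norm_2w T x" "0 \<le> norm_2w T lam" using L2norm_nonneg by (auto simp: norm_2w_def le_max_iff_disj)
    then have "0 \<le> norm_2w T x * norm r4" "0 \<le> norm_2w T x * norm_1v2 T r3"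
      "0 \<le> norm_2w T lam * norm r2" "0 \<le> norm_2w T lam * norm_1v2 T r1"
      by (simp_all add: norm_1v2_nonneg)
    then show ?thesis by (simp add: algebra_simps)
  qed
  finally show ?thesis .
qed

text \<open>In \<open>c\<close>, the two summands of the first factor are the Green constants of the
  state and costate equations, and \<open>C_B + CL\<close> and \<open>C_C + CK * C_R^2\<close>
  measure their forcings relative to the energy. The term \<open>c^2 / min \<alpha> 1\<close> is the
  price of absorbing the energy.\<close>

lemma optimality_system_bound:
  fixes X :: "'x::{real_inner,banach,second_countable_topology} set"
    and B :: "'u::{real_inner,banach} \<Rightarrow> 'x" and C :: "'x \<Rightarrow> 'y::{real_inner,banach}" and R :: "'u \<Rightarrow> 'u"
  assumes X: "closed_subspace X" and U: "closed_subspace U" and Y: "closed_subspace Y"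
    and S: "generates X D A S" and B: "bop U X B" and C: "bop X Y C" and R: "bop U U R"
    and W: "generates X D (\<lambda>x. A x + B (K x)) W" and K: "bop X U K" "\<And>x. x \<in> X \<Longrightarrow> norm (K x) \<le> CK * norm x"
    and stableW: "\<And>t z. t \<ge> 0 \<Longrightarrow> z \<in> X \<Longrightarrow> norm (W t z) \<le> M2 * exp (- k2 * t) * norm z"
    and V: "generates X (uadj_dom X D A) (\<lambda>x. uadj X D A x + badj X Y C (L x)) V"
    and L: "bop X Y L" "\<And>x. x \<in> X \<Longrightarrow> norm (L x) \<le> CL * norm x"
    and stableV: "\<And>t z. t \<ge> 0 \<Longrightarrow> z \<in> X \<Longrightarrow> norm (V t z) \<le> M1 * exp (- k1 * t) * norm z"
    and nonneg: "M1 \<ge> 0" "M2 \<ge> 0" "k1 > 0" "k2 > 0" "CK \<ge> 0" "CL \<ge> 0" "C_B \<ge> 0" "C_C \<ge> 0" "C_R \<ge> 0" "\<alpha> > 0"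
    and normB: "\<And>u. u \<in> U \<Longrightarrow> norm (B u) \<le> C_B * norm u"
    and normC: "\<And>x. x \<in> X \<Longrightarrow> norm (C x) \<le> C_C * norm x"
    and normR: "\<And>u. u \<in> U \<Longrightarrow> norm (R u) \<le> C_R * norm u"
    and coer: "\<And>u. u \<in> U \<Longrightarrow> (norm (R u))\<^sup>2 \<ge> \<alpha> * (norm u)\<^sup>2"
    and T: "T > 0" and adm: "rhs_admissible X T r1 r2 r3 r4"
    and sol: "mild_opt_solution X U Y S B C R T r1 r2 r3 r4 x lam"
  defines "c \<equiv> (2 * M1 * (1 + 1 / sqrt k1 + 2 / k1) + 2 * M2 * (1 + 1 / sqrt k2 + 2 / k2)) *
      (1 + 2 * (C_B + CL) + 2 * (C_C + CK * C_R\<^sup>2))"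
  shows "sol_norm T x lam \<le> (2 * c + c\<^sup>2 / min \<alpha> 1) * 4 * rhs_norm T r1 r2 r3 r4"
proof -
  note XI = closed_subspace_intros[OF X]
  note Ss = generatesD(1)[OF S]
  note SD = c0_semigroupD[OF Ss]
  have r: "set_integrable lborel {0..T} r1" "set_integrable lborel {0..T} r3"
    "\<And>t. t \<in> {0..T} \<Longrightarrow> r1 t \<in> X" "\<And>t. t \<in> {0..T} \<Longrightarrow> r3 t \<in> X" "r2 \<in> X" "r4 \<in> X"
    using adm by (auto simp: rhs_admissible_def)
  define Qi where "Qi = sub_inv U (\<lambda>u. badj U U R (R u))"
  define w where "w s = Qi (badj U X B (lam s))" for s
  note Q = sub_inv_gram[OF U R nonneg(10) coer, folded Qi_def]
  have x: "continuous_on {0..T} x" "\<And>t. t \<in> {0..T} \<Longrightarrow> x t \<in> X"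
    and lam: "continuous_on {0..T} lam" "\<And>t. t \<in> {0..T} \<Longrightarrow> lam t \<in> X"
    and xeq: "\<And>t. t \<in> {0..T} \<Longrightarrow> x t = S t r4 + (LINT s:{0..t}|lborel. S (t - s) (B (w s) + r3 s))"
    and leq: "\<And>t. t \<in> {0..T} \<Longrightarrow> lam t = badj X X (S (T - t)) r2 +
        (LINT s:{t..T}|lborel. badj X X (S (s - t)) (r1 s - badj X Y C (C (x s))))"
    using sol by (auto simp: mild_opt_solution_def w_def Qi_def)
  have B': "bop X U (badj U X B)" by (rule badj_bop[OF U X B])
  have CC: "bop X X (\<lambda>x. badj X Y C (C x))" by (rule bop_comp[OF C badj_bop[OF X Y C]])
  have LC: "bop X X (\<lambda>x. badj X Y C (L x))" by (rule bop_comp[OF L(1) badj_bop[OF X Y C]])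
  have wU: "w t \<in> U" and wQ: "badj U U R (R (w t)) = badj U X B (lam t)" if "t \<in> {0..T}" for t
    unfolding w_def using Q bop_mem[OF B' lam(2)[OF that]] bop_mem[OF Q(1)] by auto
  have cw: "continuous_on {0..T} w"
    unfolding w_def by (rule continuous_on_bop[OF X bop_comp[OF B' Q(1)] lam])
  have cBw: "continuous_on {0..T} (\<lambda>s. B (w s))" by (rule continuous_on_bop[OF U B cw wU])
  have cCx: "continuous_on {0..T} (\<lambda>s. C (x s))" by (rule continuous_on_bop[OF X C x])
  have cCCx: "continuous_on {0..T} (\<lambda>s. badj X Y C (C (x s)))" by (rule continuous_on_bop[OF X CC x])
  have cBl: "continuous_on {0..T} (\<lambda>s. badj U X B (lam s))" by (rule continuous_on_bop[OF X B' lam])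
  define f where "f s = B (w s) + r3 s" for s
  define g where "g s = r1 s - badj X Y C (C (x s))" for s
  have f: "set_integrable lborel {0..T} f" "\<And>s. s \<in> {0..T} \<Longrightarrow> f s \<in> X"
    unfolding f_def by (intro set_integral_add(1) borel_integrable_atLeastAtMost' cBw r)
      (auto intro!: XI r bop_mem[OF B] wU)
  have g: "set_integrable lborel {0..T} g" "\<And>s. s \<in> {0..T} \<Longrightarrow> g s \<in> X"
    unfolding g_def by (intro set_integral_diff(1) borel_integrable_atLeastAtMost' cCCx r)
      (auto intro!: XI r bop_mem[OF CC] x)
  have wx: "inner (x t) q = inner (S t r4) q + (LINT s:{0..t}|lborel. inner (S (t - s) (f s)) q)"
    if t: "t \<in> {0..T}" for t q
    using mild_solution_weak_form[OF X Ss f t, of "x t" r4 q] xeq[OF t] by (simp add: f_def)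
  have wl: "inner p (lam t) = inner (S (T - t) p) r2 + (LINT s:{t..T}|lborel. inner (S (s - t) p) (g s))"
    if t: "t \<in> {0..T}" and p: "p \<in> X" for t p
    \<comment> \<open>Strong continuity of the adjoint semigroup is obtained here from the semigroup
      \<open>V\<close> that detectability provides.\<close>
    by (rule mild_adjoint_solution_weak_form[OF X SD(1) adjoint_c0_semigroup[OF X S V LC] g t p])
      (use leq[OF t] in \<open>simp_all add: g_def\<close>)
  define c1 c2 where "c1 = 2 * M1 * (1 + 1 / sqrt k1 + 2 / k1)" and "c2 = 2 * M2 * (1 + 1 / sqrt k2 + 2 / k2)"
  define d1 d2 where "d1 = C_B + CL" and "d2 = C_C + CK * C_R\<^sup>2"
  have cs: "c1 \<ge> 0" "c2 \<ge> 0" "d1 \<ge> 0" "d2 \<ge> 0" using nonneg by (simp_all add: c1_def c2_def d1_def d2_def)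
  define e where "e = sqrt (LINT t:{0..T}|lborel. (norm (w t))\<^sup>2 + (norm (C (x t)))\<^sup>2)"
  have e2: "e\<^sup>2 = (LINT t:{0..T}|lborel. (norm (w t))\<^sup>2 + (norm (C (x t)))\<^sup>2)" and e0: "e \<ge> 0"
    unfolding e_def set_lebesgue_integral_def
    by (auto intro!: real_sqrt_pow2 Bochner_Integration.integral_nonneg)
  define nx nl n1 n3 where "nx = norm_2w T x" and "nl = norm_2w T lam"
    and "n1 = norm_1v2 T r1" and "n3 = norm_1v2 T r3"
  have nn: "nx \<ge> 0" "nl \<ge> 0" "n1 \<ge> 0" "n3 \<ge> 0"
    using L2norm_nonneg by (auto simp: nx_def nl_def n1_def n3_def norm_1v2_nonneg norm_2w_def le_max_iff_disj)
  define \<rho> where "\<rho> = norm r2 + norm r4 + n1 + n3"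
  have nr: "set_integrable lborel {0..T} (\<lambda>s. norm (r1 s))" "set_integrable lborel {0..T} (\<lambda>s. norm (r3 s))"
    using r(1,2) by (auto intro: set_integrable_norm)
  have norm1: "norm_1v2 T (\<lambda>s. norm (r1 s)) = n1" "norm_1v2 T (\<lambda>s. norm (r3 s)) = n3"
    by (simp_all add: n1_def n3_def norm_1v2_def L1norm_def L2norm_def)
  have bx: "nx \<le> c1 * (norm r4 + n3 + 2 * d1 * e)"
  proof -
    \<comment> \<open>The control term \<open>B w\<close> stays a forcing, estimated through
      \<open>w\<close>; the summand with \<open>CL\<close> is the price of passing from
      \<open>S\<close> to \<open>V\<close>. Neither involves \<open>x\<close> beyond
      \<open>C x\<close>.\<close>
    define h where "h s = C_B * norm (w s) + CL * norm (C (x s))" for s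
    have ch: "continuous_on {0..T} h" unfolding h_def by (intro continuous_intros cw cCx)
    have h0: "0 \<le> h s" for s using nonneg by (simp add: h_def)
    have "nx \<le> c1 * (norm r4 + norm_1v2 T (\<lambda>s. norm (r3 s)) + norm_1v2 T h)"
      unfolding nx_def c1_def
    proof (rule norm_2w_Green_le[OF T nonneg(3,1) _ _ x(1) nr(2) _ borel_integrable_atLeastAtMost'[OF ch] h0])
      fix t assume t: "t \<in> {0..T}"
      let ?h = "\<lambda>s. norm (f s) + CL * norm (C (x s))"
      have sub: "set_integrable lborel {0..t} (\<lambda>s. norm (f s))"
        by (rule set_integrable_norm[OF set_integrable_subset[OF f(1)]]) (use t in auto)
      have cC: "continuous_on {0..t} (\<lambda>s. CL * norm (C (x s)))"
        by (rule continuous_on_subset[of "{0..T}"]) (use t in \<open>auto intro!: continuous_intros cCx\<close>)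
      have "(LINT s:{0..t}|lborel. M1 * exp (- k1 * (t - s)) * ?h s) \<le>
          M1 * (exp_conv k1 T (\<lambda>s. norm (r3 s)) t + exp_conv k1 T h t)"
      proof (rule set_integral_exp_le_exp_conv[OF nr(2) _ borel_integrable_atLeastAtMost'[OF ch] h0])
        show "?h s \<le> norm (r3 s) + h s" if "s \<in> {0..t}" for s
          using norm_triangle_ineq[of "B (w s)" "r3 s"] normB[OF wU, of s] that t by (simp add: f_def h_def)
        show "set_integrable lborel {0..t} (\<lambda>s. M1 * exp (- k1 * (t - s)) * ?h s)"
          by (intro set_integrable_mult_continuous continuous_intros set_integral_add(1)[OF sub
                borel_integrable_atLeastAtMost'[OF cC]])
      qed (use t nonneg in auto)
      moreover have "norm (x t) \<le> M1 * exp (- k1 * t) * norm r4 + (LINT s:{0..t}|lborel. M1 * exp (- k1 * (t - s)) * ?h s)"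
        by (rule detectable_state_bound[OF X Y S C L V stableV nonneg(1) f x r(6) wx t nonneg(6)])
      ultimately show "norm (x t) \<le> M1 * (exp (- k1 * \<bar>t - 0\<bar>) * norm r4 +
          exp_conv k1 T (\<lambda>s. norm (r3 s)) t + exp_conv k1 T h t)"
        using t by (simp add: algebra_simps)
    qed (use T in auto)
    also have "norm_1v2 T h \<le> 2 * d1 * e"
    proof (rule norm_1v2_combination_le[OF _ _ ch h0])
      show "h t \<le> d1 * (norm (w t) + norm (C (x t)))" for t
      proof -
        have "0 \<le> CL * norm (w t)" "0 \<le> C_B * norm (C (x t))" using nonneg by auto
        then show ?thesis by (simp add: h_def d1_def algebra_simps)
      qed
    qed (use e2 e0 cs in \<open>auto intro!: continuous_intros cw cCx\<close>)
    finally show ?thesis using cs by (simp add: norm1 mult_left_mono)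
  qed
  have bl: "nl \<le> c2 * (norm r2 + n1 + 2 * d2 * e)"
  proof -
    define h where "h s = C_C * norm (C (x s)) + CK * norm (badj U X B (lam s))" for s
    have ch: "continuous_on {0..T} h" unfolding h_def by (intro continuous_intros cCx cBl)
    have h0: "0 \<le> h s" for s using nonneg by (simp add: h_def)
    have "nl \<le> c2 * (norm r2 + norm_1v2 T (\<lambda>s. norm (r1 s)) + norm_1v2 T h)"
      unfolding nl_def c2_def
    proof (rule norm_2w_Green_le[OF T nonneg(4,2) _ _ lam(1) nr(1) _ borel_integrable_atLeastAtMost'[OF ch] h0])
      fix t assume t: "t \<in> {0..T}"
      let ?h = "\<lambda>s. norm (g s) + CK * norm (badj U X B (lam s))"
      have sub: "set_integrable lborel {t..T} (\<lambda>s. norm (g s))"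
        by (rule set_integrable_norm[OF set_integrable_subset[OF g(1)]]) (use t in auto)
      have cC: "continuous_on {t..T} (\<lambda>s. CK * norm (badj U X B (lam s)))"
        by (rule continuous_on_subset[of "{0..T}"]) (use t in \<open>auto intro!: continuous_intros cBl\<close>)
      have "(LINT s:{t..T}|lborel. M2 * exp (- k2 * (s - t)) * ?h s) \<le>
          M2 * (exp_conv k2 T (\<lambda>s. norm (r1 s)) t + exp_conv k2 T h t)"
      proof (rule set_integral_exp_le_exp_conv[OF nr(1) _ borel_integrable_atLeastAtMost'[OF ch] h0])
        show "?h s \<le> norm (r1 s) + h s" if "s \<in> {t..T}" for s
          using norm_triangle_ineq4[of "r1 s" "badj X Y C (C (x s))"]
            badj_norm_le[OF X C nonneg(8) normC, of "C (x s)"] by (simp add: g_def h_def)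
        show "set_integrable lborel {t..T} (\<lambda>s. M2 * exp (- k2 * (s - t)) * ?h s)"
          by (intro set_integrable_mult_continuous continuous_intros set_integral_add(1)[OF sub
                borel_integrable_atLeastAtMost'[OF cC]])
      qed (use t nonneg in auto)
      moreover have "norm (lam t) \<le> M2 * exp (- k2 * (T - t)) * norm r2 + (LINT s:{t..T}|lborel. M2 * exp (- k2 * (s - t)) * ?h s)"
        by (rule stabilizable_costate_bound[OF X U S B K W stableW nonneg(2) g lam r(5) wl t nonneg(5)])
      ultimately show "norm (lam t) \<le> M2 * (exp (- k2 * \<bar>t - T\<bar>) * norm r2 +
          exp_conv k2 T (\<lambda>s. norm (r1 s)) t + exp_conv k2 T h t)"
        using t by (simp add: algebra_simps)
    qed (use T in auto)
    also have "norm_1v2 T h \<le> 2 * d2 * e"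
    proof (rule norm_1v2_combination_le[OF _ _ ch h0])
      show "h t \<le> d2 * (norm (w t) + norm (C (x t)))" if t: "t \<in> {0..T}" for t
      proof -
        \<comment> \<open>The adjoint of \<open>B\<close> applied to \<open>lam\<close> is recovered
          from the control, being the Gram operator of \<open>R\<close> applied to \<open>w\<close>.
          This is where \<open>C_R\<close> enters, squared.\<close>
        have "norm (badj U X B (lam t)) \<le> C_R * norm (R (w t))"
          using badj_norm_le[OF U R nonneg(9) normR, of "R (w t)"] wQ[OF t] by simp
        also have "\<dots> \<le> C_R * (C_R * norm (w t))" by (intro mult_left_mono normR wU t nonneg)
        finally have "CK * norm (badj U X B (lam t)) \<le> CK * (C_R * (C_R * norm (w t)))"
          using nonneg by (intro mult_left_mono) auto
        moreover have "0 \<le> C_C * norm (w t)" "0 \<le> CK * C_R\<^sup>2 * norm (C (x t))" using nonneg by auto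
        ultimately show ?thesis by (simp add: h_def d2_def algebra_simps power2_eq_square)
      qed
    qed (use e2 e0 cs in \<open>auto intro!: continuous_intros cw cCx\<close>)
    finally show ?thesis using cs by (simp add: norm1 mult_left_mono)
  qed
  have en: "min \<alpha> 1 * e\<^sup>2 \<le> (nx + nl) * \<rho>"
    unfolding e2 nx_def nl_def \<rho>_def n1_def n3_def
    by (rule energy_bound[OF X U Y Ss B C R coer T r x lam cw wU wQ wx[unfolded f_def] wl[unfolded g_def]])
  have \<rho>0: "\<rho> \<ge> 0" using nn by (simp add: \<rho>_def)
  have c_eq: "c = (c1 + c2) * (1 + 2 * d1 + 2 * d2)" by (simp add: c_def c1_def c2_def d1_def d2_def)
  have "nx + nl \<le> c * (\<rho> + e)"
  proof -
    have "norm r4 + n3 + 2 * d1 * e \<le> (1 + 2 * d1 + 2 * d2) * (\<rho> + e)"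
      "norm r2 + n1 + 2 * d2 * e \<le> (1 + 2 * d1 + 2 * d2) * (\<rho> + e)"
    proof -
      have "0 \<le> d1 * \<rho>" "0 \<le> d2 * \<rho>" "0 \<le> d1 * e" "0 \<le> d2 * e" using cs \<rho>0 e0 by auto
      then show "norm r4 + n3 + 2 * d1 * e \<le> (1 + 2 * d1 + 2 * d2) * (\<rho> + e)"
        "norm r2 + n1 + 2 * d2 * e \<le> (1 + 2 * d1 + 2 * d2) * (\<rho> + e)"
        using nn e0 by (simp_all add: distrib_left distrib_right) (simp_all add: \<rho>_def)
    qed
    then have "c1 * (norm r4 + n3 + 2 * d1 * e) \<le> c1 * ((1 + 2 * d1 + 2 * d2) * (\<rho> + e))"
      "c2 * (norm r2 + n1 + 2 * d2 * e) \<le> c2 * ((1 + 2 * d1 + 2 * d2) * (\<rho> + e))"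
      using cs by (auto intro: mult_left_mono)
    then have "nx + nl \<le> c1 * ((1 + 2 * d1 + 2 * d2) * (\<rho> + e)) + c2 * ((1 + 2 * d1 + 2 * d2) * (\<rho> + e))"
      using bx bl by linarith
    then show ?thesis by (simp add: c_eq distrib_right mult.assoc)
  qed
  moreover have c0: "c \<ge> 0" using cs by (simp add: c_eq)
  ultimately have main: "nx + nl \<le> (2 * c + c\<^sup>2 / min \<alpha> 1) * \<rho>"
    using quadratic_absorption[OF _ _ \<rho>0 c0 e0 _ en] nonneg nn by simp
  have "sol_norm T x lam \<le> nx + nl"
    unfolding sol_norm_def nx_def[symmetric] nl_def[symmetric]
    by (rule sqrt_sum_squares_le_sum[OF nn(1,2)])
  also note main
  also have "(2 * c + c\<^sup>2 / min \<alpha> 1) * \<rho> \<le> (2 * c + c\<^sup>2 / min \<alpha> 1) * (4 * rhs_norm T r1 r2 r3 r4)"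
  proof (intro mult_left_mono)
    \<comment> \<open>\<open>\<rho>\<close> is a sum of four components, each at most their
      Euclidean norm; hence the factor 4.\<close>
    have "norm r2 \<le> rhs_norm T r1 r2 r3 r4" "norm r4 \<le> rhs_norm T r1 r2 r3 r4"
      "n1 \<le> rhs_norm T r1 r2 r3 r4" "n3 \<le> rhs_norm T r1 r2 r3 r4"
      unfolding rhs_norm_def n1_def[symmetric] n3_def[symmetric] by (intro real_le_rsqrt; simp)+
    then show "\<rho> \<le> 4 * rhs_norm T r1 r2 r3 r4" by (simp add: \<rho>_def)
    show "0 \<le> 2 * c + c\<^sup>2 / min \<alpha> 1" using c0 nonneg by simp
  qed
  finally show ?thesis by (simp only: mult.assoc)
qed

theorem mainTheorem2:
  fixes X :: "'o \<Rightarrow> 'x::{real_inner,banach,second_countable_topology} set"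
    and U :: "'o \<Rightarrow> 'u::{real_inner,banach} set"
    and Y :: "'o \<Rightarrow> 'y::{real_inner,banach} set"
    and D :: "'o \<Rightarrow> 'x set" and A :: "'o \<Rightarrow> 'x \<Rightarrow> 'x"
    and S :: "'o \<Rightarrow> real \<Rightarrow> 'x \<Rightarrow> 'x"
    and B :: "'o \<Rightarrow> 'u \<Rightarrow> 'x" and C :: "'o \<Rightarrow> 'x \<Rightarrow> 'y" and R :: "'o \<Rightarrow> 'u \<Rightarrow> 'u"
    and C_B C_C C_R \<alpha> :: real
  assumes spaces: "\<And>\<Omega>. closed_subspace (X \<Omega>) \<and> closed_subspace (U \<Omega>) \<and> closed_subspace (Y \<Omega>)"
    and gen: "\<And>\<Omega>. generates (X \<Omega>) (D \<Omega>) (A \<Omega>) (S \<Omega>)"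
    and opB: "\<And>\<Omega>. bop (U \<Omega>) (X \<Omega>) (B \<Omega>)"
    and opC: "\<And>\<Omega>. bop (X \<Omega>) (Y \<Omega>) (C \<Omega>)"
    and opR: "\<And>\<Omega>. bop (U \<Omega>) (U \<Omega>) (R \<Omega>)"
    and stab: "du_exp_stabilizable X D A U B"
    and detect: "du_exp_detectable X D A Y C"
    and pos: "C_B > 0" "C_C > 0" "C_R > 0" "\<alpha> > 0"
    and normB: "\<And>\<Omega> u. u \<in> U \<Omega> \<Longrightarrow> norm (B \<Omega> u) \<le> C_B * norm u"
    and normC: "\<And>\<Omega> x. x \<in> X \<Omega> \<Longrightarrow> norm (C \<Omega> x) \<le> C_C * norm x"
    and normR: "\<And>\<Omega> u. u \<in> U \<Omega> \<Longrightarrow> norm (R \<Omega> u) \<le> C_R * norm u"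
    and coerc: "\<And>\<Omega> u. u \<in> U \<Omega> \<Longrightarrow> (norm (R \<Omega> u))\<^sup>2 \<ge> \<alpha> * (norm u)\<^sup>2"
  shows "\<exists>c>0. \<forall>T>0. \<forall>\<Omega> r1 r2 r3 r4 x lam.
           rhs_admissible (X \<Omega>) T r1 r2 r3 r4 \<longrightarrow>
           mild_opt_solution (X \<Omega>) (U \<Omega>) (Y \<Omega>) (S \<Omega>) (B \<Omega>) (C \<Omega>) (R \<Omega>) T r1 r2 r3 r4 x lam \<longrightarrow>
           sol_norm T x lam \<le> c * rhs_norm T r1 r2 r3 r4"
proof -
  obtain K CK W where K: "\<And>\<Omega>. bop (X \<Omega>) (U \<Omega>) (K \<Omega>)" "\<And>\<Omega> x. x \<in> X \<Omega> \<Longrightarrow> norm (K \<Omega> x) \<le> CK * norm x"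
    and W: "\<And>\<Omega>. generates (X \<Omega>) (D \<Omega>) (\<lambda>x. A \<Omega> x + B \<Omega> (K \<Omega> x)) (W \<Omega>)" and sW: "du_exp_stable X W"
    using stab unfolding du_exp_stabilizable_def by blast
  obtain L CL V where L: "\<And>\<Omega>. bop (X \<Omega>) (Y \<Omega>) (L \<Omega>)" "\<And>\<Omega> x. x \<in> X \<Omega> \<Longrightarrow> norm (L \<Omega> x) \<le> CL * norm x"
    and V: "\<And>\<Omega>. generates (X \<Omega>) (uadj_dom (X \<Omega>) (D \<Omega>) (A \<Omega>))
      (\<lambda>x. uadj (X \<Omega>) (D \<Omega>) (A \<Omega>) x + badj (X \<Omega>) (Y \<Omega>) (C \<Omega>) (L \<Omega> x)) (V \<Omega>)" and sV: "du_exp_stable X V"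
    using detect unfolding du_exp_detectable_def du_exp_stabilizable_def by blast
  obtain M2 k2 where M2: "M2 > 0" "k2 > 0"
    "\<And>\<Omega> t x. t \<ge> 0 \<Longrightarrow> x \<in> X \<Omega> \<Longrightarrow> norm (W \<Omega> t x) \<le> M2 * exp (- k2 * t) * norm x"
    using sW unfolding du_exp_stable_def by blast
  obtain M1 k1 where M1: "M1 > 0" "k1 > 0"
    "\<And>\<Omega> t x. t \<ge> 0 \<Longrightarrow> x \<in> X \<Omega> \<Longrightarrow> norm (V \<Omega> t x) \<le> M1 * exp (- k1 * t) * norm x"
    using sV unfolding du_exp_stable_def by blast
  \<comment> \<open>The bounds from stabilizability and detectability come without a sign (on zero
    spaces a negative constant satisfies them), so absolute values are used from here on.\<close>
  have K': "norm (K \<Omega> x) \<le> \<bar>CK\<bar> * norm x" if "x \<in> X \<Omega>" for \<Omega> x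
    using K(2)[OF that] by (meson abs_ge_self mult_right_mono norm_ge_zero order_trans)
  have L': "norm (L \<Omega> x) \<le> \<bar>CL\<bar> * norm x" if "x \<in> X \<Omega>" for \<Omega> x
    using L(2)[OF that] by (meson abs_ge_self mult_right_mono norm_ge_zero order_trans)
  \<comment> \<open>Only constants common to all domains occur, so \<open>c\<close> is fixed before
    \<open>T\<close> and \<open>\<Omega>\<close> are chosen.\<close>
  define c where "c = (2 * M1 * (1 + 1 / sqrt k1 + 2 / k1) + 2 * M2 * (1 + 1 / sqrt k2 + 2 / k2)) *
      (1 + 2 * (C_B + \<bar>CL\<bar>) + 2 * (C_C + \<bar>CK\<bar> * C_R\<^sup>2))"
  define c' where "c' = (2 * c + c\<^sup>2 / min \<alpha> 1) * 4"
  have "c > 0"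
    unfolding c_def using M1(1,2) M2(1,2) pos by (intro mult_pos_pos add_pos_pos add_pos_nonneg) auto
  then have "c' > 0"
    unfolding c'_def using pos by (intro mult_pos_pos add_pos_nonneg) auto
  moreover have "sol_norm T x lam \<le> c' * rhs_norm T r1 r2 r3 r4"
    if "T > 0" "rhs_admissible (X \<Omega>) T r1 r2 r3 r4"
      "mild_opt_solution (X \<Omega>) (U \<Omega>) (Y \<Omega>) (S \<Omega>) (B \<Omega>) (C \<Omega>) (R \<Omega>) T r1 r2 r3 r4 x lam"
    for T \<Omega> r1 r2 r3 r4 x lam
  proof -
    have sp: "closed_subspace (X \<Omega>)" "closed_subspace (U \<Omega>)" "closed_subspace (Y \<Omega>)"
      using spaces[of \<Omega>] by auto
    show ?thesis
      unfolding c'_def c_def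
      by (rule optimality_system_bound[OF sp gen opB opC opR W K(1) K' M2(3) V L(1) L' M1(3)
            _ _ _ _ _ _ _ _ _ _ normB normC normR coerc that])
        (use M1(1,2) M2(1,2) pos in auto)
  qed
  ultimately show ?thesis by blast
qed

end
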